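(* Let $K$ be a compact subset of a closed surface $\mathcal{S}$. Then the following assertions are equivalent. (1) $K$ is a Peano compactum. (2) $\mathcal{D}_K(x)=\{x\}$ for all $x\in K$, where $\mathcal{D}_K(x)$ is the class of $x$ under the Schönflies equivalence $\sim_K$. (3) The Schönflies relation is trivial, i.e. $R_K=\{(x,x): x\in K\}$.
   Context: A closed surface is a compact connected $2$-manifold without boundary. A continuum is a connected compact metric space (possibly a single point). Peano compactum: a compact metric space such that for every $\varepsilon>0$ at most finitely many components have diameter greater than $\varepsilon$, and every nondegenerate component is a Peano continuum (equivalently, is locally connected). Marked quadrilateral in $\mathcal{S}$: a triple $(Q,I_1,I_2)$ with $Q\subset\mathcal{S}$ homeomorphic to $[0,1]^2$ and $I_1,I_2\subset\partial Q$ two disjoint closed arcs (where $\partial Q$ is the boundary curve of $Q$). Schönflies relation $R_K\subset K\times K$: $(x,y)\in R_K$ iff $x=y$ or there is a marked quadrilateral $(Q,I_1,I_2)$ in $\mathcal{S}$ such that (a) $x\in I_1$, $y\in I_2$ and $K\cap\partial Q\subset I_1\cup I_2$; (b) $K\cap Q$ has infinitely many (pairwise distinct) components $Q_n$ $(n\ge1)$ with $Q_n\cap I_i\neq\emptyset$ for each $i\in\{1,2\}$; (c) $(Q_n)_{n\ge1}$ converges with respect to Hausdorff distance to a continuum $Q_\infty$ with $x,y\in Q_\infty$. Schönflies equivalence $\sim_K$: the smallest closed equivalence relation on $K$ (closed as a subset of $K\times K$) containing $R_K$. $\mathcal{D}_K$ is the collection of its classes. *)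

theory Defs
  imports "HOL-Analysis.Analysis"
begin

text \<open>
  A closed surface is metrizable, so it is rendered as a subset of a metric space, carrying the
  restricted metric. All notions below that mention the metric (Hausdorff convergence of compact
  sets, diameters of components of a compact set) depend only on the topology.
\<close>

definition closed_surface :: "'a::metric_space set \<Rightarrow> bool" where
  "closed_surface S \<longleftrightarrow> S \<noteq> {} \<and> compact S \<and> connected S \<and>
     (\<forall>x\<in>S. \<exists>U (V :: (real^2) set).
        openin (top_of_set S) U \<and> x \<in> U \<and> open V \<and> U homeomorphic V)"

definition continuum :: "'a::metric_space set \<Rightarrow> bool" where
  "continuum C \<longleftrightarrow> C \<noteq> {} \<and> compact C \<and> connected C"

definition peano_continuum :: "'a::metric_space set \<Rightarrow> bool" where
  "peano_continuum C \<longleftrightarrow> continuum C \<and> locally connected C"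

definition peano_compactum :: "'a::metric_space set \<Rightarrow> bool" where
  "peano_compactum K \<longleftrightarrow> compact K \<and>
     (\<forall>\<epsilon>>0. finite {C \<in> components K. diameter C > \<epsilon>}) \<and>
     (\<forall>C\<in>components K. \<not> (\<exists>a. C = {a}) \<longrightarrow> peano_continuum C)"

text \<open>The two suprema are the genuine ones whenever both sets are nonempty and bounded.\<close>

definition hausdorff_distance :: "'a::metric_space set \<Rightarrow> 'a set \<Rightarrow> real" where
  "hausdorff_distance A B = max (SUP a\<in>A. infdist a B) (SUP b\<in>B. infdist b A)"

abbreviation unit_square :: "(real \<times> real) set" where
  "unit_square \<equiv> {0..1} \<times> {0..1}"

text \<open>
  The boundary curve is intrinsic to \<open>Q\<close>; by invariance of domain it does not depend on the
  parametrization, see \<open>disk_boundary_eq\<close>.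
\<close>

definition disk_boundary :: "'a::metric_space set \<Rightarrow> 'a set" where
  "disk_boundary Q = {x. \<exists>h g. homeomorphism unit_square Q h g \<and> x \<in> h ` frontier unit_square}"

lemma disk_boundary_eq:
  assumes h: "homeomorphism unit_square Q h g"
  shows "disk_boundary Q = h ` frontier unit_square"
proof
  show "h ` frontier unit_square \<subseteq> disk_boundary Q"
    using h unfolding disk_boundary_def by blast
  have cl: "closed unit_square"
    by (intro closed_Times) auto
  show "disk_boundary Q \<subseteq> h ` frontier unit_square"
  proof
    fix x assume "x \<in> disk_boundary Q"
    then obtain h' g' y where h': "homeomorphism unit_square Q h' g'"
      and y: "y \<in> frontier unit_square" and x: "x = h' y"
      unfolding disk_boundary_def by auto
    have ysq: "y \<in> unit_square"
      using y cl frontier_subset_eq by blast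
    have xQ: "x \<in> Q"
      using h' ysq x by (auto simp: homeomorphism_def)
    have hgx: "h (g x) = x" and gx: "g x \<in> unit_square"
      using h xQ homeomorphism_apply2 homeomorphism_image2 by (blast, blast)
    have k: "homeomorphism unit_square unit_square (g' \<circ> h) (g \<circ> h')"
      using homeomorphism_compose [OF h homeomorphism_symD [OF h']] .
    have "g x \<notin> interior unit_square"
    proof
      assume "g x \<in> interior unit_square"
      moreover have "open ((g' \<circ> h) ` interior unit_square)"
      proof (rule invariance_of_domain)
        show "continuous_on (interior unit_square) (g' \<circ> h)"
          using k by (meson homeomorphism_cont1 interior_subset continuous_on_subset)
        show "inj_on (g' \<circ> h) (interior unit_square)"
          by (rule inj_on_subset [OF inj_on_inverseI interior_subset],
              rule homeomorphism_apply1 [OF k])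
      qed auto
      moreover have "(g' \<circ> h) ` interior unit_square \<subseteq> unit_square"
        using homeomorphism_image1 [OF k] by (metis image_mono interior_subset)
      ultimately have "(g' \<circ> h) (g x) \<in> interior unit_square"
        by (meson image_eqI interior_maximal subsetD)
      moreover have "(g' \<circ> h) (g x) = y"
        using hgx x h' ysq by (auto simp: homeomorphism_def)
      ultimately show False
        using y by (simp add: frontier_def)
    qed
    then have "g x \<in> frontier unit_square"
      using gx cl by (simp add: frontier_def closure_closed)
    then show "x \<in> h ` frontier unit_square"
      using hgx by (metis image_eqI)
  qed
qed

definition marked_quadrilateral ::
  "'a::metric_space set \<Rightarrow> 'a set \<Rightarrow> 'a set \<Rightarrow> 'a set \<Rightarrow> bool" where
  "marked_quadrilateral S Q I1 I2 \<longleftrightarrow>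
     Q \<subseteq> S \<and> Q homeomorphic unit_square \<and>
     (\<exists>\<gamma>. arc \<gamma> \<and> path_image \<gamma> = I1) \<and> (\<exists>\<gamma>. arc \<gamma> \<and> path_image \<gamma> = I2) \<and>
     I1 \<subseteq> disk_boundary Q \<and> I2 \<subseteq> disk_boundary Q \<and> I1 \<inter> I2 = {}"

definition schoenflies_relation :: "'a::metric_space set \<Rightarrow> 'a set \<Rightarrow> ('a \<times> 'a) set" where
  "schoenflies_relation S K = {(x, y) \<in> K \<times> K. x = y \<or>
     (\<exists>Q I1 I2. marked_quadrilateral S Q I1 I2 \<and>
        x \<in> I1 \<and> y \<in> I2 \<and> K \<inter> disk_boundary Q \<subseteq> I1 \<union> I2 \<and>
        (\<exists>(Qn :: nat \<Rightarrow> 'a set) Qinf.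
           inj Qn \<and> (\<forall>n. Qn n \<in> components (K \<inter> Q) \<and> Qn n \<inter> I1 \<noteq> {} \<and> Qn n \<inter> I2 \<noteq> {}) \<and>
           continuum Qinf \<and> (\<lambda>n. hausdorff_distance (Qn n) Qinf) \<longlonglongrightarrow> 0 \<and>
           x \<in> Qinf \<and> y \<in> Qinf))}"

definition schoenflies_equivalence :: "'a::metric_space set \<Rightarrow> 'a set \<Rightarrow> ('a \<times> 'a) set" where
  "schoenflies_equivalence S K =
     \<Inter>{E. equiv K E \<and> closedin (top_of_set (K \<times> K)) E \<and> schoenflies_relation S K \<subseteq> E}"

definition schoenflies_class :: "'a::metric_space set \<Rightarrow> 'a set \<Rightarrow> 'a \<Rightarrow> 'a set" where
  "schoenflies_class S K x = schoenflies_equivalence S K `` {x}"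

end

theory Submission
  imports Defs "HOL-Complex_Analysis.Great_Picard"
begin

text \<open>
  If \<open>K\<close> is a Peano compactum and the components \<open>Q\<^sub>n\<close> of \<open>K \<inter> Q\<close> join the disjoint arcs \<open>I\<^sub>1, I\<^sub>2\<close>, then
  infinitely many \<open>Q\<^sub>n\<close> lie in one locally connected component of \<open>K\<close>. Their limit joins \<open>I\<^sub>1\<close> to \<open>I\<^sub>2\<close>, so
  it has a point interior to \<open>Q\<close>, and local connectedness there contradicts that the \<open>Q\<^sub>n\<close> are
  distinct components.

  If \<open>K\<close> is not a Peano compactum, then some chart contains a square annulus that is crossed by
  infinitely many components of \<open>K\<close> intersected with the annulus. Two of them are separated by a
  splitting of this intersection into disjoint compact sets, so Janiszewski's theorem yields two disjoint arcs
  across the annulus that avoid \<open>K\<close>; they may be taken in the lines of a fine square grid. The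
  theta-curve theorem shows that these arcs cut the annulus into two Jordan domains, one of which
  contains infinitely many crossing components. Its closure is a disk by the Schoenflies theorem,
  which for curves in a grid follows by repeatedly cutting along grid segments. Compactness then
  supplies a Hausdorff convergent subsequence.
\<close>

section \<open>Gluing disks along an arc\<close>

text \<open>The relation asks for a genuine disk whose boundary meets K only inside two disjoint
  arcs, so the other two sides must avoid K. The marked arcs come from the boundary squares of the
  annulus and the sides from Janiszewski's theorem. It is applied twice: the second time the first
  side is adjoined to one of the two compact pieces and acts there as the connected crossing set, so
  the second side avoids it too. Squares instead of round circles put all four sides in the lines of
  one grid, and induction on the number of enclosed cells then shows that the region is a disk. Both
  ways of failing to be a Peano compactum lead to one statement: for some point p and every small
  closed D around p, infinitely many components of K \<inter> D meet a prescribed neighbourhood of p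
  and reach the relative boundary of D. Boundary bumping turns these into components that cross the
  annulus.\<close>

lemma homeomorphism_factor:
  fixes g :: "'a::topological_space \<Rightarrow> 'b::t2_space" and h :: "'a \<Rightarrow> 'c::t2_space"
  assumes T: "compact T" and g: "continuous_on T g" and h: "continuous_on T h"
    and eq: "\<And>s t. s \<in> T \<Longrightarrow> t \<in> T \<Longrightarrow> g s = g t \<longleftrightarrow> h s = h t"
  obtains \<phi> \<psi> where "homeomorphism (g ` T) (h ` T) \<phi> \<psi>" "\<And>t. t \<in> T \<Longrightarrow> \<phi> (g t) = h t"
proof -
  define \<phi> where "\<phi> = (\<lambda>x. h (SOME t. t \<in> T \<and> g t = x))"
  have \<phi>: "\<phi> (g t) = h t" if "t \<in> T" for t
  proof -
    have "(SOME s. s \<in> T \<and> g s = g t) \<in> T \<and> g (SOME s. s \<in> T \<and> g s = g t) = g t"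
      by (rule someI[of "\<lambda>s. s \<in> T \<and> g s = g t" t]) (simp add: that)
    then show ?thesis
      unfolding \<phi>_def using eq that by blast
  qed
  \<comment> \<open>\<open>\<phi>\<close> is well defined because \<open>g\<close> and
    \<open>h\<close> have the same fibres. A closed set in the target is pulled back by
    \<open>h\<close> to a compact subset of \<open>T\<close>, and its image under \<open>g\<close>
    is compact, hence closed, and is the preimage under \<open>\<phi>\<close>.\<close>
  have cont: "continuous_on (g ` T) \<phi>"
    unfolding continuous_on_closed_invariant
  proof (intro allI impI)
    fix B :: "'c set" assume "closed B"
    then have "closedin (top_of_set T) (T \<inter> h -` B)"
      using h continuous_closedin_preimage by blast
    then have "compact (T \<inter> h -` B)"
      using T closedin_compact by blast
    then have "compact (g ` (T \<inter> h -` B))"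
      using g by (meson compact_continuous_image continuous_on_subset inf_le1)
    then have "closed (g ` (T \<inter> h -` B))"
      by (rule compact_imp_closed)
    moreover have "g ` (T \<inter> h -` B) \<inter> g ` T = \<phi> -` B \<inter> g ` T"
      using \<phi> by auto
    ultimately show "\<exists>A. closed A \<and> A \<inter> g ` T = \<phi> -` B \<inter> g ` T"
      by blast
  qed
  have comp: "compact (g ` T)"
    using g T by (rule compact_continuous_image)
  have im: "\<phi> ` (g ` T) = h ` T"
    unfolding image_image using \<phi> by (rule image_cong[OF refl])
  have inj: "inj_on \<phi> (g ` T)"
    using \<phi> eq by (auto simp: inj_on_def)
  obtain \<psi> where "homeomorphism (g ` T) (h ` T) \<phi> \<psi>"
    using homeomorphism_compact[OF comp cont im inj] by blast
  then show thesis
    by (rule that) (rule \<phi>)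
qed

lemma simple_loop_eq_iff:
  assumes "simple_path g" "pathfinish g = pathstart g" "s \<in> {0..1}" "t \<in> {0..1}"
  shows "g s = g t \<longleftrightarrow> s = t \<or> {s, t} = {0, 1}"
proof
  show "g s = g t \<Longrightarrow> s = t \<or> {s, t} = {0, 1}"
    using assms(1,3,4) unfolding simple_path_def loop_free_def by blast
  show "s = t \<or> {s, t} = {0, 1} \<Longrightarrow> g s = g t"
    using assms(2) unfolding pathfinish_def pathstart_def by (auto simp: doubleton_eq_iff)
qed

text \<open>Two simple loops have the same fibres, since each identifies only the parameters 0 and
  1; matching parameters therefore defines a homeomorphism of the images.\<close>

lemma homeomorphism_simple_loops:
  fixes g :: "real \<Rightarrow> 'a::t2_space" and h :: "real \<Rightarrow> 'b::t2_space"
  assumes "simple_path g" "pathfinish g = pathstart g" "simple_path h" "pathfinish h = pathstart h"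
  obtains \<phi> \<psi> where "homeomorphism (path_image g) (path_image h) \<phi> \<psi>"
    "\<And>t. t \<in> {0..1} \<Longrightarrow> \<phi> (g t) = h t"
proof -
  have cont: "continuous_on {0..1} g" "continuous_on {0..1} h"
    using assms simple_path_imp_path path_def by (blast, blast)
  have eq: "g s = g t \<longleftrightarrow> h s = h t" if "s \<in> {0..1}" "t \<in> {0..1}" for s t
    using simple_loop_eq_iff[OF assms(1,2) that] simple_loop_eq_iff[OF assms(3,4) that] by simp
  show thesis
  proof (rule homeomorphism_factor[OF compact_Icc cont eq])
    fix \<phi> \<psi>
    assume "homeomorphism (g ` {0..1}) (h ` {0..1}) \<phi> \<psi>" and "\<And>t. t \<in> {0..1} \<Longrightarrow> \<phi> (g t) = h t"
    then show thesis
      by (rule that[unfolded path_image_def])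
  qed
qed

text \<open>Alexander's cone construction: \<open>\<phi>\<close> is extended radially. Norms are
  preserved, which gives continuity at the origin and reduces injectivity and surjectivity to the
  sphere.\<close>

lemma homeomorphism_cball_extension:
  fixes \<phi> :: "'a::euclidean_space \<Rightarrow> 'a"
  assumes "homeomorphism (sphere 0 1) (sphere 0 1) \<phi> \<psi>"
  obtains F G where "homeomorphism (cball 0 1) (cball 0 1) F G" "\<And>x. x \<in> sphere 0 1 \<Longrightarrow> F x = \<phi> x"
proof -
  \<comment> \<open>At \<open>x = 0\<close> the quotient is \<open>0\<close> and
    \<open>\<phi> 0\<close> is arbitrary, but the factor \<open>norm x\<close> makes the value
    \<open>0\<close>.\<close>
  define F where "F = (\<lambda>x. norm x *\<^sub>R \<phi> (x /\<^sub>R norm x))"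
  have \<phi>1: "norm (\<phi> x) = 1" if "norm x = 1" for x
    using assms that unfolding homeomorphism_def by force
  have contphi: "continuous_on (sphere 0 1) \<phi>"
    using assms homeomorphism_cont1 by blast
  have nF: "norm (F x) = norm x" for x
  proof (cases "x = 0")
    case False
    then show ?thesis by (simp add: F_def \<phi>1)
  qed (simp add: F_def)
  have cont: "continuous_on UNIV F"
  proof (rule continuous_at_imp_continuous_on, rule ballI)
    fix x :: 'a
    show "isCont F x"
    proof (cases "x = 0")
      case True
      have "((\<lambda>y. norm (F y)) \<longlongrightarrow> 0) (at 0)"
        unfolding nF by (intro tendsto_eq_intros | simp)+
      then show ?thesis
        using True nF[of 0] by (simp add: isCont_def tendsto_norm_zero_iff)
    next
      case False
      have "(\<lambda>x :: 'a. x /\<^sub>R norm x) ` (- {0}) \<subseteq> sphere 0 1"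
        by (rule image_subsetI) simp
      then have "continuous_on (- {0}) (\<lambda>x. \<phi> (x /\<^sub>R norm x))"
        by (rule continuous_on_compose2[OF contphi, rotated]) (intro continuous_intros; simp)
      then have "continuous_on (- {0}) F"
        unfolding F_def by (intro continuous_intros)
      then show ?thesis
        using False by (simp add: continuous_on_eq_continuous_at open_Compl)
    qed
  qed
  have inj: "inj_on F (cball 0 1)"
  proof (rule inj_onI)
    fix x y :: 'a assume eq: "F x = F y"
    then have n: "norm x = norm y" by (metis nF)
    show "x = y"
    proof (cases "x = 0")
      case False
      then have y: "y \<noteq> 0" using n by force
      have "\<phi> (x /\<^sub>R norm x) = \<phi> (y /\<^sub>R norm y)"
        using eq n False y by (simp add: F_def)
      moreover have "x /\<^sub>R norm x \<in> sphere 0 1" "y /\<^sub>R norm y \<in> sphere 0 1"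
        using False y by auto
      ultimately have "x /\<^sub>R norm x = y /\<^sub>R norm y"
        using homeomorphism_apply1[OF assms] by metis
      then show ?thesis using n False y by simp
    qed (use n in auto)
  qed
  have surj: "F ` cball 0 1 = cball 0 1"
  proof
    show "cball 0 1 \<subseteq> F ` cball 0 1"
    proof
      fix y :: 'a assume y: "y \<in> cball 0 1"
      show "y \<in> F ` cball 0 1"
      proof (cases "y = 0")
        case True
        then show ?thesis by (intro image_eqI[of _ _ 0]) (auto simp: F_def)
      next
        case False
        define u where "u = \<psi> (y /\<^sub>R norm y)"
        have "y /\<^sub>R norm y \<in> sphere 0 1"
          using False by simp
        then have u: "norm u = 1" "\<phi> u = y /\<^sub>R norm y"
          using assms unfolding homeomorphism_def u_def by force+
        have "F (norm y *\<^sub>R u) = y"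
          using u False by (simp add: F_def)
        then show ?thesis
          using u y by (intro image_eqI[of _ _ "norm y *\<^sub>R u"]) auto
      qed
    qed
  qed (use nF in auto)
  obtain G where "homeomorphism (cball 0 1) (cball 0 1) F G"
    using homeomorphism_compact[OF compact_cball continuous_on_subset[OF cont] surj inj] by auto
  then show thesis
    using that by (simp add: F_def)
qed

text \<open>Invariance of domain in equal dimensions sends interior points to interior points under
  both \<open>f\<close> and \<open>g\<close>.\<close>

lemma homeomorphism_image_frontier:
  fixes f :: "'a::euclidean_space \<Rightarrow> 'b::euclidean_space"
  assumes h: "homeomorphism S T f g" and "closed S" "closed T" "DIM('a) = DIM('b)"
  shows "f ` frontier S = frontier T"
proof -
  have inj: "inj_on f S" "inj_on g T"
    using h by (metis homeomorphism_def inj_on_inverseI)+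
  have "g ` interior T \<subseteq> interior S"
    using continuous_image_subset_interior[OF homeomorphism_cont2[OF h] inj(2)] h assms(4)
    by (auto simp: homeomorphism_def Pi_iff)
  moreover have "f ` interior S \<subseteq> interior T"
    using continuous_image_subset_interior[OF homeomorphism_cont1[OF h] inj(1)] h assms(4)
    by (auto simp: homeomorphism_def Pi_iff)
  ultimately have "f ` interior S = interior T"
    using h interior_subset[of T] unfolding homeomorphism_def by (force simp: image_iff)
  then show ?thesis
    using inj(1) h assms(2,3) interior_subset[of S]
    by (auto simp: frontier_def inj_on_image_set_diff[of f S] homeomorphism_def)
qed

text \<open>Conjugating \<open>\<phi>\<close> by parametrizations of the disks gives a homeomorphism
  of the unit circle, where the radial extension applies. This control of boundary values is what
  permits gluing.\<close>

lemma homeomorphism_disks_extension: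
  fixes D E :: "complex set"
  assumes D: "D homeomorphic cball (0::complex) 1" and E: "E homeomorphic cball (0::complex) 1"
    and \<phi>: "homeomorphism (frontier D) (frontier E) \<phi> \<psi>"
  obtains F G where "homeomorphism D E F G" "\<And>x. x \<in> frontier D \<Longrightarrow> F x = \<phi> x"
proof -
  have cl: "closed D" "closed E"
    using D E homeomorphic_compactness compact_imp_closed compact_cball by blast+
  obtain p p' where p: "homeomorphism D (cball (0::complex) 1) p p'"
    using D homeomorphic_def by blast
  obtain q q' where q: "homeomorphism E (cball (0::complex) 1) q q'"
    using E homeomorphic_def by blast
  have sub: "frontier D \<subseteq> D" "frontier E \<subseteq> E"
    using cl frontier_subset_eq by blast+
  have "homeomorphism (frontier D) (sphere 0 1) p p'"
    using homeomorphism_of_subsets[OF p sub(1)] homeomorphism_image_frontier[OF p] cl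
    by (auto simp: frontier_cball)
  then have 1: "homeomorphism (sphere 0 1) (frontier D) p' p"
    by (rule homeomorphism_symD)
  have 2: "homeomorphism (frontier E) (sphere 0 1) q q'"
    using homeomorphism_of_subsets[OF q sub(2)] homeomorphism_image_frontier[OF q] cl
    by (auto simp: frontier_cball)
  have "homeomorphism (sphere 0 1) (sphere 0 1) (q \<circ> (\<phi> \<circ> p')) ((p \<circ> \<psi>) \<circ> q')"
    using homeomorphism_compose[OF homeomorphism_compose[OF 1 \<phi>] 2] by simp
  then obtain F G where F: "homeomorphism (cball (0::complex) 1) (cball 0 1) F G"
    "\<And>x. x \<in> sphere 0 1 \<Longrightarrow> F x = (q \<circ> (\<phi> \<circ> p')) x"
    by (rule homeomorphism_cball_extension) blast
  have "homeomorphism D E (q' \<circ> (F \<circ> p)) ((p' \<circ> G) \<circ> q)"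
    using homeomorphism_compose[OF homeomorphism_compose[OF p F(1)] homeomorphism_symD[OF q]]
    by simp
  moreover have "(q' \<circ> (F \<circ> p)) x = \<phi> x" if "x \<in> frontier D" for x
  proof -
    have "p x \<in> sphere 0 1" "p' (p x) = x" "\<phi> x \<in> frontier E"
      using that 1 \<phi> unfolding homeomorphism_def by blast+
    then show ?thesis
      using F(2)[of "p x"] 2 unfolding homeomorphism_def by auto
  qed
  ultimately show thesis
    using that by blast
qed

lemma frontier_Un_inside_simple_loop:
  fixes g :: "real \<Rightarrow> complex"
  assumes "simple_path g" "pathfinish g = pathstart g"
  shows "frontier (path_image g \<union> inside (path_image g)) = path_image g"
proof -
  note J = Jordan_inside_outside[OF assms]
  have "path_image g \<union> inside (path_image g) = - outside (path_image g)"
    by (rule union_with_inside)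
  then show ?thesis
    using J by (simp add: frontier_complement)
qed

abbreviation bounds_disk :: "complex set \<Rightarrow> bool" where
  "bounds_disk J \<equiv> (J \<union> inside J) homeomorphic cball (0::complex) 1"

lemma simple_path_two_arcs:
  fixes c :: "real \<Rightarrow> 'a::real_normed_vector"
  assumes "arc c" "arc d" "pathstart c = a" "pathfinish c = b" "pathstart d = a" "pathfinish d = b"
    "path_image c \<inter> path_image d = {a, b}"
  shows "simple_path (c +++ reversepath d)" "pathfinish (c +++ reversepath d) = pathstart (c +++ reversepath d)"
    "path_image (c +++ reversepath d) = path_image c \<union> path_image d"
  using assms by (auto simp: simple_path_join_loop_eq arc_reversepath path_image_join)

text \<open>The boundary values are prescribed so that \<open>c\<close> runs along the bottom side
  with its own parameter; maps of two disks that share \<open>c\<close> then agree on it by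
  construction.\<close>

lemma disk_to_rectangle:
  assumes "arc c" "arc d" "pathstart c = a" "pathfinish c = b" "pathstart d = a" "pathfinish d = b"
    "path_image c \<inter> path_image d = {a, b}" and D: "bounds_disk (path_image c \<union> path_image d)"
  obtains F G where
    "homeomorphism (path_image c \<union> path_image d \<union> inside (path_image c \<union> path_image d))
       (cbox (-1) (1 + \<i>)) F G"
    "\<And>t. t \<in> {0..1} \<Longrightarrow> F (c t) = linepath (-1) 1 t"
proof -
  note g = simple_path_two_arcs[OF assms(1-7)]
  define r where "r = rectpath (-1) (1 + \<i>)"
  have r: "simple_path r" "pathfinish r = pathstart r" "path_image r = frontier (cbox (-1) (1 + \<i>))"
    unfolding r_def
    by (auto simp: simple_path_rectpath path_image_rectpath_cbox_minus_box frontier_cbox)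
  obtain \<phi> \<psi> where \<phi>: "homeomorphism (path_image c \<union> path_image d) (path_image r) \<phi> \<psi>"
    "\<And>t. t \<in> {0..1} \<Longrightarrow> \<phi> ((c +++ reversepath d) t) = r t"
    using homeomorphism_simple_loops[OF g(1,2) r(1,2)] g(3) by metis
  have fr: "frontier (path_image c \<union> path_image d \<union> inside (path_image c \<union> path_image d)) = path_image c \<union> path_image d"
    using frontier_Un_inside_simple_loop[OF g(1,2)] g(3) by simp
  have ne: "box (-1) (1 + \<i>) \<noteq> {}"
    by (simp add: box_ne_empty Basis_complex_def)
  have E: "cbox (-1) (1 + \<i>) homeomorphic cball (0::complex) 1"
    using ne by (intro homeomorphic_convex_compact_cball) auto
  obtain F G where F: "homeomorphism (path_image c \<union> path_image d \<union> inside (path_image c \<union> path_image d))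
       (cbox (-1) (1 + \<i>)) F G" "\<And>x. x \<in> path_image c \<union> path_image d \<Longrightarrow> F x = \<phi> x"
    using homeomorphism_disks_extension[OF D E, of \<phi> \<psi>] \<phi>(1) r(3) fr by metis
  \<comment> \<open>In both joined loops the first leg occupies the parameters from 0 to 1/2, so
    \<open>c\<close> at \<open>t\<close> corresponds to the rectangle path at \<open>t / 2\<close>,
    a point of the bottom side.\<close>
  have base: "F (c t) = linepath (-1) 1 t" if "t \<in> {0..1}" for t
  proof -
    have "F (c t) = \<phi> (c t)"
      using F(2) that by (simp add: path_image_def)
    also have "\<dots> = \<phi> ((c +++ reversepath d) (t / 2))"
      using that by (simp add: joinpaths_def)
    also have "\<dots> = r (t / 2)"
      using \<phi>(2)[of "t / 2"] that by simp
    also have "\<dots> = linepath (-1) 1 t"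
      using that by (simp add: r_def rectpath_def joinpaths_def Let_def complex_eq_iff linepath_def)
    finally show ?thesis .
  qed
  show thesis
    by (rule that[OF F(1) base])
qed

text \<open>One disk is mapped to the upper half of a rectangle, the other one to the lower half, so that
  both maps agree on the common arc.\<close>

lemma homeomorphic_disk_glue:
  assumes c: "arc c" "pathstart c = a" "pathfinish c = b"
    and d: "arc d" "pathstart d = a" "pathfinish d = b" "path_image c \<inter> path_image d = {a, b}"
    and e: "arc e" "pathstart e = a" "pathfinish e = b" "path_image c \<inter> path_image e = {a, b}"
    and D: "bounds_disk (path_image c \<union> path_image d)" and E: "bounds_disk (path_image c \<union> path_image e)"
    and int: "(path_image c \<union> path_image d \<union> inside (path_image c \<union> path_image d)) \<inter>
              (path_image c \<union> path_image e \<union> inside (path_image c \<union> path_image e)) = path_image c"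
  shows "(path_image c \<union> path_image d \<union> inside (path_image c \<union> path_image d)) \<union>
         (path_image c \<union> path_image e \<union> inside (path_image c \<union> path_image e)) homeomorphic cball (0::complex) 1"
    (is "?D \<union> ?E homeomorphic _")
proof -
  let ?R = "cbox (-1) (1 + \<i>)"
  obtain F F' where F: "homeomorphism ?D ?R F F'" "\<And>t. t \<in> {0..1} \<Longrightarrow> F (c t) = linepath (-1) 1 t"
    using disk_to_rectangle[OF c(1) d(1) c(2,3) d(2,3,4) D] by metis
  obtain G G' where G: "homeomorphism ?E ?R G G'" "\<And>t. t \<in> {0..1} \<Longrightarrow> G (c t) = linepath (-1) 1 t"
    using disk_to_rectangle[OF c(1) e(1) c(2,3) e(2,3,4) E] by metis
  have comp: "compact ?D" "compact ?E"
    using D E homeomorphic_compactness compact_cball by blast+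
  define H where "H = (\<lambda>z. if z \<in> ?D then F z else cnj (G z))"
  \<comment> \<open>On \<open>c\<close> both maps take the same real value, which \<open>cnj\<close>
    fixes.\<close>
  have agree: "F z = cnj (G z)" if "z \<in> ?D \<inter> ?E" for z
  proof -
    have "z \<in> path_image c"
      using that int by blast
    then obtain t where "t \<in> {0..1}" "z = c t"
      unfolding path_image_def by blast
    then show ?thesis
      using F(2) G(2) by (simp add: linepath_def)
  qed
  have HE: "H z = cnj (G z)" if "z \<in> ?E" for z
    using agree that by (auto simp: H_def)
  have HD: "H z = F z" if "z \<in> ?D" for z
    using that by (simp add: H_def)
  have cont: "continuous_on (?D \<union> ?E) H"
  proof (rule continuous_on_closed_Un)
    show "closed ?D" "closed ?E" using comp compact_imp_closed by blast+
    show "continuous_on ?D H"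
      by (rule continuous_on_eq[OF homeomorphism_cont1[OF F(1)]]) (simp add: HD)
    have "continuous_on ?E (\<lambda>z. cnj (G z))"
      by (intro continuous_intros homeomorphism_cont1[OF G(1)])
    then show "continuous_on ?E H"
      by (rule continuous_on_eq) (simp add: HE)
  qed
  \<comment> \<open>\<open>F x\<close> has imaginary part at least 0 and \<open>cnj (G y)\<close> at
    most 0, so equality forces a real value. In either disk such a value is taken only at the
    corresponding point of \<open>c\<close>.\<close>
  have cross: "x = y" if xy: "x \<in> ?D" "y \<in> ?E" and eq: "F x = cnj (G y)" for x y
  proof -
    have mem: "F x \<in> ?R" "G y \<in> ?R"
      using xy F(1) G(1) by (auto simp: homeomorphism_def)
    then have "Im (F x) = 0"
      using eq by (auto simp: in_cbox_complex_iff)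
    then have r: "F x = of_real (Re (F x))" "Re (F x) \<in> {-1..1}"
      using mem by (auto simp: complex_eq_iff in_cbox_complex_iff)
    define t where "t = (Re (F x) + 1) / 2"
    have t: "t \<in> {0..1}" "linepath (-1) 1 t = F x"
      using r \<open>Im (F x) = 0\<close> by (auto simp: t_def linepath_def complex_eq_iff scaleR_conv_of_real field_simps)
    then have ct: "c t \<in> ?D" "c t \<in> ?E"
      by (auto simp: path_image_def)
    have "F (c t) = F x"
      using F(2) t by simp
    then have x: "c t = x"
      using F(1) ct(1) xy(1) by (metis homeomorphism_apply1)
    have "G y = F x"
      using eq \<open>Im (F x) = 0\<close> by (auto simp: complex_eq_iff)
    then have "G (c t) = G y"
      using G(2) t by simp
    then have "c t = y"
      using G(1) ct(2) xy(2) by (metis homeomorphism_apply1)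
    with x show ?thesis by simp
  qed
  have inj: "inj_on H (?D \<union> ?E)"
  proof (rule inj_onI)
    fix x y assume xy: "x \<in> ?D \<union> ?E" "y \<in> ?D \<union> ?E" and eq: "H x = H y"
    consider "x \<in> ?D" "y \<in> ?D" | "x \<in> ?E" "y \<in> ?E" | "x \<in> ?D" "y \<in> ?E" | "x \<in> ?E" "y \<in> ?D"
      using xy by blast
    then show "x = y"
    proof cases
      case 1
      then show ?thesis using eq F(1) HD homeomorphism_apply1 by metis
    next
      case 2
      then have "G x = G y" using eq HE by (metis complex_cnj_cancel_iff)
      then show ?thesis using 2 G(1) homeomorphism_apply1 by metis
    next
      case 3
      then show ?thesis using cross eq HE HD by metis
    next
      case 4
      then show ?thesis using cross eq HE HD by metis
    qed
  qed
  have "H ` (?D \<union> ?E) = H ` ?D \<union> H ` ?E"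
    by (rule image_Un)
  also have "H ` ?D = ?R"
    using F(1) HD by (simp add: homeomorphism_def)
  also have "H ` ?E = cnj ` (G ` ?E)"
    using HE by (simp add: image_image)
  also have "G ` ?E = ?R"
    using G(1) by (simp add: homeomorphism_def)
  also have "?R \<union> cnj ` ?R = cbox (-1 - \<i>) (1 + \<i>)"
  proof -
    have "z \<in> ?R \<union> cnj ` ?R" if z: "z \<in> cbox (-1 - \<i>) (1 + \<i>)" for z
    proof (cases "Im z \<ge> 0")
      case False
      then have "cnj z \<in> ?R" using z by (auto simp: in_cbox_complex_iff)
      then show ?thesis by (metis UnI2 complex_cnj_cnj image_eqI)
    qed (use z in \<open>auto simp: in_cbox_complex_iff\<close>)
    moreover have "?R \<union> cnj ` ?R \<subseteq> cbox (-1 - \<i>) (1 + \<i>)"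
      by (auto simp: in_cbox_complex_iff)
    ultimately show ?thesis
      by blast
  qed
  finally have im: "H ` (?D \<union> ?E) = cbox (-1 - \<i>) (1 + \<i>)" .
  have "?D \<union> ?E homeomorphic cbox (-1 - \<i>) (1 + \<i>)"
    using homeomorphism_compact[OF compact_Un[OF comp] cont im inj] homeomorphic_def by blast
  also have "cbox (-1 - \<i>) (1 + \<i>) homeomorphic cball (0::complex) 1"
  proof (intro homeomorphic_convex_compact_cball)
    have "box (-1 - \<i>) (1 + \<i>) \<noteq> {}"
      by (simp add: box_ne_empty Basis_complex_def)
    then show "interior (cbox (-1 - \<i>) (1 + \<i>)) \<noteq> {}" by simp
  qed auto
  finally show ?thesis .
qed

section \<open>The Schoenflies theorem for grid curves\<close>

text \<open>The lines on which one coordinate is a multiple of 1/N. For \<open>N = 0\<close> every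
  point qualifies, hence the recurring assumption \<open>N > 0\<close>.\<close>

definition grid_lines :: "nat \<Rightarrow> complex set" where
  "grid_lines N = {z. real N * Re z \<in> \<int> \<or> real N * Im z \<in> \<int>}"

definition cell_corner :: "nat \<Rightarrow> int \<Rightarrow> int \<Rightarrow> complex" where
  "cell_corner N i j = Complex (of_int i / real N) (of_int j / real N)"

abbreviation open_cell :: "nat \<Rightarrow> int \<Rightarrow> int \<Rightarrow> complex set" where
  "open_cell N i j \<equiv> box (cell_corner N i j) (cell_corner N (i + 1) (j + 1))"

abbreviation closed_cell :: "nat \<Rightarrow> int \<Rightarrow> int \<Rightarrow> complex set" where
  "closed_cell N i j \<equiv> cbox (cell_corner N i j) (cell_corner N (i + 1) (j + 1))"

lemma open_cell_iff:
  assumes "N > 0"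
  shows "z \<in> open_cell N i j \<longleftrightarrow> of_int i < real N * Re z \<and> real N * Re z < of_int i + 1 \<and>
    of_int j < real N * Im z \<and> real N * Im z < of_int j + 1"
  using assms
  by (simp add: in_box_complex_iff cell_corner_def pos_divide_less_eq pos_less_divide_eq mult.commute)

lemma closed_cell_iff:
  assumes "N > 0"
  shows "z \<in> closed_cell N i j \<longleftrightarrow> of_int i \<le> real N * Re z \<and> real N * Re z \<le> of_int i + 1 \<and>
    of_int j \<le> real N * Im z \<and> real N * Im z \<le> of_int j + 1"
  using assms
  by (auto simp: in_cbox_complex_iff cell_corner_def pos_divide_le_eq pos_le_divide_eq mult.commute)

lemma open_cell_nonempty:
  assumes "N > 0"
  shows "Complex ((of_int i + 1/2) / real N) ((of_int j + 1/2) / real N) \<in> open_cell N i j"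
  using assms by (simp add: open_cell_iff)

lemma open_cell_disjoint_grid:
  assumes "N > 0"
  shows "open_cell N i j \<inter> grid_lines N = {}"
proof -
  have "x \<notin> \<int>" if "of_int k < x" "x < of_int k + 1" for x :: real and k :: int
  proof
    assume "x \<in> \<int>"
    then obtain m where "x = of_int m" by (auto elim: Ints_cases)
    then have "real_of_int k < of_int m" "real_of_int m < of_int (k + 1)"
      using that by simp_all
    then show False unfolding of_int_less_iff by linarith
  qed
  then show ?thesis
    using assms unfolding grid_lines_def by (auto simp: open_cell_iff)
qed

lemma closed_cell_exists:
  assumes "N > 0"
  obtains i j where "z \<in> closed_cell N i j"
  using that[of "\<lfloor>real N * Re z\<rfloor>" "\<lfloor>real N * Im z\<rfloor>"] assms
  by (auto simp: closed_cell_iff)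

lemma closed_cell_Diff_open_cell:
  assumes "N > 0" "z \<in> closed_cell N i j" "z \<notin> open_cell N i j"
  shows "z \<in> grid_lines N"
proof -
  have "real N * Re z = of_int i \<or> real N * Re z = of_int (i + 1) \<or>
        real N * Im z = of_int j \<or> real N * Im z = of_int (j + 1)"
    using assms by (auto simp: open_cell_iff closed_cell_iff)
  then show ?thesis
    unfolding grid_lines_def by (metis (mono_tags, lifting) Ints_of_int mem_Collect_eq)
qed

lemma frontier_open_cell:
  assumes "N > 0"
  shows "frontier (open_cell N i j) = closed_cell N i j - open_cell N i j"
proof -
  have "open_cell N i j \<noteq> {}"
    using open_cell_nonempty[OF assms] by blast
  then show ?thesis
    by (simp add: frontier_def closure_box interior_open[OF open_box])
qed

text \<open>Along the diagonal \<open>z + Complex t t\<close> only countably many \<open>t\<close>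
  hit a grid line, whereas an interval of parameters is uncountable. The bound \<open>e/2\<close> is
  used because the diagonal step has norm at most \<open>2 * t\<close>.\<close>

lemma open_Diff_grid_nonempty:
  assumes N: "N > 0" and "open U" "z \<in> U"
  shows "U - grid_lines N \<noteq> {}"
proof -
  obtain e where e: "e > 0" "ball z e \<subseteq> U"
    using assms openE by blast
  define A where "A = (\<lambda>k::int. (of_int k - real N * Re z) / real N) ` UNIV \<union>
                      (\<lambda>k::int. (of_int k - real N * Im z) / real N) ` UNIV"
  have "countable A"
    unfolding A_def by auto
  moreover have "uncountable {0<..<e/2}"
    using e by (simp add: uncountable_open_interval)
  ultimately have "\<not> {0<..<e/2} \<subseteq> A"
    using countable_subset by blast
  then obtain t where "t \<in> {0<..<e/2}" and tA: "t \<notin> A"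
    by blast
  then have t: "0 < t" "t < e/2"
    by auto
  let ?w = "z + Complex t t"
  have "cmod (Complex t t) \<le> \<bar>t\<bar> + \<bar>t\<bar>"
    using cmod_le[of "Complex t t"] by simp
  then have "?w \<in> U"
    using e t by (auto simp: dist_norm intro!: subsetD[OF e(2)])
  moreover have "?w \<notin> grid_lines N"
  proof
    assume "?w \<in> grid_lines N"
    then obtain k where "real N * (Re z + t) = of_int k \<or> real N * (Im z + t) = of_int k"
      by (auto simp: grid_lines_def elim!: Ints_cases)
    then have "t = (of_int k - real N * Re z) / real N \<or> t = (of_int k - real N * Im z) / real N"
      using N by (auto simp: field_simps)
    then show False
      using tA unfolding A_def by blast
  qed
  ultimately show ?thesis by blast
qed

section \<open>Cell counts of bounded regions, the induction measure for grid curves\<close>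

definition cell_centers :: "nat \<Rightarrow> complex set" where
  "cell_centers N = {Complex ((of_int i + 1/2) / real N) ((of_int j + 1/2) / real N) | i j. True}"

lemma finite_cell_centers:
  assumes N: "N > 0" and "bounded U"
  shows "finite (U \<inter> cell_centers N)"
proof -
  obtain B where B: "\<And>z. z \<in> U \<Longrightarrow> cmod z \<le> B"
    using assms bounded_iff by blast
  \<comment> \<open>The extra 1 absorbs the offset 1/2 of the centres from the lattice.\<close>
  define m where "m = \<lceil>real N * B\<rceil> + 1"
  have "U \<inter> cell_centers N \<subseteq> (\<lambda>(i, j). Complex ((of_int i + 1/2) / real N) ((of_int j + 1/2) / real N)) ` ({-m..m} \<times> {-m..m})"
  proof
    fix z assume z: "z \<in> U \<inter> cell_centers N"
    then obtain i j where ij: "z = Complex ((of_int i + 1/2) / real N) ((of_int j + 1/2) / real N)"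
      unfolding cell_centers_def by blast
    have bound: "k \<in> {-m..m}" if "\<bar>(of_int k + 1/2) / real N\<bar> \<le> B" for k :: int
    proof -
      have "\<bar>of_int k + 1/2\<bar> \<le> real N * B"
        using that N by (simp add: field_simps)
      then have "\<bar>of_int k + 1/2\<bar> \<le> real_of_int \<lceil>real N * B\<rceil>"
        by (meson le_of_int_ceiling order_trans)
      then have "real_of_int k \<le> of_int m" "- of_int m \<le> real_of_int k"
        unfolding m_def by linarith+
      then show ?thesis
        by simp
    qed
    have "\<bar>Re z\<bar> \<le> B" "\<bar>Im z\<bar> \<le> B"
      using B[of z] z abs_Re_le_cmod[of z] abs_Im_le_cmod[of z] by auto
    then have "i \<in> {-m..m}" "j \<in> {-m..m}"
      using ij by (auto intro!: bound simp del: atLeastAtMost_iff)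
    then show "z \<in> (\<lambda>(i, j). Complex ((of_int i + 1/2) / real N) ((of_int j + 1/2) / real N)) ` ({-m..m} \<times> {-m..m})"
      using ij by (intro image_eqI[of _ _ "(i, j)"]) auto
  qed
  then show ?thesis
    by (rule finite_subset) auto
qed

lemma connected_subset_if_frontier_disjoint:
  assumes "connected B" "B \<inter> U \<noteq> {}" "B \<inter> frontier U = {}"
  shows "B \<subseteq> U"
  using connected_Int_frontier[of B U] assms by blast

text \<open>A cell is connected and misses the grid, hence misses the frontier of \<open>U\<close>:
  once it meets \<open>U\<close> it lies in \<open>U\<close>. A point of \<open>U\<close> off the
  grid selects the cell.\<close>

lemma open_cell_subset:
  assumes N: "N > 0" and U: "open U" "U \<noteq> {}" "frontier U \<subseteq> grid_lines N"
  obtains i j where "open_cell N i j \<subseteq> U"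
proof -
  obtain z where z: "z \<in> U" "z \<notin> grid_lines N"
    using open_Diff_grid_nonempty[OF N] U by blast
  obtain i j where "z \<in> closed_cell N i j"
    using closed_cell_exists N by blast
  then have ij: "z \<in> open_cell N i j"
    using closed_cell_Diff_open_cell N z by blast
  have "open_cell N i j \<subseteq> U"
    using U(3) open_cell_disjoint_grid[OF N, of i j] z(1) ij
    by (intro connected_subset_if_frontier_disjoint convex_connected convex_box) blast+
  then show thesis
    by (rule that)
qed

lemma cell_centers_nonempty:
  assumes N: "N > 0" and "open U" "U \<noteq> {}" "frontier U \<subseteq> grid_lines N"
  shows "U \<inter> cell_centers N \<noteq> {}"
proof -
  obtain i j where ij: "open_cell N i j \<subseteq> U"
    using open_cell_subset[OF assms] by metis
  have "Complex ((of_int i + 1/2) / real N) ((of_int j + 1/2) / real N) \<in> cell_centers N"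
    unfolding cell_centers_def by auto
  then show ?thesis
    using open_cell_nonempty[OF N, of i j] ij by blast
qed

text \<open>The rays in the directions \<open>d\<close> and \<open>- d\<close> are followed up to
  their first exits, so the open chord stays in \<open>U\<close> and can serve as a
  crosscut.\<close>

lemma chord_through_point:
  fixes z :: "'a::euclidean_space"
  assumes U: "open U" "bounded U" "z \<in> U" and d: "d \<noteq> 0"
  obtains s t where "0 < s" "0 < t" "z - s *\<^sub>R d \<in> frontier U" "z + t *\<^sub>R d \<in> frontier U"
    "\<And>r. - s < r \<Longrightarrow> r < t \<Longrightarrow> z + r *\<^sub>R d \<in> U"
proof -
  have z: "z \<in> interior U" and int: "interior U = U"
    using U interior_open by auto
  obtain t where t: "0 < t" "z + t *\<^sub>R d \<in> frontier U" "\<And>e. 0 \<le> e \<Longrightarrow> e < t \<Longrightarrow> z + e *\<^sub>R d \<in> interior U"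
    using ray_to_frontier[OF U(2) z d] by metis
  obtain s where s: "0 < s" "z + s *\<^sub>R (- d) \<in> frontier U" "\<And>e. 0 \<le> e \<Longrightarrow> e < s \<Longrightarrow> z + e *\<^sub>R (- d) \<in> interior U"
    using ray_to_frontier[OF U(2) z, of "- d"] d by (metis neg_equal_0_iff_equal)
  have "z + r *\<^sub>R d \<in> U" if "- s < r" "r < t" for r
  proof (cases "r \<ge> 0")
    case True
    then show ?thesis using t(3) that int by blast
  next
    case False
    then show ?thesis using s(3)[of "- r"] that int by simp
  qed
  then show thesis
    using s t by (intro that) auto
qed

text \<open>Base case of the induction. The inside contains a cell; being connected and disjoint
  from the frontier of that cell, which consists of grid points, it equals the cell, and a closed
  cell is convex.\<close>

lemma bounds_disk_if_no_grid_inside: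
  fixes g :: "real \<Rightarrow> complex"
  assumes N: "N > 0" and g: "simple_path g" "pathfinish g = pathstart g"
    and grid: "path_image g \<subseteq> grid_lines N" and empty: "inside (path_image g) \<inter> grid_lines N = {}"
  shows "bounds_disk (path_image g)"
proof -
  let ?I = "inside (path_image g)"
  have J: "?I \<noteq> {}" "open ?I" "connected ?I" "frontier ?I = path_image g"
    using Jordan_inside_outside[OF g] by simp_all
  obtain i j where ij: "open_cell N i j \<subseteq> ?I"
    using open_cell_subset[OF N J(2,1)] J(4) grid by metis
  have "?I \<subseteq> open_cell N i j"
  proof (rule connected_subset_if_frontier_disjoint[OF J(3)])
    show "?I \<inter> open_cell N i j \<noteq> {}"
      using ij open_cell_nonempty[OF N, of i j] by blast
    show "?I \<inter> frontier (open_cell N i j) = {}"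
      using empty closed_cell_Diff_open_cell[OF N, of _ i j] frontier_open_cell[OF N] by blast
  qed
  then have I: "?I = open_cell N i j"
    using ij by blast
  then have "path_image g = closed_cell N i j - open_cell N i j"
    using J(4) frontier_open_cell[OF N, of i j] by metis
  then have "path_image g \<union> ?I = closed_cell N i j"
    using I box_subset_cbox[of "cell_corner N i j" "cell_corner N (i + 1) (j + 1)"] by blast
  moreover have "closed_cell N i j homeomorphic cball (0::complex) 1"
    using open_cell_nonempty[OF N, of i j]
    by (intro homeomorphic_convex_compact_cball) auto
  ultimately show ?thesis
    by simp
qed

text \<open>The theta-curve theorem \<open>split_inside_simple_closed_curve\<close> in crosscut
  form: requiring the open arc of \<open>c\<close> to lie inside the outer loop already forces
  \<open>c\<close> to meet the outer arcs only at the ends.\<close>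

lemma theta_regions:
  fixes c1 :: "real \<Rightarrow> complex"
  assumes "arc c1" "pathstart c1 = a" "pathfinish c1 = b"
    and "arc c2" "pathstart c2 = a" "pathfinish c2 = b"
    and "arc c" "pathstart c = a" "pathfinish c = b"
    and c1c2: "path_image c1 \<inter> path_image c2 = {a,b}"
    and c: "path_image c - {a, b} \<subseteq> inside (path_image c1 \<union> path_image c2)"
      "path_image c - {a, b} \<noteq> {}"
  shows "inside (path_image c1 \<union> path_image c) \<inter> inside (path_image c2 \<union> path_image c) = {}"
    and "inside (path_image c1 \<union> path_image c) \<union> inside (path_image c2 \<union> path_image c) \<union>
           (path_image c - {a,b}) = inside (path_image c1 \<union> path_image c2)"
    and "path_image c1 \<inter> path_image c = {a, b}" "path_image c2 \<inter> path_image c = {a, b}"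
proof -
  have ends: "{a, b} \<subseteq> path_image c1" "{a, b} \<subseteq> path_image c2" "{a, b} \<subseteq> path_image c"
    using pathstart_in_path_image[of c1] pathfinish_in_path_image[of c1]
      pathstart_in_path_image[of c2] pathfinish_in_path_image[of c2]
      pathstart_in_path_image[of c] pathfinish_in_path_image[of c]
    by (simp_all add: assms)
  show 1: "path_image c1 \<inter> path_image c = {a, b}" and 2: "path_image c2 \<inter> path_image c = {a, b}"
    using c ends inside_no_overlap[of "path_image c1 \<union> path_image c2"] by blast+
  have ab: "a \<noteq> b"
    using assms(1-3) arc_distinct_ends by metis
  have meets: "path_image c \<inter> inside (path_image c1 \<union> path_image c2) \<noteq> {}"
    using c by blast
  have "inside (path_image c1 \<union> path_image c) \<inter> inside (path_image c2 \<union> path_image c) = {} \<and>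
      inside (path_image c1 \<union> path_image c) \<union> inside (path_image c2 \<union> path_image c) \<union>
           (path_image c - {a,b}) = inside (path_image c1 \<union> path_image c2)"
    by (rule split_inside_simple_closed_curve[OF arc_imp_simple_path[OF assms(1)] assms(2,3)
        arc_imp_simple_path[OF assms(4)] assms(5,6) arc_imp_simple_path[OF assms(7)] assms(8,9)
        ab c1c2 1 2 meets]) (rule conjI)
  then show "inside (path_image c1 \<union> path_image c) \<inter> inside (path_image c2 \<union> path_image c) = {}"
    and "inside (path_image c1 \<union> path_image c) \<union> inside (path_image c2 \<union> path_image c) \<union>
           (path_image c - {a,b}) = inside (path_image c1 \<union> path_image c2)"
    by blast+
qed

text \<open>Cut along a maximal grid segment inside the curve: both pieces contain fewer cells.\<close>

lemma bounds_disk_grid_curve: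
  fixes g :: "real \<Rightarrow> complex"
  assumes "N > 0" "simple_path g" "pathfinish g = pathstart g" "path_image g \<subseteq> grid_lines N"
  shows "bounds_disk (path_image g)"
  using assms(2-)
proof (induction "card (inside (path_image g) \<inter> cell_centers N)" arbitrary: g rule: less_induct)
  case less
  note N = \<open>N > 0\<close>
  let ?I = "inside (path_image g)"
  have J: "?I \<noteq> {}" "open ?I" "connected ?I" "bounded ?I" "frontier ?I = path_image g"
    using Jordan_inside_outside[OF less.prems(1,2)] by blast+
  show ?case
  proof (cases "?I \<inter> grid_lines N = {}")
    case True
    then show ?thesis
      using bounds_disk_if_no_grid_inside[OF N] less.prems by blast
  next
    case False
    then obtain z where z: "z \<in> ?I" "z \<in> grid_lines N" by blast
    \<comment> \<open>A grid point lies on a vertical or a horizontal grid line; \<open>d\<close> is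
      the direction of such a line, so the whole chord stays in the grid.\<close>
    obtain d :: complex where d: "d \<noteq> 0" "\<And>r. z + r *\<^sub>R d \<in> grid_lines N"
    proof (cases "real N * Re z \<in> \<int>")
      case True
      then show thesis using that[of \<i>] by (simp add: grid_lines_def)
    next
      case False
      then show thesis using that[of 1] z by (simp add: grid_lines_def)
    qed
    obtain s t where st: "0 < s" "0 < t" "z - s *\<^sub>R d \<in> path_image g" "z + t *\<^sub>R d \<in> path_image g"
      "\<And>r. - s < r \<Longrightarrow> r < t \<Longrightarrow> z + r *\<^sub>R d \<in> ?I"
      using chord_through_point[OF J(2,4) z(1) d(1)] J(5) by metis
    define a b where "a = z - s *\<^sub>R d" and "b = z + t *\<^sub>R d"
    define c where "c = linepath a b"
    have "b - a = (s + t) *\<^sub>R d"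
      by (simp add: a_def b_def algebra_simps)
    then have ab: "a \<noteq> b"
      using st(1,2) d(1) by auto
    have c: "arc c" "pathstart c = a" "pathfinish c = b"
      using ab by (auto simp: c_def arc_linepath)
    have c_form: "\<exists>r. x = z + r *\<^sub>R d \<and> (x \<noteq> a \<longrightarrow> x \<noteq> b \<longrightarrow> - s < r \<and> r < t)" if x: "x \<in> path_image c" for x
    proof -
      obtain u where u: "0 \<le> u" "u \<le> 1" "x = (1 - u) *\<^sub>R a + u *\<^sub>R b"
        using x by (auto simp: c_def closed_segment_def)
      have "x = z + (u * (s + t) - s) *\<^sub>R d"
        by (simp add: u(3) a_def b_def algebra_simps)
      moreover have "- s < u * (s + t) - s \<and> u * (s + t) - s < t" if "x \<noteq> a" "x \<noteq> b"
      proof -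
        have "u \<noteq> 0" "u \<noteq> 1" using that u(3) by auto
        then have "0 < u * (s + t)" "u * (s + t) < 1 * (s + t)"
          using u(1,2) st(1,2) by (auto intro!: mult_strict_right_mono)
        then show ?thesis by simp
      qed
      ultimately show ?thesis by blast
    qed
    have c_in: "path_image c - {a, b} \<subseteq> ?I"
      using c_form st(5) by blast
    have c_grid: "path_image c \<subseteq> grid_lines N"
      using c_form d(2) by blast
    have zc: "z \<in> path_image c - {a, b}"
    proof -
      have "z = (1 - s / (s + t)) *\<^sub>R a + (s / (s + t)) *\<^sub>R b"
      proof -
        have "(1 - s / (s + t)) *\<^sub>R a + (s / (s + t)) *\<^sub>R b = a + (s / (s + t)) *\<^sub>R (b - a)"
          by (simp add: algebra_simps)
        also have "\<dots> = z"
          using \<open>b - a = _\<close> st(1,2) by (simp add: a_def)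
        finally show ?thesis by simp
      qed
      then have "z \<in> path_image c"
        using st(1,2) unfolding c_def path_image_linepath closed_segment_def
        by (intro CollectI exI[of _ "s / (s + t)"]) auto
      then show ?thesis
        using st(1,2) d(1) by (auto simp: a_def b_def)
    qed
    obtain u v where u: "arc u" "pathstart u = a" "pathfinish u = b"
      and v: "arc v" "pathstart v = b" "pathfinish v = a"
      and uv: "path_image u \<inter> path_image v = {a, b}" "path_image u \<union> path_image v = path_image g"
      using exists_double_arc[OF less.prems(1,2) st(3,4)] ab unfolding a_def b_def by metis
    define w where "w = reversepath v"
    have w: "arc w" "pathstart w = a" "pathfinish w = b"
      and uw: "path_image u \<inter> path_image w = {a, b}" "path_image u \<union> path_image w = path_image g"
      using v uv by (auto simp: w_def arc_reversepath)
    have ne: "path_image c - {a, b} \<noteq> {}"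
      using zc by blast
    note th = theta_regions[OF u w c uw(1) c_in[folded uw(2)] ne, unfolded uw(2)]
    have cu: "path_image c \<inter> path_image u = {a, b}" and cw: "path_image c \<inter> path_image w = {a, b}"
      using th(3,4) by blast+
    note gu = simple_path_two_arcs[OF c(1) u(1) c(2,3) u(2,3) cu]
    note gw = simple_path_two_arcs[OF c(1) w(1) c(2,3) w(2,3) cw]
    let ?Iu = "inside (path_image c \<union> path_image u)" and ?Iw = "inside (path_image c \<union> path_image w)"
    have th1: "?Iu \<inter> ?Iw = {}" and th2: "?Iu \<union> ?Iw \<union> (path_image c - {a, b}) = ?I"
      using th(1,2) by (simp_all add: Un_commute)
    have grid: "path_image c \<union> path_image u \<subseteq> grid_lines N" "path_image c \<union> path_image w \<subseteq> grid_lines N"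
      using c_grid less.prems(3) uw(2) by blast+
    have Ju: "open ?Iu" "?Iu \<noteq> {}" "frontier ?Iu = path_image c \<union> path_image u"
      using Jordan_inside_outside[OF gu(1,2)] gu(3) by auto
    have Jw: "open ?Iw" "?Iw \<noteq> {}" "frontier ?Iw = path_image c \<union> path_image w"
      using Jordan_inside_outside[OF gw(1,2)] gw(3) by auto
    \<comment> \<open>Each piece has its frontier in the grid and so contains a cell centre. As the
      pieces are disjoint, each has strictly fewer centres than the whole.\<close>
    have neu: "?Iu \<inter> cell_centers N \<noteq> {}"
      using cell_centers_nonempty[OF N Ju(1,2)] Ju(3) grid by simp
    have new: "?Iw \<inter> cell_centers N \<noteq> {}"
      using cell_centers_nonempty[OF N Jw(1,2)] Jw(3) grid by simp
    have fin: "finite (?I \<inter> cell_centers N)"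
      using finite_cell_centers[OF N J(4)] .
    have "card (?Iu \<inter> cell_centers N) < card (?I \<inter> cell_centers N)"
      using th1 th2 new by (intro psubset_card_mono[OF fin]) blast
    then have Du: "bounds_disk (path_image c \<union> path_image u)"
      using less.hyps[of "c +++ reversepath u"] gu grid by simp
    have "card (?Iw \<inter> cell_centers N) < card (?I \<inter> cell_centers N)"
      using th1 th2 neu by (intro psubset_card_mono[OF fin]) blast
    then have Dw: "bounds_disk (path_image c \<union> path_image w)"
      using less.hyps[of "c +++ reversepath w"] gw grid by simp
    have no: "?I \<inter> path_image g = {}" "?Iu \<inter> path_image c = {}" "?Iw \<inter> path_image c = {}"
      using inside_no_overlap[of "path_image g"] inside_no_overlap[of "path_image c \<union> path_image u"]
        inside_no_overlap[of "path_image c \<union> path_image w"] by blast+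
    \<comment> \<open>The two closed disks meet only in the crosscut: \<open>u\<close> and
      \<open>w\<close> lie on the old curve, away from its inside, and meet each other only at
      \<open>a\<close> and \<open>b\<close>.\<close>
    have int: "(path_image c \<union> path_image u \<union> ?Iu) \<inter> (path_image c \<union> path_image w \<union> ?Iw) = path_image c"
    proof -
      have "path_image u \<inter> ?Iw = {}" "path_image w \<inter> ?Iu = {}"
        using th2 no(1) uw(2) by blast+
      moreover have "path_image u \<inter> path_image w \<subseteq> path_image c"
        using uw(1) cu by blast
      ultimately show ?thesis
        using th1 by blast
    qed
    have "{a, b} \<subseteq> path_image g"
      using uw by blast
    then have "path_image g \<union> ?I = (path_image c \<union> path_image u \<union> ?Iu) \<union> (path_image c \<union> path_image w \<union> ?Iw)"
      using th2 uw by blast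
    then show ?thesis
      using homeomorphic_disk_glue[OF c u cu w cw Du Dw int] by simp
  qed
qed

section \<open>Arcs crossing an annulus\<close>

text \<open>The maximum norm is chosen because its circles of positive integer radius are squares
  made of grid segments.\<close>

definition sup_norm :: "complex \<Rightarrow> real" where
  "sup_norm z = max \<bar>Re z\<bar> \<bar>Im z\<bar>"

abbreviation square_annulus :: "complex set" where
  "square_annulus \<equiv> {z. 1 \<le> sup_norm z \<and> sup_norm z \<le> 2}"

definition crosses_annulus :: "complex set \<Rightarrow> bool" where
  "crosses_annulus X \<longleftrightarrow> (\<exists>x\<in>X. sup_norm x = 1) \<and> (\<exists>y\<in>X. sup_norm y = 2)"

lemma continuous_on_sup_norm [continuous_intros]: "continuous_on S sup_norm"
  unfolding sup_norm_def by (intro continuous_intros)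

lemma sup_norm_scaleR: "sup_norm (r *\<^sub>R z) = \<bar>r\<bar> * sup_norm z"
  by (simp add: sup_norm_def abs_mult max_mult_distrib_left)

lemma sup_norm_le_iff: "sup_norm z \<le> r \<longleftrightarrow> z \<in> cbox (Complex (- r) (- r)) (Complex r r)"
  by (auto simp: sup_norm_def in_cbox_complex_iff)

lemma sup_norm_less_iff: "sup_norm z < r \<longleftrightarrow> z \<in> box (Complex (- r) (- r)) (Complex r r)"
  by (auto simp: sup_norm_def in_box_complex_iff)

lemma connected_sup_norm_greater: "connected {z. sup_norm z > r}"
proof -
  have "{z. sup_norm z > r} = - cbox (Complex (- r) (- r)) (Complex r r)"
    using sup_norm_le_iff by (auto simp: not_le[symmetric])
  then show ?thesis
    by (simp add: connected_complement_bounded_convex)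
qed

text \<open>From 0 a radial segment reaches \<open>x\<close> through the open inner square,
  \<open>X\<close> leads on to \<open>y\<close>, a second radial segment leaves the outer square,
  and the exterior of that square is connected. As \<open>F\<close> lies in the annulus, only the
  part in \<open>X\<close> could meet \<open>F\<close>, and \<open>X\<close> avoids it.\<close>

lemma connected_component_crossing:
  assumes X: "connected X" "crosses_annulus X" "X \<inter> F = {}" and F: "F \<subseteq> square_annulus"
  shows "connected_component (- F) 0 3"
proof -
  obtain x y where x: "x \<in> X" "sup_norm x = 1" and y: "y \<in> X" "sup_norm y = 2"
    using X(2) unfolding crosses_annulus_def by blast
  have "closed_segment 0 x \<subseteq> - F"
  proof
    fix z assume "z \<in> closed_segment 0 x"
    then obtain u where u: "0 \<le> u" "u \<le> 1" "z = u *\<^sub>R x"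
      by (auto simp: closed_segment_def)
    show "z \<in> - F"
    proof (cases "u = 1")
      case True
      then show ?thesis using u x X(3) by auto
    next
      case False
      then have "sup_norm z < 1" using u x by (simp add: sup_norm_scaleR)
      then show ?thesis using F by auto
    qed
  qed
  then have 1: "connected_component (- F) 0 x"
    unfolding connected_component_def by (intro exI[of _ "closed_segment 0 x"]) auto
  have 2: "connected_component (- F) x y"
    unfolding connected_component_def using X x(1) y(1) by blast
  have "closed_segment y (2 *\<^sub>R y) \<subseteq> - F"
  proof
    fix z assume "z \<in> closed_segment y (2 *\<^sub>R y)"
    then obtain u where u: "0 \<le> u" "u \<le> 1" "z = (1 - u) *\<^sub>R y + u *\<^sub>R (2 *\<^sub>R y)"
      by (auto simp: closed_segment_def)
    then have z: "z = (1 + u) *\<^sub>R y"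
      by (simp add: scaleR_conv_of_real algebra_simps)
    show "z \<in> - F"
    proof (cases "u = 0")
      case True
      then show ?thesis using z y X(3) by auto
    next
      case False
      then have "sup_norm z > 2" using z u y by (simp add: sup_norm_scaleR)
      then show ?thesis using F by auto
    qed
  qed
  then have 3: "connected_component (- F) y (2 *\<^sub>R y)"
    unfolding connected_component_def by (intro exI[of _ "closed_segment y (2 *\<^sub>R y)"]) auto
  have "sup_norm (2 *\<^sub>R y) > 2"
    unfolding sup_norm_scaleR using y by simp
  moreover have "sup_norm 3 > 2"
    by (simp add: sup_norm_def)
  moreover have "{z. sup_norm z > 2} \<subseteq> - F"
    using F by auto
  ultimately have 4: "connected_component (- F) (2 *\<^sub>R y) 3"
    unfolding connected_component_def
    by (intro exI[of _ "{z. sup_norm z > 2}"]) (auto simp: connected_sup_norm_greater)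
  show ?thesis
    using 1 2 3 4 connected_component_trans by metis
qed

lemma closed_cells_meet:
  assumes N: "N > 0" and z: "z \<in> closed_cell N i j" "z \<in> closed_cell N k l" "(i, j) \<noteq> (k, l)"
  shows "z \<notin> open_cell N i j"
proof
  assume "z \<in> open_cell N i j"
  then have "of_int i < real N * Re z" "real N * Re z < of_int (i + 1)"
    "of_int j < real N * Im z" "real N * Im z < of_int (j + 1)"
    "of_int k \<le> real N * Re z" "real N * Re z \<le> of_int (k + 1)"
    "of_int l \<le> real N * Im z" "real N * Im z \<le> of_int (l + 1)"
    using z by (auto simp: open_cell_iff[OF N] closed_cell_iff[OF N])
  \<comment> \<open>The indices of the two cells differ by less than 1 in each coordinate, so by
    integrality they coincide.\<close>
  then have "real_of_int i < of_int (k + 1)" "real_of_int k < of_int (i + 1)"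
    "real_of_int j < of_int (l + 1)" "real_of_int l < of_int (j + 1)"
    by linarith+
  then show False
    using z(3) unfolding of_int_less_iff by auto
qed

lemma dist_closed_cell:
  assumes N: "N > 0" and "z \<in> closed_cell N i j" "w \<in> closed_cell N i j"
  shows "dist z w \<le> 2 / real N"
proof -
  have "\<bar>real N * Re z - real N * Re w\<bar> \<le> 1" "\<bar>real N * Im z - real N * Im w\<bar> \<le> 1"
    using assms by (auto simp: closed_cell_iff[OF N])
  then have "real N * \<bar>Re (z - w)\<bar> \<le> 1" "real N * \<bar>Im (z - w)\<bar> \<le> 1"
    by (simp_all add: abs_mult_pos' right_diff_distrib)
  then have "real N * (\<bar>Re (z - w)\<bar> + \<bar>Im (z - w)\<bar>) \<le> 2"
    by (simp add: distrib_left)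
  moreover have "dist z w \<le> \<bar>Re (z - w)\<bar> + \<bar>Im (z - w)\<bar>"
    unfolding dist_norm by (rule cmod_le)
  ultimately show ?thesis
    using N by (simp add: pos_le_divide_eq mult.commute) (metis mult_left_mono of_nat_0_le_iff order_trans)
qed

lemma finite_closed_cells_meeting:
  assumes N: "N > 0" and "bounded P"
  shows "finite {(i, j). closed_cell N i j \<inter> P \<noteq> {}}"
proof -
  obtain B where B: "\<And>z. z \<in> P \<Longrightarrow> cmod z \<le> B"
    using assms bounded_iff by blast
  define m where "m = \<lceil>real N * B\<rceil> + 1"
  have "{(i, j). closed_cell N i j \<inter> P \<noteq> {}} \<subseteq> {-m..m} \<times> {-m..m}"
  proof
    fix m' assume "m' \<in> {(i, j). closed_cell N i j \<inter> P \<noteq> {}}"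
    then obtain i j z where m': "m' = (i, j)" and z: "z \<in> closed_cell N i j" "z \<in> P"
      by blast
    have "real N * \<bar>Re z\<bar> \<le> real N * B" "real N * \<bar>Im z\<bar> \<le> real N * B"
      using B[OF z(2)] abs_Re_le_cmod[of z] abs_Im_le_cmod[of z] by (auto intro!: mult_left_mono)
    then have "\<bar>real N * Re z\<bar> \<le> of_int \<lceil>real N * B\<rceil>" "\<bar>real N * Im z\<bar> \<le> of_int \<lceil>real N * B\<rceil>"
      by (simp_all add: abs_mult) (meson le_of_int_ceiling order_trans)+
    then have "real_of_int i \<le> of_int m" "of_int (- m) \<le> real_of_int i"
      "real_of_int j \<le> of_int m" "of_int (- m) \<le> real_of_int j"
      using z(1) unfolding closed_cell_iff[OF N] m_def by (auto simp: abs_le_iff)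
    then show "m' \<in> {-m..m} \<times> {-m..m}"
      unfolding of_int_le_iff m' by simp
  qed
  then show ?thesis
    by (rule finite_subset) simp
qed

lemma path_connected_frontier_cell:
  assumes "N > 0"
  shows "path_connected (frontier (open_cell N i j))"
proof -
  have "Re (cell_corner N i j) \<le> Re (cell_corner N (i + 1) (j + 1))"
    "Im (cell_corner N i j) \<le> Im (cell_corner N (i + 1) (j + 1))"
    using assms by (auto simp: cell_corner_def divide_right_mono)
  then have "frontier (open_cell N i j) =
      path_image (rectpath (cell_corner N i j) (cell_corner N (i + 1) (j + 1)))"
    using path_image_rectpath_cbox_minus_box frontier_open_cell[OF assms] by simp
  then show ?thesis
    by (simp add: path_connected_path_image)
qed

text \<open>The boundaries of the cells met by a path form a connected set, because cells that meet have
  boundaries that meet.\<close>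

lemma grid_arc_exists:
  assumes U: "open U" and conn: "connected_component U a b"
    and ab: "Re a \<in> \<int>" "Im a \<in> \<int>" "Re b \<in> \<int>" "Im b \<in> \<int>" "a \<noteq> b"
  obtains N g where "N > 0" "arc g" "pathstart g = a" "pathfinish g = b" "path_image g \<subseteq> U \<inter> grid_lines N"
proof -
  have "path_component U a b"
    using open_path_connected_component[OF U] conn by metis
  then obtain p where p: "path p" "path_image p \<subseteq> U" "pathstart p = a" "pathfinish p = b"
    unfolding path_component_def by blast
  obtain e where e: "e > 0" "(\<Union>x\<in>path_image p. ball x e) \<subseteq> U"
    using compact_subset_open_imp_ball_epsilon_subset[OF compact_path_image[OF p(1)] U p(2)] by blast
  \<comment> \<open>A closed cell has diameter at most \<open>2 / real N\<close>, so every cell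
    touched by \<open>p\<close> stays within the \<open>e\<close>-neighbourhood of \<open>p\<close>,
    hence in \<open>U\<close>.\<close>
  obtain N :: nat where N: "N > 0" "2 / real N < e"
  proof -
    obtain N :: nat where "2 / e < real N" using reals_Archimedean2 by blast
    moreover have "0 < 2 / e" using e by simp
    ultimately have "real N > 0" "2 < real N * e"
      using e(1) by (linarith, simp add: pos_divide_less_eq)
    then have "N > 0" "2 / real N < e"
      by (simp_all add: pos_divide_less_eq mult.commute)
    then show thesis by (rule that)
  qed
  define M where "M = {(i, j). closed_cell N i j \<inter> path_image p \<noteq> {}}"
  define F where "F = (\<lambda>(i, j). frontier (open_cell N i j))"
  define C where "C = (\<lambda>(i, j). closed_cell N i j)"
  define X where "X = \<Union> (F ` M)"
  have "finite M"
    unfolding M_def by (rule finite_closed_cells_meeting[OF N(1) bounded_path_image[OF p(1)]])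
  have FC: "F m \<subseteq> C m" for m
    using frontier_open_cell[OF N(1)] by (cases m) (auto simp: F_def C_def)
  have "C m \<subseteq> U" if m: "m \<in> M" for m
  proof
    fix z assume z: "z \<in> C m"
    obtain w where "w \<in> C m" "w \<in> path_image p"
      using m by (cases m) (auto simp: M_def C_def)
    moreover have "dist w z < e"
      using dist_closed_cell[OF N(1)] \<open>w \<in> C m\<close> z N(2) by (cases m) (fastforce simp: C_def)
    ultimately show "z \<in> U"
      using e(2) by (meson UN_I mem_ball subsetD)
  qed
  then have XU: "X \<subseteq> U"
    using FC unfolding X_def by blast
  have "F m \<subseteq> grid_lines N" for m
    using closed_cell_Diff_open_cell[OF N(1)] frontier_open_cell[OF N(1)] by (cases m) (auto simp: F_def)
  then have Xgrid: "X \<subseteq> grid_lines N"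
    unfolding X_def by blast
  \<comment> \<open>A point with integral real part lies on a grid line for every \<open>N\<close>,
    so a closed cell that contains it has it on its boundary. This applies to \<open>a\<close> and
    \<open>b\<close>.\<close>
  have lattice: "z \<in> F m" if "z \<in> C m" "Re z \<in> \<int>" for z m
  proof -
    have "z \<in> grid_lines N"
      using that(2) unfolding grid_lines_def by auto
    then show ?thesis
      using that(1) open_cell_disjoint_grid[OF N(1)] frontier_open_cell[OF N(1)]
      by (cases m) (auto simp: F_def C_def)
  qed
  have cover: "\<exists>m\<in>M. z \<in> C m" if "z \<in> path_image p" for z
  proof -
    obtain i j where "z \<in> closed_cell N i j"
      using closed_cell_exists[OF N(1)] by blast
    then have "(i, j) \<in> M" "z \<in> C (i, j)"
      using that by (auto simp: M_def C_def)
    then show ?thesis by blast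
  qed
  have pcF: "path_connected (F m)" for m
    using path_connected_frontier_cell[OF N(1)] by (cases m) (simp add: F_def)
  let ?P = "path_component_set X a"
  have dich: "F m \<subseteq> ?P" if m: "m \<in> M" "F m \<inter> ?P \<noteq> {}" for m
  proof -
    obtain x where x: "x \<in> F m" "path_component X a x" using m(2) by blast
    have "F m \<subseteq> path_component_set X x"
      using path_component_maximal[OF x(1) pcF] m(1) unfolding X_def by blast
    then show ?thesis
      using x(2) path_component_trans by blast
  qed
  \<comment> \<open>The cells touched by \<open>p\<close> are sorted by whether their boundary can
    be reached from \<open>a\<close>. Distinct closed cells that meet share a boundary point, so the
    two closed unions are disjoint, and connectedness puts all of \<open>p\<close> into
    \<open>A1\<close>.\<close>
  define A1 where "A1 = \<Union> (C ` {m \<in> M. F m \<subseteq> ?P})"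
  define A2 where "A2 = \<Union> (C ` {m \<in> M. \<not> F m \<subseteq> ?P})"
  have clC: "closed (C m)" for m
    by (cases m) (simp add: C_def closed_cbox)
  have cl: "closed A1" "closed A2"
    unfolding A1_def A2_def using \<open>finite M\<close> clC by (auto intro!: closed_UN)
  have disj: "A1 \<inter> A2 = {}"
  proof (rule ccontr)
    assume "A1 \<inter> A2 \<noteq> {}"
    then obtain z m n where mn: "m \<in> M" "F m \<subseteq> ?P" "n \<in> M" "\<not> F n \<subseteq> ?P" "z \<in> C m" "z \<in> C n"
      unfolding A1_def A2_def by blast
    then have "m \<noteq> n" by blast
    then have "z \<in> F m" "z \<in> F n"
      using mn(5,6) closed_cells_meet[OF N(1)] frontier_open_cell[OF N(1)]
      by (cases m, cases n, auto simp: F_def C_def)+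
    then show False
      using dich mn by blast
  qed
  have pcover: "path_image p \<subseteq> A1 \<union> A2"
  proof
    fix z assume "z \<in> path_image p"
    then obtain m where "m \<in> M" "z \<in> C m"
      using cover by blast
    then show "z \<in> A1 \<union> A2"
      unfolding A1_def A2_def by (cases "F m \<subseteq> ?P") blast+
  qed
  have aX: "\<exists>m\<in>M. a \<in> F m"
    using cover[of a] lattice ab p(3) pathstart_in_path_image[of p] by metis
  then have "path_component X a a"
    unfolding X_def by (intro path_component_refl) blast
  with aX obtain m where "m \<in> M" "a \<in> F m" "F m \<subseteq> ?P"
    using dich by blast
  then have "a \<in> A1"
    using FC unfolding A1_def by blast
  moreover have "a \<in> path_image p" "b \<in> path_image p"
    using p pathstart_in_path_image[of p] pathfinish_in_path_image[of p] by auto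
  ultimately have "path_image p \<inter> A2 = {}"
    using connected_closedD[OF connected_path_image[OF p(1)] _ pcover cl] disj by blast
  then have "b \<in> A1"
    using pcover \<open>b \<in> path_image p\<close> by blast
  then have "path_component X a b"
    using lattice ab(3) unfolding A1_def by blast
  then obtain q where q: "path q" "path_image q \<subseteq> X" "pathstart q = a" "pathfinish q = b"
    unfolding path_component_def by blast
  obtain g where "arc g" "path_image g \<subseteq> path_image q" "pathstart g = a" "pathfinish g = b"
    using path_contains_arc[OF q(1,3,4) ab(5)] by metis
  then show thesis
    using that[OF N(1)] q(2) XU Xgrid by blast
qed

section \<open>Arcs that run from the inner to the outer square\<close>

lemma crossing_interval:
  fixes f :: "real \<Rightarrow> real"
  assumes f: "continuous_on {0..1} f" and "f 0 < l" "l < u" "u < f 1"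
  obtains s t where "0 \<le> s" "s < t" "t \<le> 1" "f s = l" "f t = u" "\<And>x. s < x \<Longrightarrow> x < t \<Longrightarrow> l < f x \<and> f x < u"
proof -
  have comp: "compact S" if "closed S" "S \<subseteq> {a..b}" for S and a b :: real
    using closed_Int_compact[OF that(1) compact_Icc[of a b]] that(2) by (simp add: Int_absorb2)
  \<comment> \<open>\<open>t\<close> is the first time with value at least \<open>u\<close>, and
    \<open>s\<close> the last time before \<open>t\<close> with value at most \<open>l\<close>.
    Choosing them in this order leaves only values strictly between \<open>l\<close> and
    \<open>u\<close> on the open interval.\<close>
  have "closed {x \<in> {0..1}. u \<le> f x}"
    using continuous_on_closed_Collect_le[OF continuous_on_const f] by simp
  then have "compact {x \<in> {0..1}. u \<le> f x}"
    by (rule comp) (rule Collect_restrict)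
  moreover have "1 \<in> {x \<in> {0..1}. u \<le> f x}"
    using assms by simp
  ultimately obtain t where t: "t \<in> {0..1}" "u \<le> f t" "\<And>x. x \<in> {0..1} \<Longrightarrow> u \<le> f x \<Longrightarrow> t \<le> x"
    using compact_attains_inf[of "{x \<in> {0..1}. u \<le> f x}"] by blast
  have ft: "f t = u"
  proof -
    obtain x where "0 \<le> x" "x \<le> t" "f x = u"
      using IVT'[of f 0 u t] t assms continuous_on_subset[OF f, of "{0..t}"] by auto
    then show ?thesis using t(1) t(3)[of x] by auto
  qed
  have f': "continuous_on {0..t} f"
    using continuous_on_subset[OF f] t(1) by auto
  have "closed {x \<in> {0..t}. f x \<le> l}"
    using continuous_on_closed_Collect_le[OF f' continuous_on_const] by simp
  then have "compact {x \<in> {0..t}. f x \<le> l}"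
    by (rule comp) (rule Collect_restrict)
  moreover have "0 \<in> {x \<in> {0..t}. f x \<le> l}"
    using assms t(1) by simp
  ultimately obtain s where s: "s \<in> {0..t}" "f s \<le> l" "\<And>x. x \<in> {0..t} \<Longrightarrow> f x \<le> l \<Longrightarrow> x \<le> s"
    using compact_attains_sup[of "{x \<in> {0..t}. f x \<le> l}"] by blast
  have fs: "f s = l"
  proof -
    obtain x where "s \<le> x" "x \<le> t" "f x = l"
      using IVT'[of f s l t] s assms ft continuous_on_subset[OF f', of "{s..t}"] by auto
    then show ?thesis using s(1) s(3)[of x] by auto
  qed
  have "s \<noteq> t" using fs ft assms by auto
  show thesis
  proof
    show "0 \<le> s" "s < t" "t \<le> 1" using s(1) t(1) \<open>s \<noteq> t\<close> by auto
    show "l < f x \<and> f x < u" if "s < x" "x < t" for x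
      using s(1) s(3)[of x] t(1) t(3)[of x] that by fastforce
  qed (fact fs ft)+
qed

text \<open>Only the endpoints lie on the boundary squares, so two disjoint arcs of this kind form a
  simple closed curve together with an arc of each square joining their ends.\<close>

definition crossing_arc :: "(real \<Rightarrow> complex) \<Rightarrow> bool" where
  "crossing_arc g \<longleftrightarrow> arc g \<and> sup_norm (pathstart g) = 1 \<and> sup_norm (pathfinish g) = 2 \<and>
     (\<forall>z\<in>path_image g. z \<noteq> pathstart g \<longrightarrow> z \<noteq> pathfinish g \<longrightarrow> 1 < sup_norm z \<and> sup_norm z < 2)"

lemma crossing_subarc:
  assumes g: "arc g" "sup_norm (pathstart g) < 1" "sup_norm (pathfinish g) > 2"
  obtains h where "crossing_arc h" "path_image h \<subseteq> path_image g"
proof -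
  have "continuous_on {0..1} g"
    using g(1) arc_imp_path path_def by blast
  then have "continuous_on {0..1} (\<lambda>x. sup_norm (g x))"
    by (rule continuous_on_compose2[OF continuous_on_sup_norm]) auto
  moreover have "sup_norm (g 0) < 1" "sup_norm (g 1) > 2"
    using g(2,3) by (simp_all add: pathstart_def pathfinish_def)
  ultimately obtain s t where st: "0 \<le> s" "s < t" "t \<le> 1" "sup_norm (g s) = 1" "sup_norm (g t) = 2"
    "\<And>x. s < x \<Longrightarrow> x < t \<Longrightarrow> 1 < sup_norm (g x) \<and> sup_norm (g x) < 2"
    using crossing_interval[of "\<lambda>x. sup_norm (g x)" 1 2] by auto
  define h where "h = subpath s t g"
  have im: "path_image h = g ` {s..t}"
    using st(2) by (simp add: h_def path_image_subpath)
  have "arc h"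
    unfolding h_def using g(1) st(1-3) by (intro arc_subpath_arc) auto
  moreover have "\<forall>z\<in>path_image h. z \<noteq> pathstart h \<longrightarrow> z \<noteq> pathfinish h \<longrightarrow> 1 < sup_norm z \<and> sup_norm z < 2"
  proof (intro ballI impI)
    fix z assume z: "z \<in> path_image h" "z \<noteq> pathstart h" "z \<noteq> pathfinish h"
    then obtain x where x: "x \<in> {s..t}" "z = g x" using im by blast
    then have "s < x" "x < t" using z(2,3) by (auto simp: h_def order.order_iff_strict)
    then show "1 < sup_norm z \<and> sup_norm z < 2" using st(6) x(2) by simp
  qed
  ultimately have "crossing_arc h"
    unfolding crossing_arc_def using st(4,5) by (simp add: h_def)
  moreover have "path_image h \<subseteq> path_image g"
    using im st(1-3) by (auto simp: path_image_def)
  ultimately show thesis by (rule that)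
qed

lemma crossing_arc_in_annulus:
  assumes "crossing_arc g" shows "path_image g \<subseteq> square_annulus"
  using assms unfolding crossing_arc_def by fastforce

lemma crosses_annulus_crossing_arc:
  assumes "crossing_arc g" shows "crosses_annulus (path_image g)"
  using assms unfolding crossing_arc_def crosses_annulus_def by blast

text \<open>By Janiszewski's theorem: neither compact set alone separates \<open>0\<close> from \<open>3\<close>, because the
  connected set in the other one joins the two boundary components of the annulus.\<close>

lemma crossing_arc_exists:
  assumes M: "compact M1" "compact M2" "M1 \<inter> M2 = {}" "M1 \<subseteq> square_annulus" "M2 \<subseteq> square_annulus"
    and X: "connected X1" "X1 \<subseteq> M1" "crosses_annulus X1" "connected X2" "X2 \<subseteq> M2" "crosses_annulus X2"
  obtains N g where "N > 0" "crossing_arc g" "path_image g \<subseteq> grid_lines N" "path_image g \<inter> (M1 \<union> M2) = {}"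
proof -
  have "connected_component (- M1) 0 3"
    using connected_component_crossing[OF X(4,6) _ M(4)] X(5) M(3) by blast
  moreover have "connected_component (- M2) 0 3"
    using connected_component_crossing[OF X(1,3) _ M(5)] X(2) M(3) by blast
  ultimately have conn: "connected_component (- (M1 \<union> M2)) 0 3"
    using M by (intro Janiszewski) (auto simp: compact_imp_closed)
  have "open (- (M1 \<union> M2))"
    by (intro open_Compl closed_Un compact_imp_closed M)
  \<comment> \<open>The points 0 and 3 have integral coordinates, as a grid arc requires, and lie on
    different sides of the annulus; the arc is afterwards trimmed to one crossing.\<close>
  then obtain N g where N: "N > 0" and g: "arc g" "pathstart g = 0" "pathfinish g = 3"
    "path_image g \<subseteq> - (M1 \<union> M2) \<inter> grid_lines N"
    using grid_arc_exists[OF _ conn] by auto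
  obtain h where h: "crossing_arc h" "path_image h \<subseteq> path_image g"
    by (rule crossing_subarc[OF g(1)]) (auto simp: g sup_norm_def)
  show thesis
    using that[OF N h(1)] h(2) g(4) by blast
qed

section \<open>Cutting the annulus into two strips\<close>

lemma sup_norm_eq_square:
  "{z. sup_norm z = r} = cbox (Complex (- r) (- r)) (Complex r r) - box (Complex (- r) (- r)) (Complex r r)"
proof (rule set_eqI)
  fix z
  show "z \<in> {z. sup_norm z = r} \<longleftrightarrow>
      z \<in> cbox (Complex (- r) (- r)) (Complex r r) - box (Complex (- r) (- r)) (Complex r r)"
    unfolding Diff_iff sup_norm_le_iff[symmetric] sup_norm_less_iff[symmetric] by auto
qed

lemma sup_norm_square_loop:
  assumes "r > 0"
  obtains g where "simple_path g" "pathfinish g = pathstart g" "path_image g = {z. sup_norm z = r}"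
proof
  let ?g = "rectpath (Complex (- r) (- r)) (Complex r r)"
  show "simple_path ?g"
    using assms by (intro simple_path_rectpath) auto
  show "pathfinish ?g = pathstart ?g"
    by simp
  show "path_image ?g = {z. sup_norm z = r}"
    unfolding sup_norm_eq_square using assms by (intro path_image_rectpath_cbox_minus_box) auto
qed

lemma inside_sup_norm_square:
  assumes "r > 0"
  shows "inside {z. sup_norm z = r} = {z. sup_norm z < r}"
proof -
  let ?C = "cbox (Complex (- r) (- r)) (Complex r r)"
  have fr: "frontier ?C = {z. sup_norm z = r}"
    by (simp add: frontier_cbox sup_norm_eq_square)
  have "inside (frontier ?C) = interior ?C"
    by (intro inside_frontier_eq_interior) auto
  then show ?thesis
    unfolding fr interior_cbox using sup_norm_less_iff by blast
qed

lemma sup_norm_closure: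
  assumes "sup_norm z = r" "r > 0"
  shows "z \<in> closure {z. sup_norm z < r}"
proof -
  have "{z. sup_norm z < r} = box (Complex (- r) (- r)) (Complex r r)"
    using sup_norm_less_iff by blast
  moreover have "0 \<in> box (Complex (- r) (- r)) (Complex r r)"
    using assms by (simp add: in_box_complex_iff)
  then have "closure (box (Complex (- r) (- r)) (Complex r r)) = cbox (Complex (- r) (- r)) (Complex r r)"
    by (intro closure_box) blast
  moreover have "z \<in> cbox (Complex (- r) (- r)) (Complex r r)"
    using assms sup_norm_le_iff[of z r] by simp
  ultimately show ?thesis
    by simp
qed

lemma connected_sup_norm_less: "connected {z. sup_norm z < r}"
proof -
  have "{z. sup_norm z < r} = box (Complex (- r) (- r)) (Complex r r)"
    using sup_norm_less_iff by blast
  then show ?thesis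
    by (simp add: convex_connected)
qed

text \<open>Scaling a point of \<open>U\<close> slightly up and down stays in \<open>U\<close>,
  which is impossible on either boundary square.\<close>

lemma open_subset_annulus:
  assumes U: "open U" "U \<subseteq> square_annulus" "z \<in> U"
  shows "1 < sup_norm z" "sup_norm z < 2"
proof -
  obtain e where e: "e > 0" "ball z e \<subseteq> U"
    using U openE by blast
  have "z \<noteq> 0"
    using U by (auto simp: sup_norm_def)
  define t where "t = e / (2 * norm z)"
  have t: "t > 0" "norm (t *\<^sub>R z) < e"
    using e \<open>z \<noteq> 0\<close> by (auto simp: t_def)
  have "(1 + t) *\<^sub>R z \<in> ball z e" "(1 - t) *\<^sub>R z \<in> ball z e"
    using t(2) by (auto simp: dist_norm algebra_simps)
  then have 1: "(1 + t) *\<^sub>R z \<in> square_annulus" "(1 - t) *\<^sub>R z \<in> square_annulus"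
    using e U by blast+
  have pos: "1 \<le> sup_norm z"
    using U by blast
  have "sup_norm z * 1 < sup_norm z * \<bar>1 + t\<bar>"
    using pos t by (intro mult_strict_left_mono) auto
  then show "sup_norm z < 2"
    using 1(1) by (simp add: sup_norm_scaleR mult.commute)
  \<comment> \<open>\<open>t\<close> is not known to be less than 1: the bound for
    \<open>(1 - t) *\<^sub>R z\<close> gives only \<open>t \<ge> 2\<close>, and the bound for
    \<open>(1 + t) *\<^sub>R z\<close> rules this out.\<close>
  show "1 < sup_norm z"
  proof (rule ccontr)
    assume "\<not> 1 < sup_norm z"
    then have z1: "sup_norm z = 1" using pos by simp
    have "\<bar>1 - t\<bar> \<ge> 1"
      using 1(2) z1 by (simp add: sup_norm_scaleR)
    then have "t \<ge> 2" using t by linarith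
    moreover have "1 + t \<le> 2"
      using 1(1) z1 t by (simp add: sup_norm_scaleR)
    ultimately show False by simp
  qed
qed

text \<open>A topological rectangle with sides \<open>a\<close> and \<open>b\<close> across the
  annulus; the images of \<open>i\<close> and \<open>k\<close> will be the marked arcs. The
  definition does not choose between the two arcs of each square, so the enclosed region may contain
  the hole of the annulus. The right choice is made in \<open>annulus_split\<close>.\<close>

definition strip :: "(real \<Rightarrow> complex) \<Rightarrow> (real \<Rightarrow> complex) \<Rightarrow> (real \<Rightarrow> complex) \<Rightarrow> (real \<Rightarrow> complex) \<Rightarrow> bool" where
  "strip a b i k \<longleftrightarrow> crossing_arc a \<and> crossing_arc b \<and> path_image a \<inter> path_image b = {} \<and>
     arc i \<and> pathstart i = pathstart a \<and> pathfinish i = pathstart b \<and> path_image i \<subseteq> {z. sup_norm z = 1} \<and>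
     arc k \<and> pathstart k = pathfinish a \<and> pathfinish k = pathfinish b \<and> path_image k \<subseteq> {z. sup_norm z = 2}"

abbreviation strip_boundary ::
  "(real \<Rightarrow> complex) \<Rightarrow> (real \<Rightarrow> complex) \<Rightarrow> (real \<Rightarrow> complex) \<Rightarrow> (real \<Rightarrow> complex) \<Rightarrow> complex set" where
  "strip_boundary a b i k \<equiv> path_image a \<union> path_image b \<union> path_image i \<union> path_image k"

abbreviation strip_region ::
  "(real \<Rightarrow> complex) \<Rightarrow> (real \<Rightarrow> complex) \<Rightarrow> (real \<Rightarrow> complex) \<Rightarrow> (real \<Rightarrow> complex) \<Rightarrow> complex set" where
  "strip_region a b i k \<equiv> strip_boundary a b i k \<union> inside (strip_boundary a b i k)"

lemma crossing_arc_Int: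
  assumes "crossing_arc a" "z \<in> path_image a"
  shows "sup_norm z = 1 \<longleftrightarrow> z = pathstart a" "sup_norm z = 2 \<longleftrightarrow> z = pathfinish a"
    "1 \<le> sup_norm z" "sup_norm z \<le> 2"
  using assms unfolding crossing_arc_def by fastforce+

text \<open>Three consecutive sides as a single arc, with \<open>a\<close> traversed backwards; it
  will be a crosscut of the outer square.\<close>

lemma strip_inner_arc:
  assumes "crossing_arc a" "crossing_arc b" "path_image a \<inter> path_image b = {}"
    and i: "arc i" "pathstart i = pathstart a" "pathfinish i = pathstart b" "path_image i \<subseteq> {z. sup_norm z = 1}"
  obtains c where "arc c" "pathstart c = pathfinish a" "pathfinish c = pathfinish b"
    "path_image c = path_image a \<union> path_image b \<union> path_image i"
proof
  let ?c = "reversepath a +++ (i +++ b)"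
  have ab: "arc a" "arc b"
    using assms by (auto simp: crossing_arc_def)
  have ib: "path_image i \<inter> path_image b \<subseteq> {pathstart b}"
    using i(4) crossing_arc_Int(1)[OF assms(2)] by blast
  then have 1: "arc (i +++ b)"
    using i ab by (intro arc_join) auto
  have im: "path_image (i +++ b) = path_image i \<union> path_image b"
    using i by (simp add: path_image_join)
  have "path_image a \<inter> path_image i \<subseteq> {pathstart a}"
    using i(4) crossing_arc_Int(1)[OF assms(1)] by blast
  then have "path_image a \<inter> (path_image i \<union> path_image b) \<subseteq> {pathstart a}"
    using assms(3) by blast
  then show "arc ?c"
    by (intro arc_join[OF arc_reversepath[OF ab(1)] 1]) (simp_all add: i im)
  show "path_image ?c = path_image a \<union> path_image b \<union> path_image i"
    using i im by (auto simp: path_image_join)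
qed auto

text \<open>The sides \<open>a\<close>, \<open>k\<close>, \<open>b\<close> as a single arc, so that
  the loop can be viewed with its two distinguished points on the inner square.\<close>

lemma strip_outer_arc:
  assumes "crossing_arc a" "crossing_arc b" "path_image a \<inter> path_image b = {}"
    and k: "arc k" "pathstart k = pathfinish a" "pathfinish k = pathfinish b" "path_image k \<subseteq> {z. sup_norm z = 2}"
  obtains c where "arc c" "pathstart c = pathstart a" "pathfinish c = pathstart b"
    "path_image c = path_image a \<union> path_image b \<union> path_image k"
proof
  let ?c = "a +++ (k +++ reversepath b)"
  have ab: "arc a" "arc b"
    using assms by (auto simp: crossing_arc_def)
  have ib: "path_image k \<inter> path_image b \<subseteq> {pathfinish b}"
    using k(4) crossing_arc_Int(2)[OF assms(2)] by blast
  then have 1: "arc (k +++ reversepath b)"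
    by (intro arc_join[OF k(1) arc_reversepath[OF ab(2)]]) (simp_all add: k)
  have im: "path_image (k +++ reversepath b) = path_image k \<union> path_image b"
    using k by (simp add: path_image_join)
  have "path_image a \<inter> path_image k \<subseteq> {pathfinish a}"
    using k(4) crossing_arc_Int(2)[OF assms(1)] by blast
  then have "path_image a \<inter> (path_image k \<union> path_image b) \<subseteq> {pathfinish a}"
    using assms(3) by blast
  then show "arc ?c"
    by (intro arc_join[OF ab(1) 1]) (simp_all add: k im)
  show "path_image ?c = path_image a \<union> path_image b \<union> path_image k"
    using k im by (auto simp: path_image_join)
qed auto

lemma strip_loop:
  assumes "strip a b i k"
  obtains g where "simple_path g" "pathfinish g = pathstart g" "path_image g = strip_boundary a b i k"
proof -
  have a: "crossing_arc a" and b: "crossing_arc b" and ab: "path_image a \<inter> path_image b = {}"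
    and i: "arc i" "pathstart i = pathstart a" "pathfinish i = pathstart b" "path_image i \<subseteq> {z. sup_norm z = 1}"
    and k: "arc k" "pathstart k = pathfinish a" "pathfinish k = pathfinish b" "path_image k \<subseteq> {z. sup_norm z = 2}"
    using assms unfolding strip_def by blast+
  obtain c where c: "arc c" "pathstart c = pathfinish a" "pathfinish c = pathfinish b"
    "path_image c = path_image a \<union> path_image b \<union> path_image i"
    using strip_inner_arc[OF a b ab i] by blast
  have "path_image c \<inter> path_image k = {pathfinish a, pathfinish b}"
  proof
    show "{pathfinish a, pathfinish b} \<subseteq> path_image c \<inter> path_image k"
      using c k pathfinish_in_path_image[of a] pathfinish_in_path_image[of b]
        pathstart_in_path_image[of k] pathfinish_in_path_image[of k] by auto
    show "path_image c \<inter> path_image k \<subseteq> {pathfinish a, pathfinish b}"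
      using c(4) k(4) i(4) crossing_arc_Int(2)[OF a] crossing_arc_Int(2)[OF b] by fastforce
  qed
  note g = simple_path_two_arcs[OF c(1) k(1) c(2,3) k(2,3) this]
  show thesis
    by (rule that[OF g(1,2)]) (simp add: g(3) c(4))
qed

lemma circle_arcs:
  assumes "r > 0" "sup_norm p = r" "sup_norm q = r" "p \<noteq> q"
  obtains u v where "arc u" "pathstart u = p" "pathfinish u = q" "arc v" "pathstart v = p" "pathfinish v = q"
    "path_image u \<inter> path_image v = {p, q}" "path_image u \<union> path_image v = {z. sup_norm z = r}"
proof -
  obtain g where g: "simple_path g" "pathfinish g = pathstart g" "path_image g = {z. sup_norm z = r}"
    using sup_norm_square_loop assms by blast
  have "p \<in> path_image g" "q \<in> path_image g"
    using assms g by auto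
  then obtain u v where u: "arc u" "arc v" "pathstart u = p" "pathfinish u = q" "pathstart v = q" "pathfinish v = p"
    "path_image u \<inter> path_image v = {p, q}" "path_image u \<union> path_image v = path_image g"
    using exists_double_arc[OF g(1,2) _ _ assms(4)] by metis
  show thesis
    by (rule that[of u "reversepath v"]) (use u g in \<open>simp_all add: arc_reversepath\<close>)
qed

text \<open>Two theta-curves are used. The outer square with the crosscut \<open>c\<close>, made of
  \<open>a\<close>, \<open>i\<close> and \<open>b\<close>, yields two regions. The hole
  \<open>S\<close> is connected and lies in one of them; the outer arc bounding that region is
  called \<open>k'\<close>, so the region of \<open>i\<close> and \<open>k\<close> stays in the
  annulus. In the region with the hole, \<open>i'\<close> is a crosscut that splits off the hole and
  leaves the strip of \<open>i'\<close> and \<open>k'\<close>.\<close>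

lemma annulus_split:
  assumes a: "crossing_arc a" and b: "crossing_arc b" and ab: "path_image a \<inter> path_image b = {}"
  obtains i k i' k' where "strip a b i k" "strip a b i' k'"
    "strip_region a b i k \<subseteq> square_annulus" "strip_region a b i' k' \<subseteq> square_annulus"
    "square_annulus \<subseteq> strip_region a b i k \<union> strip_region a b i' k'"
    "strip_region a b i k \<inter> strip_region a b i' k' \<subseteq> path_image a \<union> path_image b"
proof -
  define S where "S = {z. sup_norm z < 1}"
  have starts: "sup_norm (pathstart a) = 1" "sup_norm (pathstart b) = 1" "pathstart a \<noteq> pathstart b"
    and ends: "sup_norm (pathfinish a) = 2" "sup_norm (pathfinish b) = 2" "pathfinish a \<noteq> pathfinish b"
    using a b ab pathstart_in_path_image[of a] pathstart_in_path_image[of b]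
      pathfinish_in_path_image[of a] pathfinish_in_path_image[of b]
    by (auto simp: crossing_arc_def)
  obtain i i' where i: "arc i" "pathstart i = pathstart a" "pathfinish i = pathstart b"
    and i': "arc i'" "pathstart i' = pathstart a" "pathfinish i' = pathstart b"
    and ii': "path_image i \<inter> path_image i' = {pathstart a, pathstart b}"
      "path_image i \<union> path_image i' = {z. sup_norm z = 1}"
    using circle_arcs[OF _ starts] by (metis zero_less_one)
  have i1: "path_image i \<subseteq> {z. sup_norm z = 1}" and i'1: "path_image i' \<subseteq> {z. sup_norm z = 1}"
    using ii' by blast+
  obtain c where c: "arc c" "pathstart c = pathfinish a" "pathfinish c = pathfinish b"
    and c_im: "path_image c = path_image a \<union> path_image b \<union> path_image i"
    using strip_inner_arc[OF a b ab i i1] by blast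
  have c_norm: "1 \<le> sup_norm z \<and> (sup_norm z = 2 \<longleftrightarrow> z \<in> {pathfinish a, pathfinish b}) \<and> sup_norm z \<le> 2"
    if z: "z \<in> path_image c" for z
  proof -
    consider "z \<in> path_image a" | "z \<in> path_image b" | "sup_norm z = 1"
      using z i1 unfolding c_im by blast
    then show ?thesis
    proof cases
      case 1
      then show ?thesis using crossing_arc_Int[OF a 1] ends by auto
    next
      case 2
      then show ?thesis using crossing_arc_Int[OF b 2] ends by auto
    next
      case 3
      then show ?thesis using ends by auto
    qed
  qed
  have c_S: "path_image c \<inter> S = {}"
    using c_norm unfolding S_def by fastforce
  have c_in: "path_image c - {pathfinish a, pathfinish b} \<subseteq> {z. sup_norm z < 2}"
    using c_norm by fastforce
  have c_ne: "path_image c - {pathfinish a, pathfinish b} \<noteq> {}"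
    using c_im pathstart_in_path_image[of a] starts ends by force
  have in2: "inside {z. sup_norm z = 2} = {z. sup_norm z < 2}"
    by (rule inside_sup_norm_square) simp
  have S_conn: "connected S" "S \<noteq> {}"
    using connected_sup_norm_less[of 1] unfolding S_def by (auto simp: sup_norm_def intro!: exI[of _ 0])
  obtain k k' where k: "arc k" "pathstart k = pathfinish a" "pathfinish k = pathfinish b"
    and k': "arc k'" "pathstart k' = pathfinish a" "pathfinish k' = pathfinish b"
    and kk': "path_image k \<inter> path_image k' = {pathfinish a, pathfinish b}"
      "path_image k \<union> path_image k' = {z. sup_norm z = 2}"
    and S_in: "S \<subseteq> inside (path_image k' \<union> path_image c)"
  proof -
    obtain u v where u: "arc u" "pathstart u = pathfinish a" "pathfinish u = pathfinish b"
      and v: "arc v" "pathstart v = pathfinish a" "pathfinish v = pathfinish b"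
      and uv: "path_image u \<inter> path_image v = {pathfinish a, pathfinish b}"
        "path_image u \<union> path_image v = {z. sup_norm z = 2}"
      using circle_arcs[OF _ ends] by (metis zero_less_numeral)
    note th = theta_regions[OF u v c uv(1), unfolded uv(2) in2, OF c_in c_ne]
    have uc: "path_image c \<inter> path_image u = {pathfinish a, pathfinish b}"
      and vc: "path_image c \<inter> path_image v = {pathfinish a, pathfinish b}"
      using th(3,4) by blast+
    have "open (inside (path_image u \<union> path_image c))" "open (inside (path_image v \<union> path_image c))"
      using c(1) u(1) v(1) by (simp_all add: open_inside compact_imp_closed compact_arc_image compact_Un)
    moreover have "S \<subseteq> {z. sup_norm z < 2}"
      unfolding S_def by auto
    then have "S \<subseteq> inside (path_image u \<union> path_image c) \<union> inside (path_image v \<union> path_image c)"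
      using th(2) c_S by blast
    ultimately have "S \<subseteq> inside (path_image v \<union> path_image c) \<or> S \<subseteq> inside (path_image u \<union> path_image c)"
      using connectedD[OF S_conn(1)] th(1) by blast
    then show thesis
      using that[OF u v uv] that[OF v u] uv by (metis inf_commute sup_commute)
  qed
  have k2: "path_image k \<subseteq> {z. sup_norm z = 2}" and k'2: "path_image k' \<subseteq> {z. sup_norm z = 2}"
    using kk' by blast+
  define J where "J = path_image k \<union> path_image c"
  define J' where "J' = path_image k' \<union> path_image c"
  note th = theta_regions[OF k k' c kk'(1), unfolded kk'(2) in2, OF c_in c_ne, folded J_def J'_def]
  have S_J': "S \<subseteq> inside J'" using S_in J'_def by simp
  have sab: "strip a b i k" "strip a b i' k'" "strip a b i k'"
    using a b ab i i' k k' i1 i'1 k2 k'2 unfolding strip_def by blast+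
  obtain d where d: "arc d" "pathstart d = pathstart a" "pathfinish d = pathstart b"
    and d_im: "path_image d = path_image a \<union> path_image b \<union> path_image k'"
    using strip_outer_arc[OF a b ab k' k'2] by blast
  \<comment> \<open>The loop \<open>J'\<close> is regrouped as \<open>i\<close> and the arc
    \<open>d\<close> through \<open>a\<close>, \<open>k'\<close> and \<open>b\<close>, because the
    second crosscut \<open>i'\<close> ends at the starting points of \<open>a\<close> and
    \<open>b\<close>.\<close>
  have J'_d: "path_image i \<union> path_image d = J'"
    unfolding J'_def c_im d_im by blast
  have J_eq: "J = strip_boundary a b i k"
    unfolding J_def c_im by blast
  define K where "K = strip_boundary a b i' k'"
  have K_eq: "path_image d \<union> path_image i' = K"
    unfolding K_def d_im by blast
  have J'_eq: "J' = strip_boundary a b i k'"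
    unfolding J'_def c_im by blast
  have inner_disj: "z \<in> {pathstart a, pathstart b}" if "z \<in> path_image i'" "z \<in> J'" for z
  proof -
    have "sup_norm z = 1" using that(1) i'1 by blast
    then show ?thesis
      using that crossing_arc_Int(1)[OF a, of z] crossing_arc_Int(1)[OF b, of z] k'2 ii'(1)
      unfolding J'_eq by auto
  qed
  have clJ': "closure (inside J') \<subseteq> J' \<union> inside J'"
  proof -
    obtain g where "simple_path g" "pathfinish g = pathstart g" "path_image g = J'"
      using strip_loop[OF sab(3)] J'_eq by metis
    then have "frontier (inside J') = J'"
      using Jordan_inside_outside by blast
    then show ?thesis
      using closure_Un_frontier[of "inside J'"] by blast
  qed
  \<comment> \<open>\<open>i'\<close> lies in the closure of the hole, hence in the closed region
    bounded by \<open>J'\<close>, and it meets \<open>J'\<close> only at its ends.\<close>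
  have i'_in: "path_image i' - {pathstart a, pathstart b} \<subseteq> inside J'"
  proof
    fix z assume z: "z \<in> path_image i' - {pathstart a, pathstart b}"
    then have "sup_norm z = 1" using i'1 by blast
    then have "z \<in> closure S"
      unfolding S_def by (rule sup_norm_closure) simp
    then have "z \<in> J' \<union> inside J'"
      using closure_mono[OF S_J'] clJ' by blast
    then show "z \<in> inside J'"
      using inner_disj z by blast
  qed
  have i'_ne: "path_image i' - {pathstart a, pathstart b} \<noteq> {}"
  proof
    assume "path_image i' - {pathstart a, pathstart b} = {}"
    then have "finite (path_image i')"
      by (meson Diff_eq_empty_iff finite.emptyI finite_insert finite_subset)
    then have "\<exists>x. path_image i' = {x}"
      using connected_finite_iff_sing[OF connected_arc_image[OF i'(1)]] by simp
    then show False
      using pathstart_in_path_image[of i'] pathfinish_in_path_image[of i'] i'(2,3) starts(3) by auto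
  qed
  have id: "path_image i \<inter> path_image d = {pathstart a, pathstart b}"
  proof
    show "{pathstart a, pathstart b} \<subseteq> path_image i \<inter> path_image d"
      using i d pathstart_in_path_image[of i] pathfinish_in_path_image[of i]
        pathstart_in_path_image[of d] pathfinish_in_path_image[of d] by auto
    show "path_image i \<inter> path_image d \<subseteq> {pathstart a, pathstart b}"
    proof
      fix z assume z: "z \<in> path_image i \<inter> path_image d"
      then have "sup_norm z = 1" using i1 by blast
      then show "z \<in> {pathstart a, pathstart b}"
        using z crossing_arc_Int(1)[OF a, of z] crossing_arc_Int(1)[OF b, of z] k'2
        unfolding d_im by auto
    qed
  qed
  have in1: "inside {z. sup_norm z = 1} = S"
    unfolding S_def by (rule inside_sup_norm_square) simp
  \<comment> \<open>The loop of \<open>i\<close> and \<open>i'\<close> is the inner square, whose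
    inside is the hole; the other region of this theta-curve is the second strip.\<close>
  note th' = theta_regions[OF i d i' id, unfolded J'_d, OF i'_in i'_ne, unfolded ii'(2) in1 K_eq]
  have clos: "closed J"
    unfolding J_def using c(1) k(1) by (intro closed_Un closed_arc_image)
  have opJ: "open (inside J)"
    using clos by (rule open_inside)
  have lt2: "z \<in> inside J \<or> z \<in> inside J' \<Longrightarrow> sup_norm z < 2" for z
    using th(2) by blast
  have R1: "J \<union> inside J \<subseteq> square_annulus"
  proof
    fix z assume "z \<in> J \<union> inside J"
    then show "z \<in> square_annulus"
    proof
      assume "z \<in> J"
      then show ?thesis
        using c_norm k2 unfolding J_def by auto
    next
      assume z: "z \<in> inside J"
      then have "z \<notin> S"
        using th(1) S_J' by blast
      then show ?thesis
        using lt2 z unfolding S_def by fastforce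
    qed
  qed
  have R2: "K \<union> inside K \<subseteq> square_annulus"
  proof
    fix z assume "z \<in> K \<union> inside K"
    then show "z \<in> square_annulus"
    proof
      assume "z \<in> K"
      then show ?thesis
        using crossing_arc_Int[OF a, of z] crossing_arc_Int[OF b, of z] k'2 i'1 unfolding K_def by auto
    next
      assume z: "z \<in> inside K"
      then have "z \<notin> S" "z \<in> inside J'"
        using th'(1,2) by blast+
      then show ?thesis
        using lt2 z unfolding S_def by fastforce
    qed
  qed
  have R3: "square_annulus \<subseteq> (J \<union> inside J) \<union> (K \<union> inside K)"
  proof
    fix z assume z: "z \<in> square_annulus"
    show "z \<in> (J \<union> inside J) \<union> (K \<union> inside K)"
    proof (cases "sup_norm z = 2")
      case True
      then have "z \<in> path_image k \<or> z \<in> path_image k'" using kk'(2) by blast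
      then show ?thesis unfolding J_def K_def by blast
    next
      case False
      then have "sup_norm z < 2" using z by simp
      then consider "z \<in> inside J" | "z \<in> inside J'" | "z \<in> path_image c" using th(2) by blast
      then show ?thesis
      proof cases
        case 2
        moreover have "z \<notin> S" using z unfolding S_def by auto
        ultimately have "z \<in> inside K \<or> z \<in> path_image i'" using th'(2) by blast
        then show ?thesis unfolding K_def by blast
      qed (auto simp: J_def)
    qed
  qed
  have R4: "(J \<union> inside J) \<inter> (K \<union> inside K) \<subseteq> path_image a \<union> path_image b"
  proof
    fix z assume z: "z \<in> (J \<union> inside J) \<inter> (K \<union> inside K)"
    have K_in: "inside K \<subseteq> inside J'" using th'(2) by blast
    have no: "J \<inter> inside J = {}" "J' \<inter> inside J' = {}"
      using inside_no_overlap by blast+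
    have ends_in: "pathstart a \<in> path_image a" "pathstart b \<in> path_image b"
      "pathfinish a \<in> path_image a" "pathfinish b \<in> path_image b"
      by (rule pathstart_in_path_image pathfinish_in_path_image)+
    consider "z \<in> J" "z \<in> K" | "z \<in> J" "z \<in> inside K" | "z \<in> inside J" "z \<in> K" | "z \<in> inside J" "z \<in> inside K"
      using z by blast
    then show "z \<in> path_image a \<union> path_image b"
    proof cases
      case 1
      show ?thesis
      proof (rule ccontr)
        assume n: "z \<notin> path_image a \<union> path_image b"
        then consider "z \<in> path_image i" "z \<in> path_image i'" | "z \<in> path_image k" "z \<in> path_image k'"
          | "sup_norm z = 1" "sup_norm z = 2"
          using 1 i1 i'1 k2 k'2 unfolding J_eq K_def by blast
        then show False
        proof cases
          case 1
          then have "z \<in> {pathstart a, pathstart b}" using ii'(1) by blast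
          then show False using n ends_in by blast
        next
          case 2
          then have "z \<in> {pathfinish a, pathfinish b}" using kk'(1) by blast
          then show False using n ends_in by blast
        qed auto
      qed
    next
      case 2
      then have "z \<in> inside J'" using K_in by blast
      then have "sup_norm z < 2" "z \<notin> path_image c"
        using lt2 no(2) unfolding J'_def by blast+
      then show ?thesis
        using 2(1) k2 unfolding J_def by auto
    next
      case 3
      then have lt: "sup_norm z < 2" "z \<notin> inside J'" using lt2 th(1) by blast+
      have "z \<in> path_image a \<or> z \<in> path_image b \<or> z \<in> path_image i'"
        using 3(2) lt(1) k'2 unfolding K_def by auto
      then show ?thesis
        using lt(2) i'_in ends_in by blast
    next
      case 4
      then show ?thesis using K_in th(1) by blast
    qed
  qed
  show thesis
    using that[OF sab(1,2)] R1 R2 R3 R4 unfolding J_eq K_def by blast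
qed

text \<open>A point of \<open>E\<close> on a boundary square cannot lie in the open inside of the
  strip, and \<open>L\<close> avoids \<open>a\<close> and \<open>b\<close>, so the point is on
  \<open>i\<close> or \<open>k\<close>; its norm tells which.\<close>

lemma components_in_strip:
  assumes s: "strip a b i k" and L: "L \<inter> (path_image a \<union> path_image b) = {}"
    and R: "strip_region a b i k \<subseteq> square_annulus"
    and E: "E \<in> components L" "crosses_annulus E" "E \<subseteq> strip_region a b i k"
  shows "E \<in> components (L \<inter> strip_region a b i k)" "E \<inter> path_image i \<noteq> {}" "E \<inter> path_image k \<noteq> {}"
proof -
  have EL: "E \<subseteq> L" using E(1) in_components_subset by blast
  show "E \<in> components (L \<inter> strip_region a b i k)"
    by (rule components_intermediate_subset[OF E(1)]) (use EL E(3) in auto)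
  obtain g where g: "simple_path g" "pathfinish g = pathstart g" "path_image g = strip_boundary a b i k"
    using strip_loop[OF s] by metis
  have op: "open (inside (strip_boundary a b i k))"
    using Jordan_inside_outside[OF g(1,2)] g(3) by auto
  have sub: "inside (strip_boundary a b i k) \<subseteq> square_annulus"
    using R by blast
  have on: "z \<in> path_image i \<union> path_image k" if "z \<in> E" "sup_norm z = 1 \<or> sup_norm z = 2" for z
  proof -
    have "z \<notin> inside (strip_boundary a b i k)"
      using open_subset_annulus[OF op sub, of z] that(2) by auto
    then show ?thesis
      using that(1) E(3) EL L by blast
  qed
  have "path_image i \<subseteq> {z. sup_norm z = 1}" "path_image k \<subseteq> {z. sup_norm z = 2}"
    using s unfolding strip_def by blast+
  moreover obtain x y where "x \<in> E" "sup_norm x = 1" "y \<in> E" "sup_norm y = 2"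
    using E(2) unfolding crosses_annulus_def by blast
  ultimately show "E \<inter> path_image i \<noteq> {}" "E \<inter> path_image k \<noteq> {}"
    using on[of x] on[of y] by fastforce+
qed

lemma sup_norm_eq_in_grid:
  assumes "sup_norm z = real m"
  shows "z \<in> grid_lines N"
proof -
  have "\<bar>Re z\<bar> = real m \<or> \<bar>Im z\<bar> = real m"
    using assms unfolding sup_norm_def by linarith
  then have "Re z \<in> \<int> \<or> Im z \<in> \<int>"
    by (metis Ints_abs Ints_minus Ints_of_nat abs_if minus_minus)
  then show ?thesis
    unfolding grid_lines_def by auto
qed

lemma grid_lines_mult:
  assumes "z \<in> grid_lines N"
  shows "z \<in> grid_lines (N * M)"
proof -
  have "real (N * M) * x \<in> \<int>" if "real N * x \<in> \<int>" for x
  proof -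
    have "real M * (real N * x) \<in> \<int>"
      by (rule Ints_mult[OF Ints_of_nat that])
    then show ?thesis by (simp add: mult_ac)
  qed
  then show ?thesis
    using assms unfolding grid_lines_def by blast
qed

lemma strip_exists:
  assumes L: "compact L" "L \<subseteq> square_annulus" and inf: "infinite {E \<in> components L. crosses_annulus E}"
  obtains a b i k where "strip a b i k" "L \<inter> (path_image a \<union> path_image b) = {}"
    "strip_region a b i k \<subseteq> square_annulus" "bounds_disk (strip_boundary a b i k)"
    "infinite {E \<in> components (L \<inter> strip_region a b i k). E \<inter> path_image i \<noteq> {} \<and> E \<inter> path_image k \<noteq> {}}"
proof -
  obtain E1 E2 where E1: "E1 \<in> components L" "crosses_annulus E1" and E2: "E2 \<in> components L" "crosses_annulus E2"
    and ne: "E1 \<noteq> E2"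
  proof -
    obtain E1 where E1: "E1 \<in> {E \<in> components L. crosses_annulus E}"
      using inf not_finite_existsD by fastforce
    moreover have "infinite ({E \<in> components L. crosses_annulus E} - {E1})"
      using inf by simp
    then obtain E2 where "E2 \<in> {E \<in> components L. crosses_annulus E} - {E1}"
      by (metis all_not_in_conv finite.emptyI)
    ultimately show thesis using that by blast
  qed
  have conn: "connected E1" "connected E2" "E1 \<subseteq> L" "E2 \<subseteq> L"
    using E1 E2 in_components_connected in_components_subset by blast+
  have "E1 \<inter> E2 = {}"
    using components_nonoverlap E1(1) E2(1) ne by blast
  \<comment> \<open>A component of a compact set is an intersection of clopen sets, so some clopen
    \<open>T\<close> contains \<open>E1\<close> but not \<open>x\<close>; the connected set
    \<open>E2\<close> then misses \<open>T\<close>.\<close>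
  moreover have "E1 = \<Inter>{T. E1 \<subseteq> T \<and> openin (top_of_set L) T \<and> closedin (top_of_set L) T}"
    by (rule Sura_Bura_compact[OF L(1) E1(1)])
  moreover obtain x where x: "x \<in> E2" using E2(1) in_components_nonempty by blast
  ultimately obtain T where T: "E1 \<subseteq> T" "openin (top_of_set L) T" "closedin (top_of_set L) T" "x \<notin> T"
    by blast
  have comp: "compact T" "compact (L - T)"
    using T closedin_compact[OF L(1)] by (auto intro!: closedin_compact[OF L(1)] closedin_diff)
  have TL: "T \<subseteq> L" using T(3) closedin_imp_subset by blast
  have E2T: "E2 \<subseteq> L - T"
  proof -
    have "E2 \<subseteq> T \<or> E2 \<inter> T = {}"
    proof -
      have "openin (top_of_set E2) (E2 \<inter> T)" "closedin (top_of_set E2) (E2 \<inter> T)"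
        using T(2,3) conn(4) by (auto simp: openin_open closedin_closed)
      then show ?thesis
        using conn(2) unfolding connected_clopen by blast
    qed
    then show ?thesis using x T(4) conn(4) by blast
  qed
  have TA: "T \<subseteq> square_annulus" "L - T \<subseteq> square_annulus"
    using TL L(2) by blast+
  obtain N a where a: "N > 0" "crossing_arc a" "path_image a \<subseteq> grid_lines N" "path_image a \<inter> (T \<union> (L - T)) = {}"
    by (rule crossing_arc_exists[OF comp _ TA conn(1) T(1) E1(2) conn(2) E2T E2(2)]) auto
  have arca: "arc a" using a(2) crossing_arc_def by blast
  have compa: "compact (T \<union> path_image a)"
    using comp(1) arca by (simp add: compact_Un compact_arc_image)
  \<comment> \<open>The first arc is added to \<open>T\<close> and takes the place of
    \<open>E1\<close> as connected crossing set, so the new arc avoids \<open>a\<close> as well as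
    \<open>L\<close>.\<close>
  obtain M b where b: "M > 0" "crossing_arc b" "path_image b \<subseteq> grid_lines M"
    "path_image b \<inter> (T \<union> path_image a \<union> (L - T)) = {}"
  proof (rule crossing_arc_exists[OF compa comp(2) _ _ TA(2), of "path_image a" E2])
    show "(T \<union> path_image a) \<inter> (L - T) = {}" using a(4) by blast
    show "T \<union> path_image a \<subseteq> square_annulus" using TA(1) crossing_arc_in_annulus[OF a(2)] by blast
    show "connected (path_image a)" using arca by (simp add: connected_arc_image)
    show "crosses_annulus (path_image a)" using crosses_annulus_crossing_arc[OF a(2)] .
  qed (use conn E2 E2T in auto)
  have ab: "path_image a \<inter> path_image b = {}" using b(4) by blast
  have Lab: "L \<inter> (path_image a \<union> path_image b) = {}" using a(4) b(4) TL by blast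
  obtain i k i' k' where s: "strip a b i k" "strip a b i' k'"
    and R: "strip_region a b i k \<subseteq> square_annulus" "strip_region a b i' k' \<subseteq> square_annulus"
      "square_annulus \<subseteq> strip_region a b i k \<union> strip_region a b i' k'"
      "strip_region a b i k \<inter> strip_region a b i' k' \<subseteq> path_image a \<union> path_image b"
    by (rule annulus_split[OF a(2) b(2) ab])
  \<comment> \<open>The two arcs may come from different grids; \<open>N * M\<close> refines both,
    and the boundary squares lie in every grid.\<close>
  have disk: "bounds_disk (strip_boundary a b i k)" if st: "strip a b i k" for i k
  proof -
    obtain g where g: "simple_path g" "pathfinish g = pathstart g" "path_image g = strip_boundary a b i k"
      using strip_loop[OF st] by metis
    have "path_image a \<subseteq> grid_lines (N * M)" "path_image b \<subseteq> grid_lines (N * M)"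
      using a(3) b(3) grid_lines_mult[of _ N M] grid_lines_mult[of _ M N] by (auto simp: mult.commute)
    moreover have "path_image i \<subseteq> grid_lines (N * M)" "path_image k \<subseteq> grid_lines (N * M)"
      using st sup_norm_eq_in_grid[of _ 1 "N * M"] sup_norm_eq_in_grid[of _ 2 "N * M"] unfolding strip_def by auto
    ultimately have "path_image g \<subseteq> grid_lines (N * M)"
      unfolding g(3) by blast
    moreover have "N * M > 0" using a(1) b(1) by simp
    ultimately show ?thesis
      using bounds_disk_grid_curve[of "N * M" g] g by simp
  qed
  have closed_region: "closed (strip_region a b i k)" if "strip a b i k" for i k
    using disk[OF that] homeomorphic_compactness compact_cball compact_imp_closed by blast
  let ?A = "{E \<in> components L. crosses_annulus E \<and> E \<subseteq> strip_region a b i k}"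
  let ?B = "{E \<in> components L. crosses_annulus E \<and> E \<subseteq> strip_region a b i' k'}"
  have "{E \<in> components L. crosses_annulus E} \<subseteq> ?A \<union> ?B"
  proof
    fix E assume E: "E \<in> {E \<in> components L. crosses_annulus E}"
    then have "E \<subseteq> L" "connected E"
      using in_components_subset in_components_connected by blast+
    \<comment> \<open>The two closed regions overlap only on \<open>a\<close> and \<open>b\<close>,
      which \<open>L\<close> avoids, so the connected set \<open>E\<close> meets only one of
      them.\<close>
    have "strip_region a b i k \<inter> E = {} \<or> strip_region a b i' k' \<inter> E = {}"
    proof (rule connected_closedD[OF \<open>connected E\<close>])
      show "strip_region a b i k \<inter> strip_region a b i' k' \<inter> E = {}"
        using R(4) Lab \<open>E \<subseteq> L\<close> by blast
      show "E \<subseteq> strip_region a b i k \<union> strip_region a b i' k'"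
        using R(3) L(2) \<open>E \<subseteq> L\<close> by (meson subset_trans)
    qed (use closed_region s in auto)
    moreover have "E \<subseteq> strip_region a b i k \<union> strip_region a b i' k'"
      using R(3) L(2) \<open>E \<subseteq> L\<close> by (meson subset_trans)
    moreover have "E \<subseteq> X \<or> E \<subseteq> Y" if "X \<inter> E = {} \<or> Y \<inter> E = {}" "E \<subseteq> X \<union> Y" for X Y
      using that by blast
    ultimately have "E \<subseteq> strip_region a b i k \<or> E \<subseteq> strip_region a b i' k'"
      by metis
    then show "E \<in> ?A \<union> ?B"
      using E by blast
  qed
  then have "infinite ?A \<or> infinite ?B"
    using inf finite_subset by blast
  then show thesis
  proof
    assume "infinite ?A"
    moreover have "?A \<subseteq> {E \<in> components (L \<inter> strip_region a b i k). E \<inter> path_image i \<noteq> {} \<and> E \<inter> path_image k \<noteq> {}}"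
      using components_in_strip[OF s(1) Lab R(1)] by blast
    ultimately have "infinite {E \<in> components (L \<inter> strip_region a b i k). E \<inter> path_image i \<noteq> {} \<and> E \<inter> path_image k \<noteq> {}}"
      by (meson finite_subset)
    then show thesis
      by (rule that[OF s(1) Lab R(1) disk[OF s(1)]])
  next
    assume "infinite ?B"
    moreover have "?B \<subseteq> {E \<in> components (L \<inter> strip_region a b i' k'). E \<inter> path_image i' \<noteq> {} \<and> E \<inter> path_image k' \<noteq> {}}"
      using components_in_strip[OF s(2) Lab R(2)] by blast
    ultimately have "infinite {E \<in> components (L \<inter> strip_region a b i' k'). E \<inter> path_image i' \<noteq> {} \<and> E \<inter> path_image k' \<noteq> {}}"
      by (meson finite_subset)
    then show thesis
      by (rule that[OF s(2) Lab R(2) disk[OF s(2)]])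
  qed
qed

section \<open>Hausdorff limits and components of compacta\<close>

text \<open>The boundary bumping theorem, moved from abstract spaces to subsets:
  \<open>closure (C - D)\<close> contains the frontier of \<open>C \<inter> D\<close> relative to
  \<open>C\<close>.\<close>

lemma boundary_bumping:
  fixes C D :: "'a::metric_space set"
  assumes C: "compact C" "connected C" and D: "closed D" and x: "x \<in> C" "x \<in> D" and "\<not> C \<subseteq> D"
  shows "connected_component_set (C \<inter> D) x \<inter> closure (C - D) \<noteq> {}"
proof -
  let ?X = "top_of_set C"
  have sub: "subtopology ?X (C \<inter> D) = top_of_set (C \<inter> D)"
    by (simp add: subtopology_subtopology Int_absorb2)
  have "connected_component_of (top_of_set (C \<inter> D)) x y \<longleftrightarrow> connected_component (C \<inter> D) x y" for y
    unfolding connected_component_of_def connected_component_def by (auto simp: connectedin_subtopology)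
  then have "connected_component_set (C \<inter> D) x = connected_component_of_set (top_of_set (C \<inter> D)) x"
    by auto
  then have "connected_component_set (C \<inter> D) x \<in> connected_components_of (subtopology ?X (C \<inter> D))"
    unfolding sub connected_components_of_def using x by auto
  moreover have "closedin ?X (C \<inter> D)"
    using D by (auto simp: closedin_closed)
  moreover have "C \<inter> D \<noteq> C"
    using assms by blast
  ultimately have "connected_component_set (C \<inter> D) x \<inter> ?X frontier_of (C \<inter> D) \<noteq> {}"
    using C by (intro boundary_bumping_theorem_closed)
      (auto simp: connected_space_subtopology compact_space_subtopology Hausdorff_space_subtopology)
  moreover have "?X frontier_of (C \<inter> D) \<subseteq> closure (C - D)"
  proof -
    have "?X frontier_of (C \<inter> D) \<subseteq> ?X closure_of (C - D)"
      unfolding frontier_of_closures by (auto simp: Diff_Int)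
    also have "\<dots> \<subseteq> closure (C - D)"
      using closure_of_subtopology_subset[of euclidean C "C - D"] by auto
    finally show ?thesis .
  qed
  ultimately show ?thesis by blast
qed

lemma bdd_above_infdist:
  fixes A B :: "'a::metric_space set"
  assumes "compact A"
  shows "bdd_above ((\<lambda>a. infdist a B) ` A)"
  using assms
  by (intro bounded_imp_bdd_above compact_imp_bounded compact_continuous_image continuous_intros)

text \<open>Compactness bounds both families of distances, so the suprema in
  \<open>hausdorff_distance\<close> are true upper bounds.\<close>

lemma infdist_le_hausdorff_distance:
  fixes A B :: "'a::metric_space set"
  assumes "compact A" "compact B"
  shows "a \<in> A \<Longrightarrow> infdist a B \<le> hausdorff_distance A B"
    and "b \<in> B \<Longrightarrow> infdist b A \<le> hausdorff_distance A B"
  unfolding hausdorff_distance_def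
  by (rule max.coboundedI1, erule cSUP_upper, rule bdd_above_infdist[OF assms(1)])
     (rule max.coboundedI2, erule cSUP_upper, rule bdd_above_infdist[OF assms(2)])

lemma hausdorff_distance_le:
  assumes "A \<noteq> {}" "B \<noteq> {}" "\<And>a. a \<in> A \<Longrightarrow> infdist a B \<le> e" "\<And>b. b \<in> B \<Longrightarrow> infdist b A \<le> e"
  shows "hausdorff_distance A B \<le> e"
  unfolding hausdorff_distance_def using assms by (simp add: cSUP_least)

lemma compact_countable_dense:
  fixes K :: "'a::metric_space set"
  assumes "compact K"
  obtains S where "countable S" "S \<subseteq> K" "\<And>x e. x \<in> K \<Longrightarrow> e > 0 \<Longrightarrow> \<exists>s\<in>S. dist x s < e"
proof -
  have "\<forall>e>0. \<exists>k. finite k \<and> k \<subseteq> K \<and> K \<subseteq> (\<Union>x\<in>k. ball x e)"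
    using assms compact_imp_seq_compact seq_compact_imp_totally_bounded by blast
  then have "\<forall>m. \<exists>k. finite k \<and> k \<subseteq> K \<and> K \<subseteq> (\<Union>x\<in>k. ball x (inverse (real (Suc m))))"
    by simp
  then obtain k where k: "\<And>m. finite (k m)" "\<And>m. k m \<subseteq> K"
    "\<And>m. K \<subseteq> (\<Union>x\<in>k m. ball x (inverse (real (Suc m))))"
    by metis
  show thesis
  proof
    show "countable (\<Union>m. k m)"
      using k(1) by (simp add: countable_finite)
    show "(\<Union>m. k m) \<subseteq> K"
      using k(2) by blast
    fix x and e :: real assume "x \<in> K" "e > 0"
    then obtain m where m: "inverse (real (Suc m)) < e"
      using reals_Archimedean by blast
    obtain s where "s \<in> k m" "dist s x < inverse (real (Suc m))"
      using k(3)[of m] \<open>x \<in> K\<close> by auto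
    then show "\<exists>s\<in>(\<Union>m. k m). dist x s < e"
      using m by (intro bexI[of _ s]) (auto simp: dist_commute)
  qed
qed

text \<open>A diagonal argument gives convergence at countably many dense points;
  \<open>infdist\<close> is 1-Lipschitz in the point, which carries the Cauchy property over to all
  of \<open>K\<close>.\<close>

lemma infdist_convergent_subsequence:
  fixes X :: "nat \<Rightarrow> 'a::metric_space set"
  assumes K: "compact K" and X: "\<And>n. X n \<noteq> {}" "\<And>n. X n \<subseteq> K"
  obtains r where "strict_mono (r :: nat \<Rightarrow> nat)" "\<forall>x\<in>K. convergent (\<lambda>n. infdist x (X (r n)))"
proof -
  obtain S where S: "countable S" "S \<subseteq> K" "\<And>x e. x \<in> K \<Longrightarrow> e > 0 \<Longrightarrow> \<exists>s\<in>S. dist x s < e"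
    using compact_countable_dense[OF K] by metis
  obtain B where B: "\<And>x y. x \<in> K \<Longrightarrow> y \<in> K \<Longrightarrow> dist x y \<le> B"
    using compact_imp_bounded[OF K] bounded_two_points by metis
  have "norm (infdist x (X n)) \<le> B" if "x \<in> S" for n x
  proof -
    obtain y where "y \<in> X n" using X(1) by blast
    then have "infdist x (X n) \<le> dist x y" "dist x y \<le> B"
      using B[of x y] S(2) X(2)[of n] that by (auto intro: infdist_le)
    then show ?thesis by (simp add: infdist_nonneg)
  qed
  then obtain r where r: "strict_mono (r :: nat \<Rightarrow> nat)"
    "\<And>x. x \<in> S \<Longrightarrow> \<exists>l. (\<lambda>n. infdist x (X (r n))) \<longlonglongrightarrow> l"
    using function_convergent_subsequence[OF S(1), of "\<lambda>n x. infdist x (X n)" B] by metis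
  have "Cauchy (\<lambda>n. infdist x (X (r n)))" if x: "x \<in> K" for x
  proof (rule metric_CauchyI)
    fix e :: real assume "e > 0"
    then obtain s where s: "s \<in> S" "dist x s < e / 3"
      using S(3)[OF x, of "e / 3"] by auto
    have "Cauchy (\<lambda>n. infdist s (X (r n)))"
      using r(2)[OF s(1)] LIMSEQ_imp_Cauchy by blast
    then obtain N where N: "\<And>m n. m \<ge> N \<Longrightarrow> n \<ge> N \<Longrightarrow> dist (infdist s (X (r m))) (infdist s (X (r n))) < e / 3"
      using \<open>e > 0\<close> unfolding Cauchy_def by (metis divide_pos_pos zero_less_numeral)
    have "dist (infdist x (X (r m))) (infdist x (X (r n))) < e" if "m \<ge> N" "n \<ge> N" for m n
      using N[OF that] infdist_triangle_abs[of x "X (r m)" s] infdist_triangle_abs[of x "X (r n)" s] s(2)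
      unfolding dist_real_def by linarith
    then show "\<exists>N. \<forall>m\<ge>N. \<forall>n\<ge>N. dist (infdist x (X (r m))) (infdist x (X (r n))) < e"
      by blast
  qed
  then show thesis
    using that[OF r(1)] by (simp add: Cauchy_convergent_iff)
qed

lemma convergent_subseq_limit:
  assumes "convergent (f :: nat \<Rightarrow> real)" "strict_mono (u :: nat \<Rightarrow> nat)" "(\<lambda>n. f (u n)) \<longlonglongrightarrow> l"
  shows "f \<longlonglongrightarrow> l"
proof -
  obtain m where m: "f \<longlonglongrightarrow> m"
    using assms(1) convergent_def by blast
  then have "(\<lambda>n. f (u n)) \<longlonglongrightarrow> m"
    using LIMSEQ_subseq_LIMSEQ[OF m assms(2)] by (simp add: o_def)
  then show ?thesis
    using assms(3) m LIMSEQ_unique by blast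
qed

lemma compact_closed_separated:
  fixes A B :: "'a::metric_space set"
  assumes A: "compact A" and B: "closed B" and AB: "A \<inter> B = {}"
  obtains d where "d > 0" "\<forall>x\<in>A. \<forall>y\<in>B. d \<le> dist x y"
proof (cases "A = {} \<or> B = {}")
  case True
  then show thesis using that[of 1] by auto
next
  case False
  have "continuous_on A (\<lambda>x. infdist x B)"
    by (intro continuous_intros)
  then obtain x0 where x0: "x0 \<in> A" "\<forall>x\<in>A. infdist x0 B \<le> infdist x B"
    using continuous_attains_inf[OF A] False by blast
  show thesis
  proof (rule that[of "infdist x0 B"])
    show "infdist x0 B > 0"
      using x0(1) AB False by (intro infdist_pos_not_in_closed[OF B]) auto
    show "\<forall>x\<in>A. \<forall>y\<in>B. infdist x0 B \<le> dist x y"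
      using x0(2) by (meson infdist_le order_trans)
  qed
qed

text \<open>Blaschke selection: the limit is the set of points whose distance to the sets tends to zero.\<close>

lemma hausdorff_convergent_subsequence:
  fixes X :: "nat \<Rightarrow> 'a::metric_space set"
  assumes K: "compact K" and X: "\<And>n. X n \<noteq> {}" "\<And>n. X n \<subseteq> K" "\<And>n. connected (X n)"
  obtains r Y where "strict_mono (r :: nat \<Rightarrow> nat)" "continuum Y"
    "(\<lambda>n. hausdorff_distance (X (r n)) Y) \<longlonglongrightarrow> 0"
proof -
  obtain r where r: "strict_mono (r :: nat \<Rightarrow> nat)" "\<forall>x\<in>K. convergent (\<lambda>n. infdist x (X (r n)))"
    by (rule infdist_convergent_subsequence[of K X, OF K X(1,2)])
  define Z where "Z = (\<lambda>n. X (r n))"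
  have Z: "Z n \<noteq> {}" "Z n \<subseteq> K" "connected (Z n)" for n
    using X unfolding Z_def by auto
  have conv: "convergent (\<lambda>n. infdist x (Z n))" if "x \<in> K" for x
    using r(2) that unfolding Z_def by blast
  define Y where "Y = {x \<in> K. (\<lambda>n. infdist x (Z n)) \<longlonglongrightarrow> 0}"
  \<comment> \<open>Accumulation points of points chosen from the sets belong to \<open>Y\<close>:
    the distances tend to 0 along a subsequence, and the full sequence of distances is known to
    converge.\<close>
  have limY: "a \<in> Y" if u: "strict_mono (u :: nat \<Rightarrow> nat)" and f: "\<And>n. f n \<in> Z (u n)" "f \<longlonglongrightarrow> a" "a \<in> K" for u f a
  proof -
    have "(\<lambda>n. infdist a (Z (u n))) \<longlonglongrightarrow> 0"
    proof (rule tendsto_sandwich[OF always_eventually always_eventually tendsto_const])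
      show "\<forall>n. 0 \<le> infdist a (Z (u n))" by (simp add: infdist_nonneg)
      show "\<forall>n. infdist a (Z (u n)) \<le> dist a (f n)" using f(1) infdist_le by blast
      show "(\<lambda>n. dist a (f n)) \<longlonglongrightarrow> 0"
        using tendsto_dist[OF tendsto_const[of a] f(2)] by simp
    qed
    then show ?thesis
      unfolding Y_def using convergent_subseq_limit[OF conv[OF f(3)] u] f(3) by blast
  qed
  have seqK: "\<exists>a v. a \<in> K \<and> strict_mono (v :: nat \<Rightarrow> nat) \<and> (\<lambda>n. f (v n)) \<longlonglongrightarrow> a" if "\<And>n. f n \<in> K" for f
    using K that unfolding compact_def o_def by blast
  have "Y \<noteq> {}"
  proof -
    have "\<forall>n. \<exists>x. x \<in> Z n" using Z(1) by blast
    then obtain f where f: "\<And>n. f n \<in> Z n" by metis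
    then obtain a v where "a \<in> K" "strict_mono (v :: nat \<Rightarrow> nat)" "(\<lambda>n. f (v n)) \<longlonglongrightarrow> a"
      using seqK[of f] Z(2) by blast
    then have "a \<in> Y" using limY[of v "\<lambda>n. f (v n)" a] f by blast
    then show ?thesis by blast
  qed
  have "closed Y"
    unfolding closed_sequential_limits
  proof (intro allI impI)
    fix f a assume fa: "(\<forall>n. f n \<in> Y) \<and> f \<longlonglongrightarrow> a"
    then have "a \<in> K"
      using compact_imp_closed[OF K] closed_sequential_limits unfolding Y_def by blast
    moreover have "(\<lambda>n. infdist a (Z n)) \<longlonglongrightarrow> 0"
    proof (rule tendstoI)
      fix e :: real assume "e > 0"
      then obtain j where j: "dist (f j) a < e / 2"
        using fa by (meson half_gt_zero lim_sequentially order_refl)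
      have "(\<lambda>n. infdist (f j) (Z n)) \<longlonglongrightarrow> 0" using fa unfolding Y_def by blast
      then have "\<forall>\<^sub>F n in sequentially. dist (infdist (f j) (Z n)) 0 < e / 2"
        using \<open>e > 0\<close> by (intro tendstoD) auto
      then show "\<forall>\<^sub>F n in sequentially. dist (infdist a (Z n)) 0 < e"
      proof eventually_elim
        case (elim n)
        then show ?case
          using infdist_triangle[of a "Z n" "f j"] j infdist_nonneg[of a "Z n"] infdist_nonneg[of "f j" "Z n"]
          by (simp add: dist_commute)
      qed
    qed
    ultimately show "a \<in> Y" unfolding Y_def by blast
  qed
  then have compY: "compact Y"
    using closed_Int_compact[OF _ K] by (metis (no_types, lifting) Y_def inf.orderE mem_Collect_eq subsetI)
  \<comment> \<open>This estimate and the next one are uniform by compactness: a sequence of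
    violations would accumulate at a point of \<open>Y\<close>, where the distances tend to
    0.\<close>
  have ev1: "\<forall>\<^sub>F n in sequentially. \<forall>a\<in>Z n. infdist a Y \<le> e" if "e > 0" for e
  proof (rule ccontr)
    assume "\<not> ?thesis"
    then obtain u where u: "strict_mono (u :: nat \<Rightarrow> nat)" "\<And>n. \<not> (\<forall>a\<in>Z (u n). infdist a Y \<le> e)"
      using not_eventually_sequentiallyD by blast
    then obtain f where f: "\<And>n. f n \<in> Z (u n)" "\<And>n. infdist (f n) Y > e"
      by (metis not_le)
    obtain a v where av: "a \<in> K" "strict_mono (v :: nat \<Rightarrow> nat)" "(\<lambda>n. f (v n)) \<longlonglongrightarrow> a"
      using seqK[of f] f(1) Z(2) by blast
    have "a \<in> Y"
      using limY[of "u \<circ> v" "\<lambda>n. f (v n)" a] f(1) av u(1) by (simp add: strict_mono_o)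
    obtain n where "dist (f (v n)) a < e"
      using av(3) \<open>e > 0\<close> by (meson lim_sequentially order_refl)
    then show False
      using infdist_le[OF \<open>a \<in> Y\<close>, of "f (v n)"] f(2)[of "v n"] by linarith
  qed
  have ev2: "\<forall>\<^sub>F n in sequentially. \<forall>b\<in>Y. infdist b (Z n) \<le> e" if "e > 0" for e
  proof (rule ccontr)
    assume "\<not> ?thesis"
    then obtain u where u: "strict_mono (u :: nat \<Rightarrow> nat)" "\<And>n. \<not> (\<forall>b\<in>Y. infdist b (Z (u n)) \<le> e)"
      using not_eventually_sequentiallyD by blast
    then obtain f where f: "\<And>n. f n \<in> Y" "\<And>n. infdist (f n) (Z (u n)) > e"
      by (metis not_le)
    obtain b v where bv: "b \<in> Y" "strict_mono (v :: nat \<Rightarrow> nat)" "(\<lambda>n. f (v n)) \<longlonglongrightarrow> b"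
      using compY f(1) unfolding compact_def o_def by blast
    have "(\<lambda>n. infdist b (Z n)) \<longlonglongrightarrow> 0" using bv(1) unfolding Y_def by blast
    then have "(\<lambda>n. infdist b (Z (u (v n)))) \<longlonglongrightarrow> 0"
      using LIMSEQ_subseq_LIMSEQ[OF _ strict_mono_o[OF u(1) bv(2)]] by (force simp: o_def)
    then have "(\<lambda>n. infdist b (Z (u (v n))) + dist (f (v n)) b) \<longlonglongrightarrow> 0 + dist b b"
      by (intro tendsto_intros bv(3))
    then have "\<forall>\<^sub>F n in sequentially. infdist b (Z (u (v n))) + dist (f (v n)) b < e"
      using \<open>e > 0\<close> by (intro order_tendstoD) auto
    then obtain n where "infdist b (Z (u (v n))) + dist (f (v n)) b < e"
      using eventually_happens'[OF sequentially_bot] by blast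
    then show False
      using infdist_triangle[of "f (v n)" "Z (u (v n))" b] f(2)[of "v n"] by linarith
  qed
  have "(\<lambda>n. hausdorff_distance (Z n) Y) \<longlonglongrightarrow> 0"
  proof (rule tendstoI)
    fix e :: real assume "e > 0"
    then have "e / 2 > 0" by simp
    from ev1[OF this] ev2[OF this] show "\<forall>\<^sub>F n in sequentially. dist (hausdorff_distance (Z n) Y) 0 < e"
    proof eventually_elim
      case (elim n)
      then have "hausdorff_distance (Z n) Y \<le> e / 2"
        using Z(1) \<open>Y \<noteq> {}\<close> by (intro hausdorff_distance_le) auto
      moreover have "0 \<le> hausdorff_distance (Z n) Y"
      proof -
        obtain b where "b \<in> Y" using \<open>Y \<noteq> {}\<close> by blast
        then have "infdist b (Z n) \<le> (SUP b\<in>Y. infdist b (Z n))"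
          by (intro cSUP_upper bdd_above_infdist compY)
        then show ?thesis
          using infdist_nonneg[of b "Z n"] unfolding hausdorff_distance_def by (simp add: le_max_iff_disj)
      qed
      ultimately show ?case using \<open>e > 0\<close> by simp
    qed
  qed
  moreover have "connected Y"
  proof (rule ccontr)
    assume "\<not> connected Y"
    then obtain A B where AB: "closed A" "closed B" "Y \<subseteq> A \<union> B" "A \<inter> B \<inter> Y = {}" "A \<inter> Y \<noteq> {}" "B \<inter> Y \<noteq> {}"
      unfolding connected_closed by blast
    define A' B' where "A' = A \<inter> Y" and "B' = B \<inter> Y"
    have "compact A'" "closed B'" "A' \<inter> B' = {}"
      using AB compY \<open>closed Y\<close> unfolding A'_def B'_def by auto
    then obtain d where d: "d > 0" "\<forall>x\<in>A'. \<forall>y\<in>B'. d \<le> dist x y"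
      by (rule compact_closed_separated)
    \<comment> \<open>\<open>P A'\<close> and \<open>P B'\<close> are disjoint because 2d/3 < d,
      while a set \<open>Z n\<close> that is within d/4 of \<open>Y\<close> in both directions is
      covered by them and meets both.\<close>
    define P where "P = (\<lambda>C :: 'a set. {x :: 'a. infdist x C < d / 3})"
    have opP: "open (P C)" for C
      unfolding P_def by (intro open_Collect_less continuous_intros)
    have "d / 4 > 0" using d by simp
    then obtain n where n: "\<forall>a\<in>Z n. infdist a Y \<le> d / 4" "\<forall>b\<in>Y. infdist b (Z n) \<le> d / 4"
      using eventually_happens'[OF sequentially_bot eventually_conj[OF ev1 ev2]] by blast
    have near: "\<exists>y\<in>C. dist x y < d / 3" if "infdist x C < d / 3" "C \<noteq> {}" for x and C :: "'a set"
      using that by (metis infdist_notempty cINF_less_iff bdd_below_image_dist)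
    have "P A' \<inter> P B' \<inter> Z n = {}"
    proof -
      have False if x: "x \<in> P A'" "x \<in> P B'" for x
      proof -
        obtain y z where "y \<in> A'" "z \<in> B'" "dist x y < d / 3" "dist x z < d / 3"
          using near[of x A'] near[of x B'] x AB(5,6) unfolding P_def A'_def B'_def by blast
        moreover have "d \<le> dist y z"
          using d(2) \<open>y \<in> A'\<close> \<open>z \<in> B'\<close> by blast
        ultimately show False
          using d(1) dist_triangle3[of y z x] by linarith
      qed
      then show ?thesis by blast
    qed
    moreover have "Z n \<subseteq> P A' \<union> P B'"
    proof
      fix x assume "x \<in> Z n"
      then have "infdist x Y < d / 3" using n(1) d by force
      then obtain y where "y \<in> Y" "dist x y < d / 3" using near[of x Y] \<open>Y \<noteq> {}\<close> by blast
      then have "y \<in> A' \<or> y \<in> B'" using AB(3) unfolding A'_def B'_def by blast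
      then show "x \<in> P A' \<union> P B'"
        using \<open>dist x y < d / 3\<close> infdist_le[of y A' x] infdist_le[of y B' x] unfolding P_def by auto
    qed
    moreover have meets: "P C \<inter> Z n \<noteq> {}" if C: "C \<subseteq> Y" "C \<noteq> {}" for C
    proof -
      obtain b where b: "b \<in> C" using C by blast
      then have "infdist b (Z n) < d / 3" using n(2) d C by force
      then obtain z where "z \<in> Z n" "dist b z < d / 3" using near[of b "Z n"] Z(1) by blast
      then have "z \<in> P C"
        using infdist_le[OF b, of z] unfolding P_def by (simp add: dist_commute)
      then show ?thesis using \<open>z \<in> Z n\<close> by blast
    qed
    ultimately show False
      using connectedD[OF Z(3) opP opP] meets[of A'] meets[of B'] AB(5,6) unfolding A'_def B'_def by blast
  qed
  ultimately show thesis
    using that[OF r(1), of Y] compY \<open>Y \<noteq> {}\<close> unfolding continuum_def Z_def by blast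
qed

section \<open>Components near a point where a compactum fails to be Peano\<close>

lemma compact_in_components:
  fixes K :: "'a::t2_space set"
  assumes "compact K" "C \<in> components K"
  shows "compact C"
  using closedin_component[OF assms(2)] closedin_compact[OF assms(1)] by blast

text \<open>Either \<open>p\<close> is a limit of points from infinitely many large components, or
  some component is not connected im kleinen at \<open>p\<close>; both give the same conclusion. It
  is stated for all \<open>D\<close> and \<open>W\<close> because these are later taken from a chart
  around \<open>p\<close>. The set \<open>closure (K - D)\<close> stands for the relative boundary
  of \<open>D\<close>.\<close>

lemma not_peano_compactum_components:
  fixes K :: "'a::metric_space set"
  assumes K: "compact K" and n: "\<not> peano_compactum K"
  obtains p v where "p \<in> K" "open v" "p \<in> v"
    "\<And>D W. closed D \<Longrightarrow> D \<subseteq> v \<Longrightarrow> open W \<Longrightarrow> p \<in> W \<Longrightarrow> K \<inter> W \<subseteq> D \<Longrightarrow>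
       infinite {E \<in> components (K \<inter> D). E \<inter> W \<noteq> {} \<and> E \<inter> closure (K - D) \<noteq> {}}"
proof -
  \<comment> \<open>The component of \<open>y\<close> in \<open>K \<inter> D\<close> contains the
    one in \<open>C \<inter> D\<close>, which reaches the closure of \<open>C - D\<close> by
    boundary bumping.\<close>
  have bump: "connected_component_set (K \<inter> D) y \<in>
      {E \<in> components (K \<inter> D). E \<inter> W \<noteq> {} \<and> E \<inter> closure (K - D) \<noteq> {}}"
    if C: "C \<in> components K" "\<not> C \<subseteq> D" and D: "closed D" and y: "y \<in> C" "y \<in> D" "y \<in> W" for C D W y
  proof -
    have CK: "C \<subseteq> K" "connected C" "compact C"
      using in_components_subset[OF C(1)] in_components_connected[OF C(1)] compact_in_components[OF K C(1)]
      by simp_all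
    have "connected_component_set (C \<inter> D) y \<inter> closure (C - D) \<noteq> {}"
      using boundary_bumping[OF CK(3,2) D y(1,2) C(2)] .
    moreover have "connected_component_set (C \<inter> D) y \<subseteq> connected_component_set (K \<inter> D) y"
      using CK(1) by (intro connected_component_mono) blast
    moreover have "closure (C - D) \<subseteq> closure (K - D)"
      using CK(1) by (intro closure_mono) blast
    ultimately have "connected_component_set (K \<inter> D) y \<inter> closure (K - D) \<noteq> {}"
      by blast
    moreover have "connected_component_set (K \<inter> D) y \<in> components (K \<inter> D)"
      using CK(1) y by (intro componentsI) blast
    moreover have "y \<in> connected_component_set (K \<inter> D) y"
      using CK(1) y by (simp add: connected_component_refl) blast
    ultimately show ?thesis
      using y(3) by blast
  qed
  consider e where "e > 0" "infinite {C \<in> components K. diameter C > e}"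
    | C where "C \<in> components K" "\<not> peano_continuum C"
    using n K unfolding peano_compactum_def by blast
  then show thesis
  proof cases
    case 1
    then obtain C :: "nat \<Rightarrow> 'a set" where C: "inj C" "range C \<subseteq> {C \<in> components K. diameter C > e}"
      using infinite_countable_subset by blast
    then have "\<forall>n. \<exists>x. x \<in> C n"
      using in_components_nonempty by blast
    then obtain f where f: "\<And>n. f n \<in> C n" by metis
    then have "\<And>n. f n \<in> K"
      using C(2) in_components_subset by blast
    then obtain p r where p: "p \<in> K" "strict_mono (r :: nat \<Rightarrow> nat)" "(\<lambda>n. f (r n)) \<longlonglongrightarrow> p"
      using K unfolding compact_def o_def by blast
    \<comment> \<open>Points of this ball are less than 2e/3 apart, so a component of diameter
      greater than \<open>e\<close> cannot lie in \<open>D\<close>.\<close>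
    show thesis
    proof (rule that[OF p(1), of "ball p (e / 3)"])
      fix D W assume D: "closed D" "D \<subseteq> ball p (e / 3)" and W: "open W" "p \<in> W" "K \<inter> W \<subseteq> D"
      have notsub: "\<not> C n \<subseteq> D" for n
      proof
        assume "C n \<subseteq> D"
        then have sub: "C n \<subseteq> ball p (e / 3)" using D(2) by blast
        moreover have "e < diameter (C n)" using C(2) by blast
        ultimately obtain x y where "x \<in> C n" "y \<in> C n" "e < dist x y"
          using diameter_lower_bounded[of "C n" e] 1(1) bounded_subset[OF bounded_ball] by blast
        moreover have "dist p x < e / 3" "dist p y < e / 3"
          using sub \<open>x \<in> C n\<close> \<open>y \<in> C n\<close> by auto
        ultimately show False
          using dist_triangle3[of x y p] 1(1) by linarith
      qed
      obtain N where N: "\<And>n. n \<ge> N \<Longrightarrow> f (r n) \<in> W"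
        using topological_tendstoD[OF p(3) W(1,2)] unfolding eventually_sequentially by blast
      let ?E = "\<lambda>n. connected_component_set (K \<inter> D) (f (r (n + N)))"
      have comp: "C n \<in> components K" for n using C(2) by blast
      have fD: "f (r (n + N)) \<in> W" "f (r (n + N)) \<in> D" for n
        using N[of "n + N"] W(3) \<open>\<And>n. f n \<in> K\<close> by auto
      have mem: "?E n \<in> {E \<in> components (K \<inter> D). E \<inter> W \<noteq> {} \<and> E \<inter> closure (K - D) \<noteq> {}}" for n
        by (rule bump[OF comp notsub D(1) f fD(2,1)])
      \<comment> \<open>Each piece stays in its own component of \<open>K\<close>, so different
        indices give different pieces.\<close>
      have sub: "?E n \<subseteq> C (r (n + N))" for n
      proof (rule components_maximal[OF comp])
        show "connected (?E n)" by simp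
        show "?E n \<subseteq> K" using connected_component_subset by blast
        have "f (r (n + N)) \<in> ?E n"
          using fD \<open>\<And>n. f n \<in> K\<close> by (simp add: connected_component_refl_eq)
        then show "C (r (n + N)) \<inter> ?E n \<noteq> {}"
          using f by blast
      qed
      have "inj ?E"
      proof (rule injI)
        fix m n assume eq: "?E m = ?E n"
        have "?E m \<noteq> {}" using mem[of m] by blast
        then have "C (r (m + N)) \<inter> C (r (n + N)) \<noteq> {}"
          using sub[of m] sub[of n] eq by blast
        then have "C (r (m + N)) = C (r (n + N))"
          using comp components_nonoverlap by blast
        then show "m = n"
          using injD[OF C(1), of "r (m + N)" "r (n + N)"] strict_mono_eq[OF p(2)] by simp
      qed
      then have "infinite (range ?E)"
        using finite_imageD infinite_UNIV_nat by blast
      moreover have "range ?E \<subseteq> {E \<in> components (K \<inter> D). E \<inter> W \<noteq> {} \<and> E \<inter> closure (K - D) \<noteq> {}}"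
        using mem by blast
      ultimately show "infinite {E \<in> components (K \<inter> D). E \<inter> W \<noteq> {} \<and> E \<inter> closure (K - D) \<noteq> {}}"
        using finite_subset by blast
    qed (use 1 in auto)
  next
    case 2
    have C: "C \<subseteq> K" "connected C" "compact C" "C \<noteq> {}"
      using in_components_subset[OF 2(1)] in_components_connected[OF 2(1)] compact_in_components[OF K 2(1)]
        in_components_nonempty[OF 2(1)] by simp_all
    then have "\<not> locally connected C"
      using 2(2) unfolding peano_continuum_def continuum_def by blast
    \<comment> \<open>Failure of the im kleinen criterion: every neighbourhood \<open>u\<close> of
      \<open>p\<close> inside \<open>v0\<close> contains a point that no connected subset of
      \<open>v0\<close> joins to \<open>p\<close>.\<close>
    then obtain v0 p where v0: "openin (top_of_set C) v0" "p \<in> v0"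
      and no: "\<And>u. openin (top_of_set C) u \<Longrightarrow> p \<in> u \<Longrightarrow> u \<subseteq> v0 \<Longrightarrow>
        \<exists>y\<in>u. \<not> (\<exists>c. connected c \<and> c \<subseteq> v0 \<and> p \<in> c \<and> y \<in> c)"
      unfolding locally_connected_im_kleinen by metis
    obtain v where v: "open v" "v0 = C \<inter> v"
      using v0(1) openin_open by metis
    have pC: "p \<in> C" "p \<in> v" using v0(2) v(2) by auto
    show thesis
    proof (rule that[of p v])
      fix D W assume D: "closed D" "D \<subseteq> v" and W: "open W" "p \<in> W" "K \<inter> W \<subseteq> D"
      let ?F = "{E \<in> components (K \<inter> D). E \<inter> W \<noteq> {} \<and> E \<inter> closure (K - D) \<noteq> {}}"
      show "infinite ?F"
      proof
        assume fin: "finite ?F"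
        \<comment> \<open>If there were only finitely many pieces, those missing \<open>p\<close>
          would have a closed union, and removing it would leave a neighbourhood \<open>u\<close> of
          \<open>p\<close>. The piece of the bad point \<open>y\<close> in \<open>u\<close> would
          then contain \<open>p\<close> and join \<open>y\<close> to \<open>p\<close> within
          \<open>v0\<close>.\<close>
        define G where "G = \<Union> {E \<in> ?F. p \<notin> E}"
        have "closed E" if "E \<in> components (K \<inter> D)" for E
          using that K D(1) by (metis compact_Int_closed compact_in_components compact_imp_closed)
        then have "closed G"
          unfolding G_def by (intro closed_Union finite_subset[OF _ fin]) blast+
        define u where "u = C \<inter> (W \<inter> v - G)"
        have "openin (top_of_set C) u"
          unfolding u_def using W(1) v(1) \<open>closed G\<close> by (intro openin_open_Int) auto
        moreover have "p \<in> u"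
          unfolding u_def G_def using pC W(2) by blast
        moreover have "u \<subseteq> v0" unfolding u_def v(2) by blast
        ultimately obtain y where y: "y \<in> u" "\<not> (\<exists>c. connected c \<and> c \<subseteq> v0 \<and> p \<in> c \<and> y \<in> c)"
          using no by blast
        have yC: "y \<in> C" "y \<in> W" "y \<in> D" "y \<notin> G"
          using y(1) C(1) W(3) unfolding u_def by auto
        have "\<not> C \<subseteq> D"
        proof
          assume "C \<subseteq> D"
          then have "C \<subseteq> v0" using D(2) v(2) by blast
          then show False using y(2) C(2) pC(1) yC(1) by blast
        qed
        then have mem: "connected_component_set (K \<inter> D) y \<in> ?F"
          using bump[OF 2(1) _ D(1) yC(1,3,2)] by blast
        let ?E = "connected_component_set (K \<inter> D) y"
        have yE: "y \<in> ?E"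
          using yC C(1) by (simp add: connected_component_refl_eq) blast
        have "p \<notin> ?E"
        proof
          assume pE: "p \<in> ?E"
          have "?E \<subseteq> C"
          proof (rule components_maximal[OF 2(1)])
            show "connected ?E" by simp
            show "?E \<subseteq> K" using connected_component_subset by blast
            show "C \<inter> ?E \<noteq> {}" using yE yC(1) by blast
          qed
          moreover have "?E \<subseteq> D" using connected_component_subset by blast
          ultimately have "?E \<subseteq> v0" using D(2) v(2) by blast
          then show False using y(2) pE yE connected_connected_component by blast
        qed
        then have "y \<in> G" unfolding G_def using mem yE by blast
        then show False using yC(4) by blast
      qed
    qed (use pC v C in auto)
  qed
qed

section \<open>Quadrilaterals in a surface\<close>

lemma homeomorphism_image_image:
  assumes "homeomorphism S T f g" "X \<subseteq> S"
  shows "g ` f ` X = X"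
proof -
  have "g (f x) = x" if "x \<in> X" for x
    using homeomorphism_apply1[OF assms(1)] assms(2) that by blast
  then show ?thesis
    by (simp add: image_image)
qed

lemma homeomorphism_image_component:
  assumes h: "homeomorphism S T f g" and C: "C \<in> components S"
  shows "f ` C \<in> components T"
proof -
  have C': "C \<noteq> {}" "C \<subseteq> S" "connected C"
    using in_components_nonempty[OF C] in_components_subset[OF C] in_components_connected[OF C] by simp_all
  note gf = homeomorphism_image_image[OF h] and fg = homeomorphism_image_image[OF homeomorphism_symD[OF h]]
  have "connected (f ` C)"
    using C' h by (meson connected_continuous_image continuous_on_subset homeomorphism_cont1)
  moreover have "f ` C \<subseteq> T"
    using C'(2) homeomorphism_image1[OF h] by blast
  moreover have "D = f ` C" if D: "f ` C \<subseteq> D" "D \<subseteq> T" "connected D" for D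
  proof -
    have "C \<subseteq> g ` D"
      using gf[OF C'(2)] D(1) by blast
    moreover have "g ` D \<subseteq> S"
      using D(2) homeomorphism_image2[OF h] by blast
    moreover have "connected (g ` D)"
      using D h by (meson connected_continuous_image continuous_on_subset homeomorphism_cont2)
    ultimately have "g ` D \<subseteq> C"
      using C'(1) by (intro components_maximal[OF C]) blast+
    then have "f ` g ` D \<subseteq> f ` C" by (rule image_mono)
    then show ?thesis
      using fg[OF D(2)] D(1) by simp
  qed
  ultimately show ?thesis
    using C'(1) unfolding in_components_maximal by (metis image_is_empty)
qed

lemma surface_chart:
  fixes S :: "'a::metric_space set"
  assumes S: "closed_surface S" and p: "p \<in> S" and v: "open v" "p \<in> v"
  obtains U V and f :: "'a \<Rightarrow> complex" and g where "openin (top_of_set S) U" "homeomorphism U V f g" "open V"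
    "{z. sup_norm z \<le> 2} \<subseteq> V" "g 0 = p" "U \<subseteq> v"
proof -
  obtain U0 and V0 :: "(real^2) set" where U0: "openin (top_of_set S) U0" "p \<in> U0" "open V0" "U0 homeomorphic V0"
    using S p unfolding closed_surface_def by blast
  then obtain f0 g0 where h0: "homeomorphism U0 V0 f0 g0"
    unfolding homeomorphic_def by blast
  define U where "U = U0 \<inter> v"
  have opU: "openin (top_of_set S) U"
    unfolding U_def using U0(1) v(1) by (rule openin_Int_open)
  have "openin (top_of_set U0) U"
    unfolding U_def using v(1) by (rule openin_open_Int)
  then have "openin (top_of_set V0) (f0 ` U)"
    by (rule homeomorphism_imp_open_map[OF h0])
  then have W: "open (f0 ` U)"
    using U0(3) openin_open_trans by blast
  have h1: "homeomorphism U (f0 ` U) f0 g0"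
    using homeomorphism_image1[OF h0] unfolding U_def by (intro homeomorphism_of_subsets[OF h0]) auto
  have pU: "p \<in> U" using U0(2) v(2) U_def by blast
  then obtain e where e: "e > 0" "ball (f0 p) e \<subseteq> f0 ` U"
    using W openE by blast
  \<comment> \<open>A point with \<open>sup_norm\<close> at most 2 is pulled back to a displacement
    of norm at most \<open>4 / r\<close>; the numerator 5 makes this less than
    \<open>e\<close>.\<close>
  define r where "r = 5 / e"
  have r: "r > 0" using e by (simp add: r_def)
  define H where "H = (\<lambda>w :: real^2. of_real (r * (w $ 1 - f0 p $ 1)) + \<i> * of_real (r * (w $ 2 - f0 p $ 2)))"
  have ReH: "Re (H w) = r * (w $ 1 - f0 p $ 1)" and ImH: "Im (H w) = r * (w $ 2 - f0 p $ 2)" for w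
    by (simp_all add: H_def)
  have contH: "continuous_on (f0 ` U) H"
    unfolding H_def by (intro continuous_intros)
  have injH: "inj_on H (f0 ` U)"
  proof (rule inj_onI)
    fix x y assume "H x = H y"
    then have "Re (H x) = Re (H y)" "Im (H x) = Im (H y)" by simp_all
    then have "x $ 1 = y $ 1" "x $ 2 = y $ 2"
      using r by (simp_all add: ReH ImH)
    then show "x = y" by (simp add: vec_eq_iff forall_2)
  qed
  have dim: "DIM(complex) \<le> DIM(real^2)" by simp
  obtain H' where H': "homeomorphism (f0 ` U) (H ` f0 ` U) H H'"
    using invariance_of_domain_homeomorphism[OF W contH dim injH] by blast
  have hom: "homeomorphism U (H ` f0 ` U) (H \<circ> f0) (g0 \<circ> H')"
    by (rule homeomorphism_compose[OF h1 H'])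
  show thesis
  proof (rule that[OF opU hom])
    show "open (H ` f0 ` U)"
      by (rule invariance_of_domain_gen[OF W contH injH dim])
    show "{z. sup_norm z \<le> 2} \<subseteq> H ` f0 ` U"
    proof
      fix z assume z: "z \<in> {z. sup_norm z \<le> 2}"
      define d :: "real^2" where "d = (\<chi> i. (if i = 1 then Re z else Im z) / r)"
      have d12: "d $ 1 = Re z / r" "d $ 2 = Im z / r"
        by (simp_all add: d_def)
      have "norm d \<le> \<bar>d $ 1\<bar> + \<bar>d $ 2\<bar>"
        using norm_le_l1_cart[of d] by (simp add: sum_2)
      also have "\<dots> = (\<bar>Re z\<bar> + \<bar>Im z\<bar>) / r"
        using r by (simp add: d12 add_divide_distrib)
      also have "\<dots> \<le> 4 / r"
        using z r unfolding sup_norm_def by (intro divide_right_mono) auto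
      also have "\<dots> < e"
        using e(1) by (simp add: r_def)
      finally have "f0 p + d \<in> f0 ` U"
        using e(2) by (auto simp: dist_norm)
      moreover have "H (f0 p + d) = z"
        using r by (simp add: complex_eq_iff ReH ImH d12)
      ultimately show "z \<in> H ` f0 ` U"
        by (metis image_eqI)
    qed
    have "(H \<circ> f0) p = 0"
      by (simp add: H_def)
    then show "(g0 \<circ> H') 0 = p"
      using homeomorphism_apply1[OF hom pU] by simp
    show "U \<subseteq> v" unfolding U_def by blast
  qed
qed

text \<open>Invariance of domain, read in a chart: near a point of the open square,
  \<open>f \<circ> h\<close> is a continuous injection of an open planar set into the plane, so its
  image is open.\<close>

lemma openin_disk_interior:
  fixes S :: "'a::metric_space set"
  assumes S: "closed_surface S" and Q: "Q \<subseteq> S" "Q homeomorphic unit_square"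
  shows "openin (top_of_set S) (Q - disk_boundary Q)"
proof -
  obtain h k where h: "homeomorphism unit_square Q h k"
    using Q(2) homeomorphic_sym homeomorphic_def by metis
  let ?I = "interior unit_square"
  have I_sub: "?I \<subseteq> unit_square" by (rule interior_subset)
  have inj: "inj_on h unit_square"
    using h by (metis homeomorphism_def inj_on_inverseI)
  have cl: "closed unit_square"
    by (intro closed_Times) auto
  have "Q - disk_boundary Q = h ` unit_square - h ` frontier unit_square"
    using disk_boundary_eq[OF h] homeomorphism_image1[OF h] by simp
  also have "\<dots> = h ` (unit_square - frontier unit_square)"
    using cl frontier_subset_eq by (intro inj_on_image_set_diff[OF inj, symmetric]) auto
  also have "unit_square - frontier unit_square = ?I"
    using I_sub cl by (auto simp: frontier_def closure_closed)
  finally have eq: "Q - disk_boundary Q = h ` ?I" .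
  have conth: "continuous_on ?I h"
    using homeomorphism_cont1[OF h] I_sub continuous_on_subset by blast
  show ?thesis
    unfolding openin_subopen[of _ "Q - disk_boundary Q"]
  proof
    fix x assume x: "x \<in> Q - disk_boundary Q"
    then obtain y where y: "y \<in> ?I" "x = h y" using eq by blast
    have "x \<in> S" using x Q(1) by blast
    then obtain U V and f :: "'a \<Rightarrow> complex" and g where U: "openin (top_of_set S) U" and f: "homeomorphism U V f g" and V: "open V"
      and sub: "{z. sup_norm z \<le> 2} \<subseteq> V" and g0: "g 0 = x"
      using surface_chart[OF S _ open_UNIV UNIV_I] by metis
    have "0 \<in> V" using sub by (auto simp: sup_norm_def)
    then have xU: "x \<in> U"
      using g0 homeomorphism_image2[OF f] by blast
    obtain U' where U': "open U'" "U = S \<inter> U'"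
      using U openin_open by metis
    define W where "W = ?I \<inter> h -` U'"
    have W: "open W"
      unfolding W_def by (rule continuous_open_preimage[OF conth open_interior U'(1)])
    have hW: "h ` W \<subseteq> U"
      using U'(2) Q(1) homeomorphism_image1[OF h] I_sub unfolding W_def by blast
    have contfh: "continuous_on W (f \<circ> h)"
    proof (rule continuous_on_compose)
      show "continuous_on W h" using conth continuous_on_subset unfolding W_def by blast
      show "continuous_on (h ` W) f" using homeomorphism_cont1[OF f] hW continuous_on_subset by blast
    qed
    have injf: "inj_on f U"
      using f by (metis homeomorphism_def inj_on_inverseI)
    have injfh: "inj_on (f \<circ> h) W"
      using hW inj I_sub unfolding W_def
      by (intro comp_inj_on inj_on_subset[OF injf]) (auto intro: inj_on_subset)
    have "open ((f \<circ> h) ` W)"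
      by (rule invariance_of_domain_gen[OF W contfh injfh]) simp
    moreover have fhV: "(f \<circ> h) ` W \<subseteq> V"
      using hW homeomorphism_image1[OF f] by (auto simp: image_comp[symmetric])
    ultimately have "openin (top_of_set V) ((f \<circ> h) ` W)"
      using open_subset by blast
    then have "openin (top_of_set U) (g ` (f \<circ> h) ` W)"
      by (rule homeomorphism_imp_open_map[OF homeomorphism_symD[OF f]])
    moreover have "g ` (f \<circ> h) ` W = h ` W"
      unfolding image_comp[of f h W, symmetric] by (rule homeomorphism_image_image[OF f hW])
    ultimately have "openin (top_of_set S) (h ` W)"
      using U openin_trans by metis
    moreover have "x \<in> h ` W"
      using y xU U'(2) unfolding W_def by blast
    moreover have "h ` W \<subseteq> Q - disk_boundary Q"
      unfolding eq W_def by blast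
    ultimately show "\<exists>T. openin (top_of_set S) T \<and> x \<in> T \<and> T \<subseteq> Q - disk_boundary Q"
      by blast
  qed
qed

section \<open>The relation of a Peano compactum is trivial\<close>

lemma compact_disk:
  fixes Q :: "'a::metric_space set"
  assumes "Q homeomorphic unit_square"
  shows "compact Q"
  using assms homeomorphic_compactness compact_Times compact_Icc by metis

text \<open>Infinitely many of the \<open>Q\<^sub>n\<close> lie in one component \<open>P\<close> of \<open>K\<close>. The limit contains a point in the
  interior of the quadrilateral, where a small connected neighbourhood in \<open>P\<close> would meet two of them.\<close>

lemma schoenflies_relation_trivial_if_peano:
  fixes S K :: "'a::metric_space set"
  assumes S: "closed_surface S" and KS: "K \<subseteq> S" and K: "peano_compactum K"
    and xy: "(x, y) \<in> schoenflies_relation S K"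
  shows "x = y"
proof (rule ccontr)
  assume "x \<noteq> y"
  then obtain Q I1 I2 and X :: "nat \<Rightarrow> 'a set" and Y where
    mq: "marked_quadrilateral S Q I1 I2" and xI: "x \<in> I1" and yI: "y \<in> I2"
    and bd: "K \<inter> disk_boundary Q \<subseteq> I1 \<union> I2" and injX: "inj X"
    and X: "\<And>n. X n \<in> components (K \<inter> Q)" "\<And>n. X n \<inter> I1 \<noteq> {}" "\<And>n. X n \<inter> I2 \<noteq> {}"
    and Y: "continuum Y" "(\<lambda>n. hausdorff_distance (X n) Y) \<longlonglongrightarrow> 0" "x \<in> Y" "y \<in> Y"
    using xy unfolding schoenflies_relation_def by auto
  have compK: "compact K" using K peano_compactum_def by blast
  have Q: "Q \<subseteq> S" "Q homeomorphic unit_square" and I12: "I1 \<inter> I2 = {}"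
    using mq unfolding marked_quadrilateral_def by blast+
  obtain \<gamma>1 \<gamma>2 where "arc \<gamma>1" "path_image \<gamma>1 = I1" "arc \<gamma>2" "path_image \<gamma>2 = I2"
    using mq unfolding marked_quadrilateral_def by blast
  then have compI: "compact I1" "compact I2"
    using compact_arc_image by blast+
  \<comment> \<open>Every \<open>X n\<close> joins \<open>I1\<close> to \<open>I2\<close>, so the
    components of \<open>K\<close> that contain the sets \<open>X n\<close> contain points at
    distance at least \<open>d\<close>; a Peano compactum has only finitely many such
    components.\<close>
  obtain d where d: "d > 0" "\<forall>a\<in>I1. \<forall>b\<in>I2. d \<le> dist a b"
    using compact_closed_separated[OF compI(1) compact_imp_closed[OF compI(2)] I12] by metis
  have compKQ: "compact (K \<inter> Q)"
    using compK compact_disk[OF Q(2)] by (simp add: compact_Int)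
  have XKQ: "X n \<subseteq> K \<inter> Q" "compact (X n)" "connected (X n)" "X n \<noteq> {}" for n
    using in_components_subset[OF X(1)] compact_in_components[OF compKQ X(1)]
      in_components_connected[OF X(1)] in_components_nonempty[OF X(1)] by auto
  have compY: "compact Y" "connected Y" using Y(1) continuum_def by blast+
  have "\<exists>C. C \<in> components K \<and> X n \<subseteq> C" for n
  proof -
    have "X n \<subseteq> K" "K \<noteq> {}" using XKQ[of n] by blast+
    then show ?thesis
      using exists_component_superset[OF _ _ XKQ(3)] by blast
  qed
  then obtain C where C: "\<And>n. C n \<in> components K" "\<And>n. X n \<subseteq> C n" by metis
  have big: "\<exists>a b. a \<in> C n \<and> b \<in> C n \<and> d \<le> dist a b" for n
  proof -
    obtain a b where "a \<in> X n" "a \<in> I1" "b \<in> X n" "b \<in> I2" using X(2,3)[of n] by blast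
    then show ?thesis using d(2) C(2)[of n] by blast
  qed
  have "C n \<in> {C \<in> components K. diameter C > d / 2}" for n
  proof -
    obtain a b where ab: "a \<in> C n" "b \<in> C n" "d \<le> dist a b" using big by blast
    have "bounded (C n)"
      using compact_in_components[OF compK C(1)] compact_imp_bounded by blast
    then have "dist a b \<le> diameter (C n)" using ab diameter_bounded_bound by blast
    then show ?thesis using C(1) ab(3) d(1) by auto
  qed
  moreover have "finite {C \<in> components K. diameter C > d / 2}"
    using K d(1) unfolding peano_compactum_def by (meson half_gt_zero)
  ultimately have "finite (range C)"
    by (meson finite_subset image_subsetI)
  then obtain n0 where inf: "infinite {n. C n = C n0}"
    using pigeonhole_infinite[of "UNIV :: nat set" C] by auto
  define P where "P = C n0"
  have P: "P \<in> components K" "P \<subseteq> K" "compact P"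
    using C(1) in_components_subset[OF C(1)] compact_in_components[OF compK C(1)] unfolding P_def by auto
  have "locally connected P"
  proof -
    have "\<not> (\<exists>a. P = {a})"
      using big[of n0] d(1) unfolding P_def by auto
    then show ?thesis
      using K P(1) unfolding peano_compactum_def peano_continuum_def by blast
  qed
  have near: "\<forall>\<^sub>F n in sequentially. infdist z (X n) < e" if "z \<in> Y" "e > 0" for z e
  proof -
    have "\<forall>\<^sub>F n in sequentially. hausdorff_distance (X n) Y < e"
      using order_tendstoD(2)[OF Y(2) that(2)] .
    then show ?thesis
      by (rule eventually_mono)
        (use infdist_le_hausdorff_distance(2)[OF XKQ(2) compY(1) that(1)] in \<open>meson le_less_trans\<close>)
  qed
  have nearpt: "\<exists>q\<in>X n. dist z q < e" if "infdist z (X n) < e" for z e n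
    using that XKQ(4)[of n] by (metis infdist_notempty cINF_less_iff bdd_below_image_dist)
  have YKQ: "Y \<subseteq> K \<inter> Q"
  proof
    fix z assume z: "z \<in> Y"
    have "z \<in> closure (K \<inter> Q)"
      unfolding closure_approachable
    proof (intro allI impI)
      fix e :: real assume "e > 0"
      then obtain n where "infdist z (X n) < e"
        using eventually_happens'[OF sequentially_bot near[OF z]] by blast
      then obtain q where "q \<in> X n" "dist z q < e" using nearpt by blast
      then show "\<exists>q\<in>K \<inter> Q. dist q z < e" using XKQ(1)[of n] by (auto simp: dist_commute)
    qed
    then show "z \<in> K \<inter> Q"
      using compKQ by (simp add: compact_imp_closed)
  qed
  \<comment> \<open>The connected set \<open>Y\<close> meets both arcs, so these disjoint closed
    sets cannot cover it, and outside them \<open>K\<close> does not meet the boundary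
    curve.\<close>
  obtain z where z: "z \<in> Y" "z \<notin> disk_boundary Q"
  proof (rule ccontr)
    assume "\<not> thesis"
    then have "Y \<subseteq> disk_boundary Q" using that by blast
    then have "Y \<subseteq> I1 \<union> I2" using YKQ bd by blast
    moreover have "I1 \<inter> I2 \<inter> Y = {}" using I12 by blast
    ultimately show False
      using connected_closedD[OF compY(2)] compI compact_imp_closed xI yI Y(3,4) by blast
  qed
  obtain O' where O': "open O'" "Q - disk_boundary Q = S \<inter> O'"
    using openin_disk_interior[OF S Q] openin_open by metis
  have zO: "z \<in> O'" using z YKQ O'(2) by blast
  have freq: "\<exists>n\<ge>m. C n = P \<and> infdist z (X n) < e" if e: "e > 0" for m e
  proof -
    obtain N where N: "\<And>n. n \<ge> N \<Longrightarrow> infdist z (X n) < e"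
      using near[OF z(1) e] unfolding eventually_sequentially by blast
    obtain n where "n \<ge> max m N" "C n = P"
      using inf unfolding infinite_nat_iff_unbounded_le P_def by blast
    then show ?thesis using N by auto
  qed
  have "z \<in> closure P"
    unfolding closure_approachable
  proof (intro allI impI)
    fix e :: real assume "e > 0"
    then obtain n where "C n = P" "infdist z (X n) < e" using freq by blast
    then obtain q where "q \<in> X n" "dist z q < e" using nearpt by blast
    then show "\<exists>q\<in>P. dist q z < e" using C(2)[of n] \<open>C n = P\<close> by (auto simp: dist_commute)
  qed
  then have zP: "z \<in> P" using P(3) by (simp add: compact_imp_closed)
  have "openin (top_of_set P) (P \<inter> O')" using O'(1) by (rule openin_open_Int)
  \<comment> \<open>\<open>O'\<close> cuts out the open part of the quadrilateral, so
    \<open>v\<close> lies in \<open>K \<inter> Q\<close>; being connected, it is contained in every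
    \<open>X n\<close> that it meets.\<close>
  then obtain u v where u: "openin (top_of_set P) u" "connected v" "z \<in> u" "u \<subseteq> v" "v \<subseteq> P \<inter> O'"
    using \<open>locally connected P\<close> zP zO unfolding locally_def by (metis IntI)
  obtain T where T: "open T" "u = P \<inter> T" using u(1) openin_open by metis
  then obtain e where e: "e > 0" "ball z e \<subseteq> T" using u(3) openE by blast
  have vKQ: "v \<subseteq> K \<inter> Q" using u(5) P(2) KS O'(2) by blast
  have vX: "v \<subseteq> X n" if n: "C n = P" "infdist z (X n) < e" for n
  proof -
    obtain q where q: "q \<in> X n" "dist z q < e" using nearpt n(2) by blast
    then have "q \<in> u" using C(2)[of n] n(1) e(2) T(2) by auto
    then have "X n \<inter> v \<noteq> {}" using q(1) u(4) by blast
    then show ?thesis by (rule components_maximal[OF X(1) u(2) vKQ])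
  qed
  obtain m where m: "C m = P" "infdist z (X m) < e" using freq[OF e(1)] by blast
  obtain n where n: "n \<ge> Suc m" "C n = P" "infdist z (X n) < e" using freq[OF e(1)] by blast
  have "z \<in> X m \<inter> X n" using vX[OF m] vX[OF n(2,3)] u(3,4) by blast
  then have "X m = X n" using components_nonoverlap[OF X(1) X(1)] by blast
  then have "m = n" using injX by (simp add: inj_eq)
  then show False using n(1) by simp
qed

section \<open>A compactum that is not Peano has a nontrivial pair\<close>

lemma aff_dim_unit_square: "aff_dim unit_square = 2"
proof -
  have "interior unit_square = {0<..<1} \<times> {0<..<1::real}"
    by (simp add: interior_Times)
  then have "(1/2, 1/2) \<in> interior unit_square"
    by simp
  then have "interior unit_square \<noteq> {}" by blast
  then show ?thesis
    using aff_dim_nonempty_interior[of unit_square] by simp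
qed

text \<open>In the plane the parametrization sends the frontier of the square to the frontier of the
  strip region, which is the Jordan curve; the chart carries this curve to the intrinsic boundary of
  the image.\<close>

lemma marked_quadrilateral_chart_image:
  fixes S :: "'a::metric_space set" and f :: "'a \<Rightarrow> complex"
  assumes f: "homeomorphism U V f g" and U: "U \<subseteq> S" and V: "{z. sup_norm z \<le> 2} \<subseteq> V"
    and s: "strip a b i k" and R: "strip_region a b i k \<subseteq> square_annulus" and D: "bounds_disk (strip_boundary a b i k)"
  shows "marked_quadrilateral S (g ` strip_region a b i k) (g ` path_image i) (g ` path_image k)"
    and "disk_boundary (g ` strip_region a b i k) = g ` strip_boundary a b i k"
proof -
  have RV: "strip_region a b i k \<subseteq> V" using R V by auto
  have gU: "g ` V = U" using homeomorphism_image2[OF f] .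
  have injg: "inj_on g V"
    using f by (metis homeomorphism_def inj_on_inverseI)
  have contg: "continuous_on V g" using homeomorphism_cont2[OF f] .
  have hg: "homeomorphism (strip_region a b i k) (g ` strip_region a b i k) g f"
    using RV gU by (intro homeomorphism_of_subsets[OF homeomorphism_symD[OF f]]) auto
  have "strip_region a b i k homeomorphic unit_square"
  proof -
    have "cball (0::complex) 1 homeomorphic unit_square"
      by (intro homeomorphic_convex_compact_sets)
        (auto simp: aff_dim_cball aff_dim_unit_square compact_Times intro!: convex_Times)
    then show ?thesis using D homeomorphic_trans by blast
  qed
  then obtain p q where p: "homeomorphism unit_square (strip_region a b i k) p q"
    using homeomorphic_sym homeomorphic_def by metis
  have gp: "homeomorphism unit_square (g ` strip_region a b i k) (g \<circ> p) (q \<circ> f)"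
    by (rule homeomorphism_compose[OF p hg])
  obtain \<gamma> where \<gamma>: "simple_path \<gamma>" "pathfinish \<gamma> = pathstart \<gamma>" "path_image \<gamma> = strip_boundary a b i k"
    using strip_loop[OF s] by metis
  have cl: "closed unit_square"
    by (intro closed_Times) auto
  have cl': "closed (strip_region a b i k)"
    using homeomorphic_compactness[OF D] by (simp add: compact_imp_closed)
  have "p ` frontier unit_square = frontier (strip_region a b i k)"
    by (rule homeomorphism_image_frontier[OF p cl cl']) simp
  also have "\<dots> = strip_boundary a b i k"
    using frontier_Un_inside_simple_loop[OF \<gamma>(1,2)] \<gamma>(3) by simp
  finally have fr: "p ` frontier unit_square = strip_boundary a b i k" .
  show db: "disk_boundary (g ` strip_region a b i k) = g ` strip_boundary a b i k"
    by (simp only: disk_boundary_eq[OF gp] image_comp[of g p, symmetric] fr)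
  have arc_g: "arc (g \<circ> c) \<and> path_image (g \<circ> c) = g ` path_image c" if "arc c" "path_image c \<subseteq> V" for c
  proof -
    have "path (g \<circ> c)"
      using that contg by (meson arc_imp_path continuous_on_subset path_continuous_image)
    moreover have "inj_on (g \<circ> c) {0..1}"
      using that injg arc_imp_inj_on[OF that(1)] unfolding path_image_def
      by (intro comp_inj_on) (auto intro: inj_on_subset)
    ultimately show ?thesis
      by (simp add: arc_def path_image_compose)
  qed
  have ik: "arc i" "arc k" "path_image i \<subseteq> V" "path_image k \<subseteq> V"
    using s RV unfolding strip_def by auto
  have "path_image i \<inter> path_image k = {}"
    using s unfolding strip_def by fastforce
  then have disj: "g ` path_image i \<inter> g ` path_image k = {}"
    using inj_on_image_Int[OF injg ik(3,4)] by simp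
  have "g ` strip_region a b i k \<subseteq> S"
    using RV gU U by blast
  moreover have "g ` strip_region a b i k homeomorphic unit_square"
    using gp homeomorphic_sym homeomorphic_def by metis
  moreover have "\<exists>\<gamma>. arc \<gamma> \<and> path_image \<gamma> = g ` path_image i" "\<exists>\<gamma>. arc \<gamma> \<and> path_image \<gamma> = g ` path_image k"
    using arc_g[OF ik(1,3)] arc_g[OF ik(2,4)] by blast+
  ultimately show "marked_quadrilateral S (g ` strip_region a b i k) (g ` path_image i) (g ` path_image k)"
    unfolding marked_quadrilateral_def db using disj by blast
qed

text \<open>After Blaschke selection, points of the components on \<open>I1\<close> and on
  \<open>I2\<close> accumulate at the required \<open>x\<close> and \<open>y\<close>, which differ
  because the arcs are disjoint.\<close>

lemma schoenflies_relation_if_infinite_components: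
  fixes S K :: "'a::metric_space set"
  assumes K: "compact K" and mq: "marked_quadrilateral S Q I1 I2" and bd: "K \<inter> disk_boundary Q \<subseteq> I1 \<union> I2"
    and inf: "infinite {E \<in> components (K \<inter> Q). E \<inter> I1 \<noteq> {} \<and> E \<inter> I2 \<noteq> {}}"
  obtains x y where "(x, y) \<in> schoenflies_relation S K" "x \<noteq> y"
proof -
  have Q: "Q homeomorphic unit_square" and I12: "I1 \<inter> I2 = {}"
    using mq unfolding marked_quadrilateral_def by blast+
  obtain \<gamma>1 \<gamma>2 where "arc \<gamma>1" "path_image \<gamma>1 = I1" "arc \<gamma>2" "path_image \<gamma>2 = I2"
    using mq unfolding marked_quadrilateral_def by blast
  then have compI: "compact I1" "compact I2"
    using compact_arc_image by blast+
  have compKQ: "compact (K \<inter> Q)"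
    using K compact_disk[OF Q] by (simp add: compact_Int)
  obtain X :: "nat \<Rightarrow> 'a set" where X: "inj X" "range X \<subseteq> {E \<in> components (K \<inter> Q). E \<inter> I1 \<noteq> {} \<and> E \<inter> I2 \<noteq> {}}"
    using infinite_countable_subset[OF inf] by blast
  have XKQ: "X n \<in> components (K \<inter> Q)" "X n \<inter> I1 \<noteq> {}" "X n \<inter> I2 \<noteq> {}" for n
    using X(2) by blast+
  have X': "X n \<subseteq> K \<inter> Q" "compact (X n)" "connected (X n)" "X n \<noteq> {}" for n
    using in_components_subset[OF XKQ(1)] compact_in_components[OF compKQ XKQ(1)]
      in_components_connected[OF XKQ(1)] in_components_nonempty[OF XKQ(1)] by auto
  obtain r Y where r: "strict_mono (r :: nat \<Rightarrow> nat)" and Y: "continuum Y" "(\<lambda>n. hausdorff_distance (X (r n)) Y) \<longlonglongrightarrow> 0"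
    by (rule hausdorff_convergent_subsequence[of "K \<inter> Q" X, OF compKQ X'(4,1,3)])
  have "\<forall>n. \<exists>a. a \<in> X (r n) \<and> a \<in> I1" "\<forall>n. \<exists>b. b \<in> X (r n) \<and> b \<in> I2"
    using XKQ(2,3) by blast+
  then obtain a b where a: "\<And>n. a n \<in> X (r n)" "\<And>n. a n \<in> I1" and b: "\<And>n. b n \<in> X (r n)" "\<And>n. b n \<in> I2"
    by metis
  have compY: "compact Y" "Y \<noteq> {}" using Y(1) continuum_def by blast+
  \<comment> \<open>The distance from \<open>c n\<close> to \<open>Y\<close> is at most the
    Hausdorff distance, which tends to 0, so an accumulation point has distance 0 to the closed set
    \<open>Y\<close>.\<close>
  have lim: "\<exists>x. x \<in> I \<and> x \<in> Y \<and> x \<in> K" if c: "\<And>n. c n \<in> X (r n)" "\<And>n. c n \<in> I" and I: "compact I" for c and I :: "'a set"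
  proof -
    obtain x v where x: "x \<in> I" "strict_mono (v :: nat \<Rightarrow> nat)" "(\<lambda>n. c (v n)) \<longlonglongrightarrow> x"
      using I c(2) unfolding compact_def o_def by blast
    have "c (v n) \<in> K" for n using c(1) X'(1) by blast
    then have xK: "x \<in> K"
      using closed_sequentially[OF compact_imp_closed[OF K] _ x(3)] by blast
    have lim0: "(\<lambda>n. hausdorff_distance (X (r (v n))) Y) \<longlonglongrightarrow> 0"
      using LIMSEQ_subseq_LIMSEQ[OF Y(2) x(2)] by (simp add: o_def)
    have le: "norm (infdist (c (v n)) Y) \<le> hausdorff_distance (X (r (v n))) Y" for n
      using infdist_le_hausdorff_distance(1)[OF X'(2) compY(1) c(1)] by (simp add: infdist_nonneg)
    have "(\<lambda>n. infdist (c (v n)) Y) \<longlonglongrightarrow> 0"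
      by (rule Lim_null_comparison[OF always_eventually[OF allI[OF le]] lim0])
    moreover have "(\<lambda>n. infdist (c (v n)) Y) \<longlonglongrightarrow> infdist x Y"
      by (rule tendsto_infdist[OF x(3)])
    ultimately have "infdist x Y = 0" using LIMSEQ_unique by blast
    then have "x \<in> Y"
      using in_closed_iff_infdist_zero[OF compact_imp_closed[OF compY(1)] compY(2)] by blast
    then show ?thesis using x(1) xK by blast
  qed
  obtain x where x: "x \<in> I1" "x \<in> Y" "x \<in> K" using lim[OF a compI(1)] by blast
  obtain y where y: "y \<in> I2" "y \<in> Y" "y \<in> K" using lim[OF b compI(2)] by blast
  have "inj (\<lambda>n. X (r n))"
    using inj_compose[OF X(1) strict_mono_imp_inj_on[OF r]] by (simp add: o_def)
  then have "\<exists>(Qn :: nat \<Rightarrow> 'a set) Qinf.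
           inj Qn \<and> (\<forall>n. Qn n \<in> components (K \<inter> Q) \<and> Qn n \<inter> I1 \<noteq> {} \<and> Qn n \<inter> I2 \<noteq> {}) \<and>
           continuum Qinf \<and> (\<lambda>n. hausdorff_distance (Qn n) Qinf) \<longlonglongrightarrow> 0 \<and> x \<in> Qinf \<and> y \<in> Qinf"
    using XKQ Y x(2) y(2) by (intro exI[of _ "\<lambda>n. X (r n)"] exI[of _ Y]) simp
  then have "(x, y) \<in> schoenflies_relation S K"
    unfolding schoenflies_relation_def using x y mq bd by blast
  moreover have "x \<noteq> y" using x(1) y(1) I12 by blast
  ultimately show thesis by (rule that)
qed

text \<open>Boundary bumping inside \<open>E\<close>, starting on the outer square: the piece
  outside the open inner square must reach points with \<open>sup_norm\<close> at most 1. Each piece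
  stays in its own \<open>E\<close>, so infinitely many remain.\<close>

lemma infinite_crossing_components:
  fixes L :: "complex set"
  assumes L: "compact L" and inf: "infinite \<E>"
    and \<E>: "\<And>E. E \<in> \<E> \<Longrightarrow> E \<in> components L \<and> (\<exists>x\<in>E. sup_norm x < 1) \<and> (\<exists>y\<in>E. sup_norm y = 2)"
    and L2: "\<And>z. z \<in> L \<Longrightarrow> sup_norm z \<le> 2"
  shows "infinite {X \<in> components (L \<inter> square_annulus). crosses_annulus X}"
proof -
  let ?N = "{z. 1 \<le> sup_norm z}"
  have N: "closed ?N"
    by (intro closed_Collect_le continuous_intros)
  have LN: "L \<inter> square_annulus = L \<inter> ?N" using L2 by auto
  have "\<exists>X. X \<in> components (L \<inter> square_annulus) \<and> crosses_annulus X \<and> X \<subseteq> E" if E: "E \<in> \<E>" for E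
  proof -
    have EL: "E \<in> components L" using \<E>[OF E] by blast
    obtain x y where x: "x \<in> E" "sup_norm x < 1" and y: "y \<in> E" "sup_norm y = 2"
      using \<E>[OF E] by blast
    have E': "E \<subseteq> L" "connected E" "compact E"
      using in_components_subset[OF EL] in_components_connected[OF EL] compact_in_components[OF L EL] by auto
    let ?X = "connected_component_set (L \<inter> ?N) y"
    have y': "y \<in> L \<inter> ?N" using y E' by auto
    have yX: "y \<in> ?X" using y' by (simp add: connected_component_refl_eq)
    have "\<not> E \<subseteq> ?N" using x by auto
    then have "connected_component_set (E \<inter> ?N) y \<inter> closure (E - ?N) \<noteq> {}"
      using boundary_bumping[OF E'(3,2) N] y by auto
    moreover have "connected_component_set (E \<inter> ?N) y \<subseteq> ?X"
      using E'(1) by (intro connected_component_mono) blast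
    moreover have "closure (E - ?N) \<subseteq> {z. sup_norm z \<le> 1}"
      by (intro closure_minimal closed_Collect_le continuous_intros) auto
    ultimately obtain z where z: "z \<in> ?X" "sup_norm z \<le> 1" by blast
    have XN: "?X \<subseteq> L \<inter> ?N" by (rule connected_component_subset)
    then have "sup_norm z = 1" using z by force
    then have "crosses_annulus ?X"
      unfolding crosses_annulus_def using z(1) yX y(2) by blast
    moreover have "?X \<in> components (L \<inter> square_annulus)"
      unfolding LN using y' by (intro componentsI) blast
    moreover have "?X \<subseteq> E"
    proof (rule components_maximal[OF EL])
      show "?X \<subseteq> L" using XN by blast
      show "E \<inter> ?X \<noteq> {}" using yX y(1) by blast
    qed simp
    ultimately show ?thesis by blast
  qed
  then obtain X where X: "\<And>E. E \<in> \<E> \<Longrightarrow> X E \<in> components (L \<inter> square_annulus) \<and> crosses_annulus (X E) \<and> X E \<subseteq> E"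
    by metis
  have "inj_on X \<E>"
  proof (rule inj_onI)
    fix E F assume EF: "E \<in> \<E>" "F \<in> \<E>" "X E = X F"
    have "X E \<noteq> {}" using X[OF EF(1)] in_components_nonempty by blast
    then have "E \<inter> F \<noteq> {}" using X[OF EF(1)] X[OF EF(2)] EF(3) by blast
    then show "E = F" using \<E> EF components_nonoverlap by metis
  qed
  then have "infinite (X ` \<E>)" using inf finite_imageD by blast
  moreover have "X ` \<E> \<subseteq> {X \<in> components (L \<inter> square_annulus). crosses_annulus X}"
    using X by blast
  ultimately show ?thesis using finite_subset by blast
qed

lemma schoenflies_relation_nontrivial_if_not_peano:
  fixes S K :: "'a::metric_space set"
  assumes S: "closed_surface S" and KS: "K \<subseteq> S" and K: "compact K" and n: "\<not> peano_compactum K"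
  obtains x y where "(x, y) \<in> schoenflies_relation S K" "x \<noteq> y"
proof (rule not_peano_compactum_components[OF K n])
  fix p v
  assume p: "p \<in> K" "open v" "p \<in> v"
    and inf: "\<And>D W. closed D \<Longrightarrow> D \<subseteq> v \<Longrightarrow> open W \<Longrightarrow> p \<in> W \<Longrightarrow> K \<inter> W \<subseteq> D \<Longrightarrow>
       infinite {E \<in> components (K \<inter> D). E \<inter> W \<noteq> {} \<and> E \<inter> closure (K - D) \<noteq> {}}"
  have pS: "p \<in> S" using p(1) KS by blast
  obtain U V and f :: "'a \<Rightarrow> complex" and g where U: "openin (top_of_set S) U" and f: "homeomorphism U V f g" and V: "open V"
    and sub: "{z. sup_norm z \<le> 2} \<subseteq> V" and g0: "g 0 = p" and Uv: "U \<subseteq> v"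
    using surface_chart[OF S pS p(2,3)] by metis
  have US: "U \<subseteq> S" using U openin_imp_subset by blast
  have gV: "g ` V = U" and fU: "f ` U = V"
    using homeomorphism_image1[OF f] homeomorphism_image2[OF f] by auto
  have fg: "\<And>z. z \<in> V \<Longrightarrow> f (g z) = z" and gf: "\<And>x. x \<in> U \<Longrightarrow> g (f x) = x"
    using homeomorphism_apply1[OF f] homeomorphism_apply2[OF f] by auto
  define B where "B = {z. sup_norm z \<le> 2}"
  have BV: "B \<subseteq> V" using sub B_def by simp
  have compB: "compact B"
  proof -
    have "B = cbox (Complex (- 2) (- 2)) (Complex 2 2)"
      unfolding B_def using sup_norm_le_iff[of _ 2] by blast
    then show ?thesis by simp
  qed
  define D where "D = g ` B"
  have compD: "compact D"
    unfolding D_def using homeomorphism_cont2[OF f] BV compB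
    by (meson compact_continuous_image continuous_on_subset)
  have DU: "D \<subseteq> U" unfolding D_def using BV gV by blast
  have open_image: "\<exists>W. open W \<and> g ` {z. sup_norm z < r} = S \<inter> W" if "r \<le> 2" for r
  proof -
    have "open {z. sup_norm z < r}"
      by (intro open_Collect_less continuous_intros)
    moreover have "{z. sup_norm z < r} \<subseteq> V" using BV that unfolding B_def by auto
    ultimately have "openin (top_of_set V) {z. sup_norm z < r}" by (simp add: open_subset)
    then have "openin (top_of_set U) (g ` {z. sup_norm z < r})"
      by (rule homeomorphism_imp_open_map[OF homeomorphism_symD[OF f]])
    then have "openin (top_of_set S) (g ` {z. sup_norm z < r})"
      using U openin_trans by blast
    then show ?thesis unfolding openin_open by blast
  qed
  \<comment> \<open>\<open>W\<close> is the neighbourhood of \<open>p\<close> that infinitely many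
    components must meet. \<open>W2\<close> serves to show that images of points with
    \<open>sup_norm\<close> less than 2 are not limits of \<open>K - D\<close>.\<close>
  obtain W where W: "open W" "g ` {z. sup_norm z < 1} = S \<inter> W"
    using open_image[of 1] by auto
  obtain W2 where W2: "open W2" "g ` {z. sup_norm z < 2} = S \<inter> W2"
    using open_image[of 2] by auto
  have pW: "p \<in> W"
  proof -
    have "g 0 \<in> g ` {z. sup_norm z < 1}" by (rule imageI) (simp add: sup_norm_def)
    then show ?thesis using W(2) g0 by simp
  qed
  have WD: "K \<inter> W \<subseteq> D"
  proof -
    have "{z. sup_norm z < 1} \<subseteq> B" unfolding B_def by auto
    then show ?thesis using W(2) KS unfolding D_def by blast
  qed
  have infE: "infinite {E \<in> components (K \<inter> D). E \<inter> W \<noteq> {} \<and> E \<inter> closure (K - D) \<noteq> {}}"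
    using inf[OF compact_imp_closed[OF compD] _ W(1) pW WD] DU Uv by blast
  define L where "L = f ` (K \<inter> D)"
  have hL: "homeomorphism (K \<inter> D) L f g"
    unfolding L_def using DU fU by (intro homeomorphism_of_subsets[OF f]) auto
  have compL: "compact L"
    unfolding L_def using homeomorphism_cont1[OF f] DU compD K
    by (meson compact_Int compact_continuous_image continuous_on_subset inf.coboundedI2)
  have fD: "sup_norm (f x) \<le> 2" if "x \<in> D" for x
    using that BV fg unfolding D_def B_def by auto
  have mem: "f ` E \<in> components L \<and> (\<exists>x\<in>f ` E. sup_norm x < 1) \<and> (\<exists>y\<in>f ` E. sup_norm y = 2)"
    if E: "E \<in> components (K \<inter> D)" "E \<inter> W \<noteq> {}" "E \<inter> closure (K - D) \<noteq> {}" for E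
  proof (intro conjI)
    show "f ` E \<in> components L"
      by (rule homeomorphism_image_component[OF hL E(1)])
    have EKD: "E \<subseteq> K \<inter> D" using in_components_subset[OF E(1)] .
    obtain x where x: "x \<in> E" "x \<in> W" using E(2) by blast
    then have "x \<in> g ` {z. sup_norm z < 1}" using W(2) EKD KS by blast
    then obtain w where "x = g w" "sup_norm w < 1" by blast
    moreover have "w \<in> V" using \<open>sup_norm w < 1\<close> sub by auto
    ultimately have "sup_norm (f x) < 1" using fg by simp
    then show "\<exists>x\<in>f ` E. sup_norm x < 1" using x(1) by blast
    obtain y where y: "y \<in> E" "y \<in> closure (K - D)" using E(3) by blast
    have "sup_norm (f y) = 2"
    proof (rule ccontr)
      assume ne: "sup_norm (f y) \<noteq> 2"
      have yD: "y \<in> D" "y \<in> K" using y(1) EKD by blast+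
      then have "f y \<in> {z. sup_norm z < 2}" using fD[of y] ne by simp
      moreover have "y = g (f y)" using gf yD(1) DU by force
      ultimately have "y \<in> W2" using W2(2) by blast
      then have "W2 \<inter> (K - D) \<noteq> {}"
        using y(2) W2(1) open_Int_closure_eq_empty by blast
      moreover have "S \<inter> W2 \<subseteq> D"
        unfolding W2(2)[symmetric] D_def B_def by auto
      ultimately show False using KS by blast
    qed
    then show "\<exists>y\<in>f ` E. sup_norm y = 2" using y(1) by blast
  qed
  define \<E> where "\<E> = (`) f ` {E \<in> components (K \<inter> D). E \<inter> W \<noteq> {} \<and> E \<inter> closure (K - D) \<noteq> {}}"
  have "inj_on ((`) f) {E \<in> components (K \<inter> D). E \<inter> W \<noteq> {} \<and> E \<inter> closure (K - D) \<noteq> {}}"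
  proof (rule inj_onI)
    fix E F assume EF: "E \<in> {E \<in> components (K \<inter> D). E \<inter> W \<noteq> {} \<and> E \<inter> closure (K - D) \<noteq> {}}"
      "F \<in> {E \<in> components (K \<inter> D). E \<inter> W \<noteq> {} \<and> E \<inter> closure (K - D) \<noteq> {}}" "f ` E = f ` F"
    have "g ` f ` X = X" if "X \<in> components (K \<inter> D)" for X
    proof -
      have "X \<subseteq> U" using in_components_subset[OF that] DU by blast
      then show ?thesis by (rule homeomorphism_image_image[OF f])
    qed
    then show "E = F" using EF by (metis (no_types, lifting) mem_Collect_eq)
  qed
  then have inf\<E>: "infinite \<E>" unfolding \<E>_def using infE finite_imageD by blast
  have infX: "infinite {X \<in> components (L \<inter> square_annulus). crosses_annulus X}"
  proof (rule infinite_crossing_components[OF compL inf\<E>])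
    fix F assume "F \<in> \<E>"
    then obtain E where E: "F = f ` E" "E \<in> components (K \<inter> D)" "E \<inter> W \<noteq> {}" "E \<inter> closure (K - D) \<noteq> {}"
      unfolding \<E>_def by blast
    show "F \<in> components L \<and> (\<exists>x\<in>F. sup_norm x < 1) \<and> (\<exists>y\<in>F. sup_norm y = 2)"
      unfolding E(1) by (rule mem[OF E(2-4)])
  next
    fix z assume "z \<in> L"
    then show "sup_norm z \<le> 2" using fD unfolding L_def by blast
  qed
  have compLA: "compact (L \<inter> square_annulus)"
  proof -
    have "closed square_annulus"
      by (intro closed_Collect_conj closed_Collect_le continuous_intros)
    then show ?thesis using compL by blast
  qed
  obtain a b i k where s: "strip a b i k" and Lab: "L \<inter> square_annulus \<inter> (path_image a \<union> path_image b) = {}"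
    and R: "strip_region a b i k \<subseteq> square_annulus" and disk: "bounds_disk (strip_boundary a b i k)"
    and infS: "infinite {E \<in> components (L \<inter> square_annulus \<inter> strip_region a b i k). E \<inter> path_image i \<noteq> {} \<and> E \<inter> path_image k \<noteq> {}}"
    using strip_exists[OF compLA _ infX] by blast
  define T where "T = strip_region a b i k"
  define J where "J = strip_boundary a b i k"
  have TA: "T \<subseteq> square_annulus" using R T_def by simp
  have TB: "T \<subseteq> B" using TA unfolding B_def by auto
  note q = marked_quadrilateral_chart_image[OF f US sub s R disk, folded T_def J_def]
  have LT: "L \<inter> square_annulus \<inter> T = L \<inter> T" using TA by blast
  \<comment> \<open>\<open>T\<close> lies in the square \<open>B\<close>, whose image is
    \<open>D\<close>, so no part of \<open>K\<close> in the quadrilateral is lost by working with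
    \<open>L\<close>.\<close>
  have KT: "K \<inter> g ` T = g ` (L \<inter> T)"
  proof
    show "K \<inter> g ` T \<subseteq> g ` (L \<inter> T)"
    proof
      fix x assume "x \<in> K \<inter> g ` T"
      then obtain w where w: "w \<in> T" "x = g w" "x \<in> K" by blast
      then have "x \<in> D" "f x = w" using TB BV fg unfolding D_def by auto
      then have "w \<in> L" unfolding L_def using w(3) by blast
      then show "x \<in> g ` (L \<inter> T)" using w by blast
    qed
    have "g ` L \<subseteq> K" using homeomorphism_image2[OF hL] by blast
    then show "g ` (L \<inter> T) \<subseteq> K \<inter> g ` T" by blast
  qed
  have JT: "J \<subseteq> T" unfolding J_def T_def by blast
  \<comment> \<open>A point of \<open>K\<close> on the boundary curve comes from a point of
    \<open>L\<close> on \<open>J\<close>, and \<open>L\<close> avoids \<open>a\<close> and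
    \<open>b\<close> in the annulus; only the images of \<open>i\<close> and \<open>k\<close>
    remain.\<close>
  have bd: "K \<inter> disk_boundary (g ` T) \<subseteq> g ` path_image i \<union> g ` path_image k"
  proof
    fix x assume x: "x \<in> K \<inter> disk_boundary (g ` T)"
    then obtain w where w: "w \<in> J" "x = g w" using q(2) by blast
    then have "x \<in> g ` (L \<inter> T)" using KT JT x by blast
    then obtain w' where w': "w' \<in> L" "w' \<in> T" "x = g w'" by blast
    have "w' = w" using fg[of w] fg[of w'] w w' JT TB BV by (metis subsetD)
    then have "w \<in> L" "w \<in> square_annulus" using w' TA by blast+
    then have "w \<in> path_image i \<union> path_image k" using w(1) Lab unfolding J_def by blast
    then show "x \<in> g ` path_image i \<union> g ` path_image k" using w(2) by blast
  qed
  have hLT: "homeomorphism (L \<inter> T) (K \<inter> g ` T) g f"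
    unfolding KT
    by (intro homeomorphism_of_subsets[OF homeomorphism_symD[OF hL]])
      (use homeomorphism_image2[OF hL] in blast)+
  let ?A = "{E \<in> components (L \<inter> T). E \<inter> path_image i \<noteq> {} \<and> E \<inter> path_image k \<noteq> {}}"
  have infA: "infinite ?A" using infS LT unfolding T_def[symmetric] by simp
  have "inj_on ((`) g) ?A"
  proof (rule inj_onI)
    fix E F assume EF: "E \<in> ?A" "F \<in> ?A" "g ` E = g ` F"
    have "f ` g ` X = X" if "X \<in> components (L \<inter> T)" for X
    proof -
      have "X \<subseteq> V" using in_components_subset[OF that] TB BV by blast
      then show ?thesis by (rule homeomorphism_image_image[OF homeomorphism_symD[OF f]])
    qed
    then show "E = F" using EF by (metis (no_types, lifting) mem_Collect_eq)
  qed
  then have "infinite ((`) g ` ?A)" using infA finite_imageD by blast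
  moreover have "(`) g ` ?A \<subseteq> {E \<in> components (K \<inter> g ` T). E \<inter> g ` path_image i \<noteq> {} \<and> E \<inter> g ` path_image k \<noteq> {}}"
    using homeomorphism_image_component[OF hLT] by blast
  ultimately have "infinite {E \<in> components (K \<inter> g ` T). E \<inter> g ` path_image i \<noteq> {} \<and> E \<inter> g ` path_image k \<noteq> {}}"
    using finite_subset by blast
  then show thesis
    by (rule schoenflies_relation_if_infinite_components[OF K q(1) bd _ that])
qed

section \<open>Trivial classes and the trivial relation\<close>

lemma schoenflies_relation_bounds:
  "Id_on K \<subseteq> schoenflies_relation S K" "schoenflies_relation S K \<subseteq> K \<times> K"
  unfolding schoenflies_relation_def by auto

text \<open>The diagonal is a closed equivalence relation since the space is Hausdorff, so it is the
  smallest one as soon as the relation is diagonal. Conversely, the relation is contained in the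
  equivalence that it generates.\<close>

lemma schoenflies_class_trivial_iff:
  fixes S K :: "'a::metric_space set"
  shows "(\<forall>x\<in>K. schoenflies_class S K x = {x}) \<longleftrightarrow> schoenflies_relation S K = {(x, x) | x. x \<in> K}"
proof -
  have diag: "{(x, x) | x. x \<in> K} = Id_on K" by auto
  show ?thesis
    unfolding diag
  proof
    assume cl: "\<forall>x\<in>K. schoenflies_class S K x = {x}"
    have "schoenflies_relation S K \<subseteq> schoenflies_equivalence S K"
      unfolding schoenflies_equivalence_def by blast
    then have "y \<in> schoenflies_class S K x" if "(x, y) \<in> schoenflies_relation S K" for x y
      using that unfolding schoenflies_class_def by blast
    then have "schoenflies_relation S K \<subseteq> Id_on K"
      using cl schoenflies_relation_bounds(2)[of S K] by (fastforce simp: Id_on_def)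
    then show "schoenflies_relation S K = Id_on K" using schoenflies_relation_bounds(1)[of K S] by blast
  next
    assume R: "schoenflies_relation S K = Id_on K"
    have "equiv K (Id_on K)"
      by (auto simp: equiv_def refl_on_def sym_def trans_def)
    moreover have "closedin (top_of_set (K \<times> K)) (Id_on K)"
    proof -
      have "Id_on K = (K \<times> K) \<inter> {z. fst z = snd z}" by auto
      moreover have "closed {z :: 'a \<times> 'a. fst z = snd z}"
        by (intro closed_Collect_eq continuous_intros)
      ultimately show ?thesis by (metis closedin_closed_Int)
    qed
    ultimately have "schoenflies_equivalence S K \<subseteq> Id_on K"
      unfolding schoenflies_equivalence_def R by blast
    moreover have "Id_on K \<subseteq> schoenflies_equivalence S K"
      unfolding schoenflies_equivalence_def R by blast
    ultimately have "schoenflies_equivalence S K = Id_on K" by blast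
    then show "\<forall>x\<in>K. schoenflies_class S K x = {x}"
      unfolding schoenflies_class_def by auto
  qed
qed

theorem corollary2p4:
  fixes S K :: "'a::metric_space set"
  assumes "closed_surface S" and "K \<subseteq> S" and "compact K"
  shows "(peano_compactum K \<longleftrightarrow> (\<forall>x\<in>K. schoenflies_class S K x = {x})) \<and>
         ((\<forall>x\<in>K. schoenflies_class S K x = {x}) \<longleftrightarrow>
            schoenflies_relation S K = {(x, x) | x. x \<in> K})"
proof -
  have diag: "{(x, x) | x. x \<in> K} = Id_on K" by auto
  \<comment> \<open>Only (1) and (3) are compared directly; (2) is reached through
    \<open>schoenflies_class_trivial_iff\<close>.\<close>
  have "peano_compactum K \<longleftrightarrow> schoenflies_relation S K = Id_on K"
  proof
    assume K: "peano_compactum K"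
    have "schoenflies_relation S K \<subseteq> Id_on K"
    proof
      fix z assume z: "z \<in> schoenflies_relation S K"
      obtain x y where xy: "z = (x, y)" by (cases z)
      have "x = y"
        using schoenflies_relation_trivial_if_peano[OF assms(1,2) K] z xy by blast
      moreover have "x \<in> K"
        using schoenflies_relation_bounds(2)[of S K] z xy by blast
      ultimately show "z \<in> Id_on K" using xy by (simp add: Id_on_iff)
    qed
    then show "schoenflies_relation S K = Id_on K"
      using schoenflies_relation_bounds(1)[of K S] by blast
  next
    assume R: "schoenflies_relation S K = Id_on K"
    show "peano_compactum K"
    proof (rule ccontr)
      assume n: "\<not> peano_compactum K"
      show False
      proof (rule schoenflies_relation_nontrivial_if_not_peano[OF assms n])
        fix x y assume "(x, y) \<in> schoenflies_relation S K" "x \<noteq> y"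
        then show False unfolding R Id_on_iff by blast
      qed
    qed
  qed
  then show ?thesis
    unfolding schoenflies_class_trivial_iff diag by (simp only: simp_thms)
qed

end
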